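(* Let $Q=(\Omega;z_1,z_2,z_3,z_4)$ be a quadrilateral. Conjugate Function Method: (1) Solve the Dirichlet-Neumann problem associated with $Q$ to obtain its harmonic solution $u_1$, and compute the modulus $h=\mathrm{M}(Q)$. (2) Solve the Dirichlet-Neumann problem associated with the conjugate quadrilateral $\tilde{Q}=(\Omega;z_2,z_3,z_4,z_1)$ to obtain its harmonic solution $u_2$. (3) Then $f=u_1+ihu_2$ is the conformal mapping from $Q$ onto the rectangle $R_h=\{z\in\mathbb{C}:0<\mathrm{Re}\,z<1,\ 0<\mathrm{Im}\,z<h\}$ such that the vertices $(z_1,z_2,z_3,z_4)$ are mapped onto the corners $(1+ih,\ ih,\ 0,\ 1)$, respectively.
   Context: A quadrilateral $Q=(\Omega;z_1,z_2,z_3,z_4)$ is a bounded Jordan domain $\Omega\subset\mathbb{C}$ with marked, positively ordered points $z_1,z_2,z_3,z_4\in\partial\Omega$. There is a canonical conformal map of $Q$ (that is, of $\Omega$) onto a rectangle $R_h=\{z\in\mathbb{C}:0<\mathrm{Re}\,z<1,\ 0<\mathrm{Im}\,z<h\}$ with $z_1,z_2,z_3,z_4$ corresponding to the vertices $1+ih,\ ih,\ 0,\ 1$ respectively. The number $h$ is unique; it is called the modulus of $Q$ and denoted $\mathrm{M}(Q)$. The conjugate quadrilateral of $Q$ is $\tilde{Q}=(\Omega;z_2,z_3,z_4,z_1)$. Dirichlet-Neumann problem: let $\Omega$ be a domain whose boundary $\partial\Omega$ consists of a finite number of regular Jordan curves, so that at every point, except possibly at finitely many points of the boundary, a normal is defined.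 Let $\partial\Omega=A\cup B$, where $A$ and $B$ are both unions of regular Jordan arcs and $A\cap B$ is finite, and let $\psi_A,\psi_B$ be real-valued continuous functions on $A,B$ respectively. Find a function $u$ such that: $u$ is continuous and differentiable in $\overline{\Omega}$; $u(t)=\psi_A(t)$ for all $t\in A$; and $\frac{\partial}{\partial n}u(t)=\psi_B(t)$ for all $t\in B$, where $\partial/\partial n$ denotes differentiation in the direction of the exterior normal. Let $\gamma_1,\gamma_2,\gamma_3,\gamma_4$ be the arcs of $\partial\Omega$ between $(z_1,z_2)$, $(z_2,z_3)$, $(z_3,z_4)$, $(z_4,z_1)$ respectively. The Dirichlet-Neumann problem associated with $Q$ is the one with mixed boundary values $u=0$ on $\gamma_2$, $u=1$ on $\gamma_4$, and $\partial u/\partial n=0$ on $\gamma_1$ and $\gamma_3$; $u_1$ denotes its (unique) harmonic solution. Applying the same definition to $\tilde{Q}$, the (unique) harmonic solution $u_2$ of the problem associated with $\tilde{Q}$ (the conjugate Dirichlet-Neumann problem) satisfies $u_2=0$ on $\gamma_3$, $u_2=1$ on $\gamma_1$, and $\partial u_2/\partial n=0$ on $\gamma_2$ and $\gamma_4$. *)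

theory Defs
  imports "HOL-Complex_Analysis.Complex_Analysis"
begin

definition regular_off :: "real set \<Rightarrow> (real \<Rightarrow> complex) \<Rightarrow> bool" where
  "regular_off S \<gamma> \<longleftrightarrow> finite S \<and> \<gamma> C1_differentiable_on ({0..1} - S) \<and>
     (\<forall>t\<in>{0..1} - S. vector_derivative \<gamma> (at t) \<noteq> 0)"

definition regular_jordan_curve :: "(real \<Rightarrow> complex) \<Rightarrow> bool" where
  "regular_jordan_curve \<gamma> \<longleftrightarrow>
     simple_path \<gamma> \<and> pathfinish \<gamma> = pathstart \<gamma> \<and> (\<exists>S. regular_off S \<gamma>)"

definition regular_jordan_arc :: "(real \<Rightarrow> complex) \<Rightarrow> bool" where
  "regular_jordan_arc \<gamma> \<longleftrightarrow> arc \<gamma> \<and> (\<exists>S. regular_off S \<gamma>)"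

definition regular_domain :: "complex set \<Rightarrow> bool" where
  "regular_domain \<Omega> \<longleftrightarrow> open \<Omega> \<and> connected \<Omega> \<and> \<Omega> \<noteq> {} \<and>
     (\<exists>\<Gamma>. finite \<Gamma> \<and> (\<forall>\<gamma>\<in>\<Gamma>. regular_jordan_curve \<gamma>) \<and>
          frontier \<Omega> = (\<Union>\<gamma>\<in>\<Gamma>. path_image \<gamma>))"

definition union_of_regular_arcs :: "complex set \<Rightarrow> bool" where
  "union_of_regular_arcs A \<longleftrightarrow>
     (\<exists>\<Gamma>. finite \<Gamma> \<and> (\<forall>\<gamma>\<in>\<Gamma>. regular_jordan_arc \<gamma>) \<and> A = (\<Union>\<gamma>\<in>\<Gamma>. path_image \<gamma>))"

text \<open>The boundary is allowed any regular parametrisation: \<open>p\<close> has a normal as soon as some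
  parametrisation is continuously differentiable with non-zero derivative there, so neither a
  base point nor an unlucky choice of exceptional parameters matters.  The last conjunct selects
  the exterior one of the two unit normals.\<close>

definition exterior_normal :: "complex set \<Rightarrow> complex \<Rightarrow> complex \<Rightarrow> bool" where
  "exterior_normal \<Omega> p n \<longleftrightarrow> norm n = 1 \<and>
     (\<exists>\<gamma> S t. simple_path \<gamma> \<and> pathfinish \<gamma> = pathstart \<gamma> \<and> regular_off S \<gamma> \<and>
        path_image \<gamma> \<subseteq> frontier \<Omega> \<and> t \<in> {0<..<1} - S \<and> \<gamma> t = p \<and>
        n \<bullet> vector_derivative \<gamma> (at t) = 0) \<and>
     (\<forall>\<^sub>F s in at_right 0. p - of_real s * n \<in> \<Omega> \<and> p + of_real s * n \<notin> closure \<Omega>)"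

text \<open>\<open>g = u\<^sub>x + \<i> u\<^sub>y\<close> is the gradient and \<open>H z\<close> its derivative, so that
  \<open>Re (H z 1) = u\<^sub>x\<^sub>x\<close> and \<open>Im (H z \<i>) = u\<^sub>y\<^sub>y\<close>.\<close>

definition harmonic_on :: "(complex \<Rightarrow> real) \<Rightarrow> complex set \<Rightarrow> bool" where
  "harmonic_on u \<Omega> \<longleftrightarrow>
     (\<exists>g H. (\<forall>z\<in>\<Omega>. (u has_derivative (\<lambda>v. g z \<bullet> v)) (at z)) \<and>
            (\<forall>z\<in>\<Omega>. (g has_derivative H z) (at z)) \<and>
            (\<forall>v. continuous_on \<Omega> (\<lambda>z. H z v)) \<and>
            (\<forall>z\<in>\<Omega>. Re (H z 1) + Im (H z \<i>) = 0))"

text \<open>\<open>E\<close> is the finite set of boundary points without normal, together with the points where the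
  type of the boundary condition changes.  There the gradient of a solution is in general
  unbounded, so only continuity of \<open>u\<close> is required.  Elsewhere \<open>u\<close> is continuously
  differentiable up to the boundary, with gradient \<open>g\<close>.\<close>

definition dirichlet_neumann ::
  "complex set \<Rightarrow> complex set \<Rightarrow> complex set \<Rightarrow> (complex \<Rightarrow> real) \<Rightarrow> (complex \<Rightarrow> real) \<Rightarrow>
   (complex \<Rightarrow> real) \<Rightarrow> bool" where
  "dirichlet_neumann \<Omega> A B \<psi>A \<psi>B u \<longleftrightarrow>
     regular_domain \<Omega> \<and> frontier \<Omega> = A \<union> B \<and>
     union_of_regular_arcs A \<and> union_of_regular_arcs B \<and> finite (A \<inter> B) \<and>
     continuous_on A \<psi>A \<and> continuous_on B \<psi>B \<and>
     continuous_on (closure \<Omega>) u \<and>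
     (\<forall>t\<in>A. u t = \<psi>A t) \<and>
     (let E = {p \<in> frontier \<Omega>. \<nexists>n. exterior_normal \<Omega> p n} \<union> (A \<inter> B) in
        \<exists>g. (\<forall>z\<in>closure \<Omega> - E. (u has_derivative (\<lambda>v. g z \<bullet> v)) (at z within closure \<Omega>)) \<and>
            continuous_on (closure \<Omega> - E) g \<and>
            (\<forall>t\<in>B - E. \<forall>n. exterior_normal \<Omega> t n \<longrightarrow> g t \<bullet> n = \<psi>B t))"

definition positive_boundary :: "complex set \<Rightarrow> (real \<Rightarrow> complex) \<Rightarrow> bool" where
  "positive_boundary \<Omega> \<gamma> \<longleftrightarrow>
     simple_path \<gamma> \<and> pathfinish \<gamma> = pathstart \<gamma> \<and> \<Omega> = inside (path_image \<gamma>) \<and>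
     (\<forall>z\<in>\<Omega>. winding_number \<gamma> z = 1)"

definition quadrilateral ::
  "complex set \<Rightarrow> complex \<Rightarrow> complex \<Rightarrow> complex \<Rightarrow> complex \<Rightarrow> bool" where
  "quadrilateral \<Omega> z1 z2 z3 z4 \<longleftrightarrow>
     (\<exists>\<gamma> t2 t3 t4. positive_boundary \<Omega> \<gamma> \<and> 0 < t2 \<and> t2 < t3 \<and> t3 < t4 \<and> t4 < 1 \<and>
        \<gamma> 0 = z1 \<and> \<gamma> t2 = z2 \<and> \<gamma> t3 = z3 \<and> \<gamma> t4 = z4)"

text \<open>The closed arc traversed from \<open>a\<close> to \<open>b\<close> in the positive direction; it does not depend on
  the parametrisation \<open>\<gamma>\<close> starting at \<open>a\<close>.\<close>

definition boundary_arc :: "complex set \<Rightarrow> complex \<Rightarrow> complex \<Rightarrow> complex set" where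
  "boundary_arc \<Omega> a b =
     {p. \<exists>\<gamma> s t. positive_boundary \<Omega> \<gamma> \<and> 0 \<le> t \<and> t \<le> s \<and> s < 1 \<and>
           \<gamma> 0 = a \<and> \<gamma> s = b \<and> \<gamma> t = p}"

definition quad_rectangle :: "real \<Rightarrow> complex set" where
  "quad_rectangle h = {z. 0 < Re z \<and> Re z < 1 \<and> 0 < Im z \<and> Im z < h}"

text \<open>A conformal map of a quadrilateral onto a rectangle is understood together with its
  homeomorphic extension to the closures, which gives the correspondence of the vertices a
  meaning.\<close>

definition canonical_conformal_map ::
  "complex set \<Rightarrow> complex \<Rightarrow> complex \<Rightarrow> complex \<Rightarrow> complex \<Rightarrow> real \<Rightarrow> (complex \<Rightarrow> complex) \<Rightarrow> bool"
  where
  "canonical_conformal_map \<Omega> z1 z2 z3 z4 h f \<longleftrightarrow>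
     f holomorphic_on \<Omega> \<and> bij_betw f \<Omega> (quad_rectangle h) \<and>
     (\<exists>g. homeomorphism (closure \<Omega>) (closure (quad_rectangle h)) f g) \<and>
     f z1 = Complex 1 h \<and> f z2 = Complex 0 h \<and> f z3 = 0 \<and> f z4 = 1"

definition quad_modulus ::
  "complex set \<Rightarrow> complex \<Rightarrow> complex \<Rightarrow> complex \<Rightarrow> complex \<Rightarrow> real" where
  "quad_modulus \<Omega> z1 z2 z3 z4 = (THE h. \<exists>f. canonical_conformal_map \<Omega> z1 z2 z3 z4 h f)"

definition quad_dirichlet_neumann_solution ::
  "complex set \<Rightarrow> complex \<Rightarrow> complex \<Rightarrow> complex \<Rightarrow> complex \<Rightarrow> (complex \<Rightarrow> real) \<Rightarrow> bool" where
  "quad_dirichlet_neumann_solution \<Omega> z1 z2 z3 z4 u \<longleftrightarrow>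
     (let \<gamma>1 = boundary_arc \<Omega> z1 z2; \<gamma>2 = boundary_arc \<Omega> z2 z3;
          \<gamma>3 = boundary_arc \<Omega> z3 z4; \<gamma>4 = boundary_arc \<Omega> z4 z1
      in harmonic_on u \<Omega> \<and>
         dirichlet_neumann \<Omega> (\<gamma>2 \<union> \<gamma>4) (\<gamma>1 \<union> \<gamma>3)
           (\<lambda>t. if t \<in> \<gamma>4 then 1 else 0) (\<lambda>t. 0) u)"

end

theory Submission
  imports Defs
begin

text \<open>Choose holomorphic \<open>f\<^sub>1\<close>, \<open>f\<^sub>2\<close> with real parts \<open>u\<^sub>1\<close>, \<open>u\<^sub>2\<close>.  Off finitely many boundary points they
  extend continuously to the boundary, and the vanishing normal derivatives make \<open>Im f\<^sub>1\<close> locally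
  constant on \<open>\<gamma>\<^sub>1\<close>, \<open>\<gamma>\<^sub>3\<close> and \<open>Im f\<^sub>2\<close> locally constant on \<open>\<gamma>\<^sub>2\<close>, \<open>\<gamma>\<^sub>4\<close>.  Continuity of \<open>u\<^sub>1\<close>, \<open>u\<^sub>2\<close> excludes
  jumps at the exceptional points inside these arcs, so \<open>Im f\<^sub>1\<close> has values \<open>b\<^sub>1\<close>, \<open>b\<^sub>3\<close> there.  With
  \<open>c = b\<^sub>1 - b\<^sub>3\<close> the function \<open>- \<i> f\<^sub>1 - c f\<^sub>2\<close> is bounded, has real part \<open>b\<^sub>3\<close> on \<open>\<gamma>\<^sub>1\<close> and \<open>\<gamma>\<^sub>3\<close> and takes finitely
  many imaginary parts on \<open>\<gamma>\<^sub>2\<close> and \<open>\<gamma>\<^sub>4\<close>; a maximum principle forces its real part to be constant, that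
  is, \<open>u\<^sub>1 + \<i> c u\<^sub>2\<close> is holomorphic.  It is continuous on the closure and sends each boundary arc into
  the line through the corresponding side of the rectangle, so its boundary curve winds \<open>\<plusminus> 1\<close> times around
  interior points.  Counting zeros gives \<open>c > 0\<close> and bijectivity onto \<open>R\<^sub>c\<close>.  The same maximum principle,
  applied to the difference of two canonical maps, gives uniqueness, hence \<open>c = M(Q)\<close>.\<close>

section \<open>Maximum principles with mixed boundary data\<close>

text \<open>The obstacle is the exceptional set: \<open>u1\<close> and \<open>u2\<close> are
  continuous there, but nothing controls their gradients, so a conjugate might be discontinuous or
  unbounded. Continuity of the real part is exploited twice. Near a point separating boundary values
  \<open>y1\<close> and \<open>y2\<close> of \<open>Im f\<close>, the product of the distances to
  the two candidate limits tends to zero by a two-constants estimate, and local connectedness of the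
  domain then excludes distinct values. Boundedness of \<open>Im f\<close> comes from the open
  mapping theorem, using on Dirichlet arcs only the limits of the real part.

  On the second and fourth arc the comparison function has no prescribed real part, only finitely
  many heights. An excess of its real part would produce a value in a horizontal half-strip that
  contains no boundary limit at all, and such half-strips are excluded by a Phragmen-Lindeloef
  argument.

  The constant \<open>c\<close> is the increment of the conjugate between the two Neumann arcs, and
  its sign is unknown at first: a winding number that counts zeros cannot be -1. The modulus enters
  only at the very end, as the one height for which a canonical map exists.\<close>

lemma continuous_on_tendsto_subset:
  assumes "continuous_on S f" "x \<in> S" "T \<subseteq> S"
  shows "(f \<longlongrightarrow> f x) (at x within T)"
  using assms by (meson continuous_on tendsto_within_subset)

text \<open>The maximum modulus principle is applied on the superlevel set \<open>K\<close>, not on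
  \<open>D\<close>. With \<open>e\<close> a third of the excess at \<open>z\<close>, the levels
  \<open>C + e\<close>, \<open>C + 2 * e\<close>, \<open>C + 3 * e\<close> are separated: the
  boundary condition keeps \<open>K\<close> away from the frontier of \<open>D\<close>, so
  \<open>K\<close> is compact, and on its own frontier the norm is at most \<open>C + 2 * e\<close>.
  Only an upper limit at the frontier enters; \<open>f\<close> may have no boundary values.\<close>

lemma maximum_modulus_limsup:
  fixes f :: "complex \<Rightarrow> complex"
  assumes "open D" "bounded D" and hol: "f holomorphic_on D"
    and bd: "\<And>p e. p \<in> frontier D \<Longrightarrow> e > 0 \<Longrightarrow> \<forall>\<^sub>F z in at p within D. norm (f z) \<le> C + e"
    and "z \<in> D"
  shows "norm (f z) \<le> C"
proof (rule ccontr)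
  assume neg: "\<not> norm (f z) \<le> C"
  define e where "e = (norm (f z) - C) / 3"
  have e: "e > 0" "norm (f z) = C + 3 * e" using neg by (auto simp: e_def field_simps)
  define K where "K = {w \<in> D. C + 2 * e \<le> norm (f w)}"
  have contf: "continuous_on D f" using hol holomorphic_on_imp_continuous_on by blast
  have KD: "K \<subseteq> D" by (auto simp: K_def)
  have "closed K"
    unfolding closed_limpt
  proof (intro allI impI)
    fix x assume x: "x islimpt K"
    then have nt: "\<not> trivial_limit (at x within K)" by (simp add: trivial_limit_within)
    have evK: "\<forall>\<^sub>F w in at x within K. w \<in> K" by (simp add: eventually_at_filter)
    show "x \<in> K"
    proof (cases "x \<in> D")
      case True
      then have "(f \<longlongrightarrow> f x) (at x within K)"
        using continuous_on_tendsto_subset[OF contf] KD by blast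
      then have "((\<lambda>w. norm (f w)) \<longlongrightarrow> norm (f x)) (at x within K)" by (rule tendsto_norm)
      then have "C + 2 * e \<le> norm (f x)"

        by (rule tendsto_lowerbound[OF _ _ nt]) (use evK in eventually_elim, auto simp: K_def)
      then show ?thesis using True by (auto simp: K_def)
    next
      case False
      have "x \<in> closure D" using x KD islimpt_subset closure_def by blast
      then have "x \<in> frontier D" using False \<open>open D\<close> by (simp add: frontier_def interior_open)
      then have "\<forall>\<^sub>F w in at x within D. norm (f w) \<le> C + e" using bd e by blast
      then have "\<forall>\<^sub>F w in at x within K. norm (f w) \<le> C + e"
        using KD by (meson at_le filter_leD)
      with evK have "\<forall>\<^sub>F w in at x within K. False"
        by eventually_elim (use e in \<open>auto simp: K_def\<close>)
      then show ?thesis using nt by (simp add: trivial_limit_def)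
    qed
  qed
  have "norm (f z) \<le> C + 2 * e"
  proof (rule maximum_modulus_frontier[of f K])
    show "f holomorphic_on interior K"
      using hol KD interior_subset by (meson holomorphic_on_subset order_trans)
    show "continuous_on (closure K) f" using contf KD \<open>closed K\<close> by (simp add: continuous_on_subset)
    show "bounded K" using KD \<open>bounded D\<close> bounded_subset by blast
    show "z \<in> K" using \<open>z \<in> D\<close> e by (auto simp: K_def)
    fix w assume w: "w \<in> frontier K"
    then have "w \<in> K" "w \<notin> interior K" using \<open>closed K\<close> by (auto simp: frontier_def)
    show "norm (f w) \<le> C + 2 * e"
    proof (rule ccontr)
      assume "\<not> norm (f w) \<le> C + 2 * e"
      then have "w \<in> D \<inter> (\<lambda>w. norm (f w)) -` {C + 2 * e <..}" using \<open>w \<in> K\<close> KD by auto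
      moreover have "open (D \<inter> (\<lambda>w. norm (f w)) -` {C + 2 * e <..})"
        by (intro continuous_open_preimage continuous_on_norm contf \<open>open D\<close>) auto
      moreover have "D \<inter> (\<lambda>w. norm (f w)) -` {C + 2 * e <..} \<subseteq> K" by (auto simp: K_def)
      ultimately show False using \<open>w \<notin> interior K\<close> by (auto simp: interior_def)
    qed
  qed
  with e show False by simp
qed

lemma at_within_frontier_nontrivial:
  fixes p :: "'a :: t1_space"
  assumes "open D" "p \<in> frontier D"
  shows "at p within D \<noteq> bot"
  using assms by (auto simp: frontier_def interior_open closure_def trivial_limit_within)

text \<open>On \<open>{z. W z \<in> S}\<close>, with \<open>S\<close> the half-strip, compare \<open>exp (N sinh (k (W - c)))\<close> with \<open>1\<close>:
  \<open>Re (sinh (k (w - c)))\<close> is positive in \<open>S\<close> and vanishes on its boundary, and the polynomial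
  factor takes care of the exceptional points.\<close>

lemma half_strip_avoided:
  fixes W :: "complex \<Rightarrow> complex"
  assumes op: "open \<Omega>" and bo: "bounded \<Omega>" and hol: "W holomorphic_on \<Omega>"
    and E: "finite E" "E \<inter> \<Omega> = {}" and yy: "y < y'"
    and ub: "\<And>z. z \<in> \<Omega> \<Longrightarrow> Re (W z) \<le> b"
    and lim: "\<And>p. p \<in> frontier \<Omega> - E \<Longrightarrow>
       \<exists>\<omega>. (W \<longlongrightarrow> \<omega>) (at p within \<Omega>) \<and> \<not> (a < Re \<omega> \<and> y < Im \<omega> \<and> Im \<omega> < y')"
    and z0: "z0 \<in> \<Omega>"
  shows "\<not> (a < Re (W z0) \<and> y < Im (W z0) \<and> Im (W z0) < y')"
proof
  assume S0: "a < Re (W z0) \<and> y < Im (W z0) \<and> Im (W z0) < y'"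
  \<comment> \<open>\<open>k\<close> stretches the strip to width \<open>pi\<close> and
    \<open>m\<close> is its middle height, so the cosine in \<open>r\<close> is positive inside and
    zero on both horizontal sides; the \<open>sinh\<close> factor is zero on the vertical side
    \<open>Re w = a\<close>.\<close>
  define k where "k = pi / (y' - y)"
  define m where "m = (y + y') / 2"
  have k: "k > 0" using yy by (simp add: k_def)
  have ky: "k * (y' - m) = pi / 2" "k * (y - m) = - (pi / 2)"
    using yy by (simp_all add: k_def m_def field_simps)
  define \<xi> where "\<xi> = (\<lambda>w::complex. of_real k * (w - Complex a m))"
  define r where "r = (\<lambda>w. (exp (k * (Re w - a)) - exp (- (k * (Re w - a)))) / 2 * cos (k * (Im w - m)))"
  have Re_r: "Re ((exp (\<xi> w) - exp (- \<xi> w)) / 2) = r w" for w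
    using cos_minus[of "k * (Im w - m)"]
    by (simp add: \<xi>_def r_def Re_exp diff_divide_distrib left_diff_distrib)
  have contr: "continuous_on UNIV r" unfolding r_def by (intro continuous_intros) auto
  have cos01: "0 < cos (k * (t - m))" if "y < t" "t < y'" for t
  proof (rule cos_gt_zero_pi)
    show "- (pi / 2) < k * (t - m)" unfolding ky(2)[symmetric] using k that by simp
    show "k * (t - m) < pi / 2" unfolding ky(1)[symmetric] using k that by simp
  qed
  define D where "D = {z \<in> \<Omega>. a < Re (W z) \<and> y < Im (W z) \<and> Im (W z) < y'}"
  have contW: "continuous_on \<Omega> W" using hol holomorphic_on_imp_continuous_on by blast
  have "open (\<Omega> \<inter> W -` {w. a < Re w \<and> y < Im w \<and> Im w < y'})"
    by (intro continuous_open_preimage contW op open_Collect_conj open_Collect_less continuous_intros)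
  moreover have "D = \<Omega> \<inter> W -` {w. a < Re w \<and> y < Im w \<and> Im w < y'}" by (auto simp: D_def)
  ultimately have oD: "open D" by simp
  have D\<Omega>: "D \<subseteq> \<Omega>" by (auto simp: D_def)
  obtain R0 where R0: "\<And>z. z \<in> \<Omega> \<union> E \<Longrightarrow> norm z \<le> R0"
    using bo E(1) by (metis bounded_Un bounded_iff finite_imp_bounded)
  define R where "R = 2 * \<bar>R0\<bar> + 1"
  have R: "R > 0" by (simp add: R_def)
  have Rle: "norm ((z - e) / of_real R) \<le> 1" if "z \<in> \<Omega>" "e \<in> E" for z e
  proof -
    have "norm (z - e) \<le> norm z + norm e" by (rule norm_triangle_ineq4)
    also have "\<dots> \<le> R" using R0[of z] R0[of e] that by (auto simp: R_def)
    finally show ?thesis using R by (simp add: norm_divide)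
  qed
  \<comment> \<open>A polynomial vanishing exactly at the exceptional points, scaled to norm at most
    1 on \<Omega>. It does not depend on \<open>N\<close>, so its size at \<open>z0\<close> is fixed
    while \<open>N\<close> grows.\<close>
  define P where "P = (\<lambda>z. \<Prod>e\<in>E. (z - e) / of_real R)"
  have P1: "norm (P z) \<le> 1" if "z \<in> \<Omega>" for z
    unfolding P_def prod_norm[symmetric] using Rle that by (intro prod_le_1) auto
  have P0: "P z0 \<noteq> 0" using E z0 R by (auto simp: P_def)
  have contP: "continuous_on UNIV P" unfolding P_def using R by (intro continuous_intros) auto
  define \<Phi> where "\<Phi> = (\<lambda>N z. P z * exp (of_nat N * ((exp (\<xi> (W z)) - exp (- \<xi> (W z))) / 2)))"
  have n\<Phi>: "norm (\<Phi> N z) = norm (P z) * exp (real N * r (W z))" for N z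
  proof -
    have "Re (of_nat N * ((exp (\<xi> (W z)) - exp (- \<xi> (W z))) / 2)) = real N * r (W z)"
      using Re_r[of "W z"] by simp
    then show ?thesis by (simp add: \<Phi>_def norm_mult)
  qed
  have le1: "norm (\<Phi> N z) \<le> 1" if "z \<in> D" for N z
  proof (rule maximum_modulus_limsup[OF oD _ _ _ that])
    show "bounded D" using bo D\<Omega> bounded_subset by blast
    show "\<Phi> N holomorphic_on D"
      unfolding \<Phi>_def P_def \<xi>_def using R holomorphic_on_subset[OF hol D\<Omega>]
      by (intro holomorphic_intros) auto
    fix p e :: "complex" and \<epsilon> :: real assume p: "p \<in> frontier D" and \<epsilon>: "\<epsilon> > 0"
    have nt: "at p within D \<noteq> bot" using at_within_frontier_nontrivial[OF oD p] .
    have evD: "\<forall>\<^sub>F z in at p within D. z \<in> D" by (simp add: eventually_at_filter)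
    have pD: "p \<notin> D" using p oD by (simp add: frontier_def interior_open)
    have pc: "p \<in> closure \<Omega>" using p D\<Omega> closure_mono by (auto simp: frontier_def)
    show "\<forall>\<^sub>F z in at p within D. norm (\<Phi> N z) \<le> 1 + \<epsilon>"
    proof (cases "p \<in> E")
      case True
      \<comment> \<open>At an exceptional point no limit of \<open>W\<close> is available; the
        one-sided bound \<open>ub\<close> keeps the exponential below \<open>M\<close>, and the zero
        of \<open>P\<close> does the rest.\<close>
      define M where "M = exp (real N * exp (k * (b - a)))"
      have bdd: "norm (\<Phi> N z) \<le> norm (P z) * M" if "z \<in> D" for z
      proof -
        have z: "z \<in> \<Omega>" "a < Re (W z)" "y < Im (W z)" "Im (W z) < y'" using that by (auto simp: D_def)
        have "0 < k * (Re (W z) - a)" using k z by simp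
        then have s0: "exp (- (k * (Re (W z) - a))) \<le> exp (k * (Re (W z) - a))" by simp
        have half_diff: "(A - B) / 2 * 1 \<le> A" if "0 < A" "0 < B" for A B :: real
          using that by simp
        have "r (W z) \<le> (exp (k * (Re (W z) - a)) - exp (- (k * (Re (W z) - a)))) / 2 * 1"
          unfolding r_def using s0 by (intro mult_left_mono) auto
        also have "\<dots> \<le> exp (k * (Re (W z) - a))" by (rule half_diff) auto
        also have "\<dots> \<le> exp (k * (b - a))" using k ub[OF z(1)] by simp
        finally have "real N * r (W z) \<le> real N * exp (k * (b - a))" by (simp add: mult_left_mono)
        then show ?thesis unfolding n\<Phi> M_def by (intro mult_left_mono) auto
      qed
      have "P p = 0" using True E(1) by (auto simp: P_def intro: prod_zero)
      moreover have "(P \<longlongrightarrow> P p) (at p within D)"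
        using continuous_on_tendsto_subset[OF contP] by blast
      ultimately have "((\<lambda>z. norm (P z) * M) \<longlongrightarrow> norm (0::complex) * M) (at p within D)"
        by (intro tendsto_intros) simp
      then have "\<forall>\<^sub>F z in at p within D. norm (P z) * M < 1 + \<epsilon>"
        using \<epsilon> by (intro order_tendstoD) auto
      with evD show ?thesis by eventually_elim (meson bdd less_imp_le order_trans)
    next
      case False
      obtain \<omega> where \<omega>: "(W \<longlongrightarrow> \<omega>) (at p within D)" "\<not> (a < Re \<omega> \<and> y < Im \<omega> \<and> Im \<omega> < y')"
      proof (cases "p \<in> \<Omega>")
        case True
        then have "(W \<longlongrightarrow> W p) (at p within D)"
          using continuous_on_tendsto_subset[OF contW] D\<Omega> by blast
        moreover have "\<not> (a < Re (W p) \<and> y < Im (W p) \<and> Im (W p) < y')" using pD True by (auto simp: D_def)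
        ultimately show ?thesis using that by blast
      next
        case nin: False
        then have "p \<in> frontier \<Omega> - E" using pc False op by (simp add: frontier_def interior_open)
        from lim[OF this] show ?thesis using that D\<Omega> tendsto_within_subset by blast
      qed
      have t1: "((\<lambda>z. Re (W z)) \<longlongrightarrow> Re \<omega>) (at p within D)"
        and t2: "((\<lambda>z. Im (W z)) \<longlongrightarrow> Im \<omega>) (at p within D)"
        using \<omega>(1) by (auto intro: tendsto_intros)
      have "a \<le> Re \<omega>" using t1 by (rule tendsto_lowerbound[OF _ _ nt]) (use evD in eventually_elim, auto simp: D_def)
      moreover have "y \<le> Im \<omega>" using t2 by (rule tendsto_lowerbound[OF _ _ nt]) (use evD in eventually_elim, auto simp: D_def)
      moreover have "Im \<omega> \<le> y'" using t2 by (rule tendsto_upperbound[OF _ _ nt]) (use evD in eventually_elim, auto simp: D_def)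
      \<comment> \<open>The limit lies in the closed half-strip but not in the open one, hence on
        its boundary, where \<open>r\<close> is zero.\<close>
      ultimately have "Re \<omega> = a \<or> Im \<omega> = y \<or> Im \<omega> = y'" using \<omega>(2) by linarith
      moreover have "cos (k * (y' - m)) = 0" "cos (k * (y - m)) = 0" unfolding ky by simp_all
      ultimately have r0: "r \<omega> = 0" by (auto simp: r_def)
      have "((\<lambda>z. r (W z)) \<longlongrightarrow> r \<omega>) (at p within D)"
        by (rule isCont_tendsto_compose[OF _ \<omega>(1)]) (use contr in \<open>simp add: continuous_on_eq_continuous_at\<close>)
      then have "((\<lambda>z. exp (real N * r (W z))) \<longlongrightarrow> exp (real N * 0)) (at p within D)"
        unfolding r0 by (intro tendsto_intros)
      then have "\<forall>\<^sub>F z in at p within D. exp (real N * r (W z)) < 1 + \<epsilon>"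
        using \<epsilon> by (intro order_tendstoD) auto
      with evD show ?thesis
      proof eventually_elim
        case (elim z)
        have "norm (\<Phi> N z) \<le> 1 * exp (real N * r (W z))"
          unfolding n\<Phi> using P1[of z] D\<Omega> elim by (intro mult_right_mono) auto
        then show ?case using elim by simp
      qed
    qed
  qed
  have r0: "r (W z0) > 0"
  proof -
    have "0 < k * (Re (W z0) - a)" using k S0 by simp
    then have "exp (- (k * (Re (W z0) - a))) < exp (k * (Re (W z0) - a))" by simp
    then show ?thesis unfolding r_def using cos01 S0 by (intro mult_pos_pos) auto
  qed
  \<comment> \<open>\<open>le1\<close> holds for every \<open>N\<close> while
    \<open>r (W z0)\<close> is positive; already the linear growth in \<open>exp x >= 1 + x\<close>
    contradicts it.\<close>
  obtain N where N: "real N * r (W z0) > 1 / norm (P z0)"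
    using r0 reals_Archimedean3 by blast
  have "norm (P z0) * (1 / norm (P z0)) < norm (P z0) * (real N * r (W z0))"
    using P0 N by (intro mult_strict_left_mono) auto
  also have "\<dots> \<le> norm (P z0) * exp (real N * r (W z0))"
    using exp_ge_add_one_self[of "real N * r (W z0)"] by (intro mult_left_mono norm_ge_zero) linarith
  also have "\<dots> = norm (\<Phi> N z0)" by (simp add: n\<Phi>)
  also have "\<dots> \<le> 1" using le1 S0 z0 by (auto simp: D_def)
  finally show False using P0 by simp
qed

text \<open>The image is open, so a value of \<open>W\<close> can be moved vertically inside it, and
  an interval of heights is not exhausted by \<open>T\<close>. This moves a point with large real
  part away from the heights that occur as boundary data.\<close>

lemma open_mapping_avoiding_heights:
  fixes W :: "complex \<Rightarrow> complex"
  assumes "open \<Omega>" "connected \<Omega>" "W holomorphic_on \<Omega>" "\<not> W constant_on \<Omega>" "finite T"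
    "z \<in> \<Omega>" "m < Re (W z)"
  obtains z1 where "z1 \<in> \<Omega>" "m < Re (W z1)" "Im (W z1) \<notin> T"
proof -
  have "open (W ` \<Omega>)" using open_mapping_thm[of W \<Omega> \<Omega>] assms by blast
  moreover have "W z \<in> W ` \<Omega>" using assms by blast
  ultimately obtain e where e: "e > 0" "ball (W z) e \<subseteq> W ` \<Omega>" by (meson open_contains_ball)
  have "infinite {Im (W z) <..< Im (W z) + e}" using e by (intro infinite_Ioo) auto
  then obtain t where t: "t \<in> {Im (W z) <..< Im (W z) + e}" "t \<notin> T"
    using \<open>finite T\<close> by (meson finite_subset subsetI)
  have "W z - Complex (Re (W z)) t = Complex 0 (Im (W z) - t)" by (simp add: complex_eq_iff)
  then have "dist (W z) (Complex (Re (W z)) t) < e" using t by (simp add: dist_norm cmod_def)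
  then have "Complex (Re (W z)) t \<in> W ` \<Omega>" using e by auto
  then obtain z1 where "z1 \<in> \<Omega>" "W z1 = Complex (Re (W z)) t" by (metis imageE)
  then show ?thesis using that t assms by auto
qed

text \<open>An excess of the real part can be moved to a height outside \<open>Y\<close>; a thin
  half-strip around that height contains no boundary limit, so \<open>half_strip_avoided\<close>
  applies. The point \<open>q\<close> is there for constant \<open>W\<close>: with its height in
  \<open>Y\<close>, such a function meets \<open>lim\<close> whatever its real part is.\<close>

lemma mixed_boundary_maximum:
  fixes W :: "complex \<Rightarrow> complex"
  assumes op: "open \<Omega>" and con: "connected \<Omega>" and bo: "bounded \<Omega>" and hol: "W holomorphic_on \<Omega>"
    and E: "finite E" "E \<inter> \<Omega> = {}" and Y: "finite Y"
    and ub: "\<And>z. z \<in> \<Omega> \<Longrightarrow> Re (W z) \<le> b"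
    and lim: "\<And>p. p \<in> frontier \<Omega> - E \<Longrightarrow>
       \<exists>\<omega>. (W \<longlongrightarrow> \<omega>) (at p within \<Omega>) \<and> (Re \<omega> \<le> m \<or> Im \<omega> \<in> Y)"
    and q: "q \<in> frontier \<Omega>" "(W \<longlongrightarrow> \<omega>q) (at q within \<Omega>)" "Re \<omega>q \<le> m"
    and z: "z \<in> \<Omega>"
  shows "Re (W z) \<le> m"
proof (rule ccontr)
  assume neg: "\<not> Re (W z) \<le> m"
  show False
  proof (cases "W constant_on \<Omega>")
    case True
    then have "\<forall>\<^sub>F x in at q within \<Omega>. W x = W z"
      using z by (auto simp: constant_on_def eventually_at_filter)
    then have "(W \<longlongrightarrow> W z) (at q within \<Omega>)" by (rule tendsto_eventually)
    then have "\<omega>q = W z" using tendsto_unique[OF at_within_frontier_nontrivial[OF op q(1)]] q(2) by blast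
    then show False using neg q by simp
  next
    case False
    then obtain z1 where z1: "z1 \<in> \<Omega>" "m < Re (W z1)" "Im (W z1) \<notin> Y"
      using open_mapping_avoiding_heights[OF op con hol False Y z, of m] neg by auto
    have "open (- Y)" using Y by (simp add: finite_imp_closed open_Compl)
    then obtain e where e: "e > 0" "ball (Im (W z1)) e \<subseteq> - Y"
      using z1 by (meson ComplI open_contains_ball)
    have "\<not> (m < Re (W z1) \<and> Im (W z1) - e < Im (W z1) \<and> Im (W z1) < Im (W z1) + e)"
    proof (rule half_strip_avoided[OF op bo hol E _ ub _ z1(1)])
      show "Im (W z1) - e < Im (W z1) + e" using e by simp
      fix p assume "p \<in> frontier \<Omega> - E"
      from lim[OF this] obtain \<omega> where \<omega>: "(W \<longlongrightarrow> \<omega>) (at p within \<Omega>)" "Re \<omega> \<le> m \<or> Im \<omega> \<in> Y" by blast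
      moreover have "\<not> (Im (W z1) - e < t \<and> t < Im (W z1) + e)" if "t \<in> Y" for t
        using e(2) that by (auto simp: subset_iff dist_real_def abs_if)
      ultimately show "\<exists>\<omega>. (W \<longlongrightarrow> \<omega>) (at p within \<Omega>) \<and>
          \<not> (m < Re \<omega> \<and> Im (W z1) - e < Im \<omega> \<and> Im \<omega> < Im (W z1) + e)" by fastforce
    qed
    then show False using e z1 by simp
  qed
qed

text \<open>If \<open>Re W\<close> exceeded \<open>m\<close>, one could travel to the right from a value of \<open>W\<close>, at a height
  outside \<open>T\<close>, without ever leaving the image.\<close>

lemma half_plane_bound:
  fixes W :: "complex \<Rightarrow> complex"
  assumes op: "open \<Omega>" and con: "connected \<Omega>" and bo: "bounded \<Omega>" and hol: "W holomorphic_on \<Omega>"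
    and nc: "\<not> W constant_on \<Omega>" and T: "finite T"
    and lim: "\<And>p. p \<in> frontier \<Omega> \<Longrightarrow> (\<exists>\<omega>. (W \<longlongrightarrow> \<omega>) (at p within \<Omega>) \<and> Re \<omega> \<le> m) \<or>
       (\<exists>\<tau>\<in>T. ((\<lambda>z. Im (W z)) \<longlongrightarrow> \<tau>) (at p within \<Omega>))"
    and z: "z \<in> \<Omega>"
  shows "Re (W z) \<le> m"
proof (rule ccontr)
  assume neg: "\<not> Re (W z) \<le> m"
  then obtain z1 where z1: "z1 \<in> \<Omega>" "m < Re (W z1)" "Im (W z1) \<notin> T"
    using open_mapping_avoiding_heights[OF op con hol nc T z, of m] by auto
  have contW: "continuous_on \<Omega> W" using hol holomorphic_on_imp_continuous_on by blast
  \<comment> \<open>The points of \<Omega> over the horizontal ray to the right of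
    \<open>W z1\<close>. The set is closed because \<open>lim\<close> speaks of every frontier point
    and rules each one out as a limit of \<open>X\<close>: the real part would be at most
    \<open>m\<close>, or the height would lie in \<open>T\<close>. An upper bound for the real part
    then comes from compactness of \<open>X\<close>.\<close>
  define X where "X = {x \<in> \<Omega>. Re (W x) \<ge> Re (W z1) \<and> Im (W x) = Im (W z1)}"
  have X\<Omega>: "X \<subseteq> \<Omega>" by (auto simp: X_def)
  have "closed X"
    unfolding closed_limpt
  proof (intro allI impI)
    fix x assume x: "x islimpt X"
    then have nt: "at x within X \<noteq> bot" by (simp add: trivial_limit_within)
    have evX: "\<forall>\<^sub>F w in at x within X. w \<in> X" by (simp add: eventually_at_filter)
    have lims: "Re \<omega> \<ge> Re (W z1) \<and> Im \<omega> = Im (W z1)" if \<omega>: "(W \<longlongrightarrow> \<omega>) (at x within X)" for \<omega>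
    proof
      have "((\<lambda>z. Re (W z)) \<longlongrightarrow> Re \<omega>) (at x within X)" using \<omega> by (intro tendsto_intros)
      then show "Re (W z1) \<le> Re \<omega>"
        by (rule tendsto_lowerbound[OF _ _ nt]) (use evX in eventually_elim, auto simp: X_def)
      have "((\<lambda>z. Im (W z)) \<longlongrightarrow> Im \<omega>) (at x within X)" using \<omega> by (intro tendsto_intros)
      moreover have "((\<lambda>z. Im (W z)) \<longlongrightarrow> Im (W z1)) (at x within X)"
        by (rule tendsto_eventually) (use evX in eventually_elim, auto simp: X_def)
      ultimately show "Im \<omega> = Im (W z1)" using nt tendsto_unique by blast
    qed
    show "x \<in> X"
    proof (cases "x \<in> \<Omega>")
      case True
      then have "(W \<longlongrightarrow> W x) (at x within X)"
        using continuous_on_tendsto_subset[OF contW] X\<Omega> by blast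
      from lims[OF this] show ?thesis using True by (simp add: X_def)
    next
      case False
      have "x \<in> closure \<Omega>" using x X\<Omega> islimpt_subset closure_def by blast
      then have "x \<in> frontier \<Omega>" using False op by (simp add: frontier_def interior_open)
      from lim[OF this] show ?thesis
      proof
        assume "\<exists>\<omega>. (W \<longlongrightarrow> \<omega>) (at x within \<Omega>) \<and> Re \<omega> \<le> m"
        then obtain \<omega> where \<omega>: "(W \<longlongrightarrow> \<omega>) (at x within X)" "Re \<omega> \<le> m"
          using X\<Omega> tendsto_within_subset by blast
        from lims[OF \<omega>(1)] \<omega>(2) z1 show ?thesis by simp
      next
        assume "\<exists>\<tau>\<in>T. ((\<lambda>z. Im (W z)) \<longlongrightarrow> \<tau>) (at x within \<Omega>)"
        then obtain \<tau> where "\<tau> \<in> T" and \<tau>: "((\<lambda>z. Im (W z)) \<longlongrightarrow> \<tau>) (at x within X)"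
          using X\<Omega> tendsto_within_subset by blast
        moreover have "((\<lambda>z. Im (W z)) \<longlongrightarrow> Im (W z1)) (at x within X)"
          by (rule tendsto_eventually) (use evX in eventually_elim, auto simp: X_def)
        ultimately have "\<tau> = Im (W z1)" using nt tendsto_unique by blast
        then show ?thesis using \<open>\<tau> \<in> T\<close> z1 by simp
      qed
    qed
  qed
  moreover have "bounded X" using bo X\<Omega> bounded_subset by blast
  ultimately have "compact X" by (simp add: compact_eq_bounded_closed)
  moreover have "X \<noteq> {}" using z1 by (auto simp: X_def)
  moreover have "continuous_on X (\<lambda>x. Re (W x))"
    using contW X\<Omega> by (intro continuous_intros) (auto intro: continuous_on_subset)
  ultimately obtain x where x: "x \<in> X" "\<And>w. w \<in> X \<Longrightarrow> Re (W w) \<le> Re (W x)"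
    using continuous_attains_sup by metis
  have "open (W ` \<Omega>)" using open_mapping_thm[of W \<Omega> \<Omega>] op con hol nc by blast
  moreover have "W x \<in> W ` \<Omega>" using x X\<Omega> by blast
  ultimately obtain e where e: "e > 0" "ball (W x) e \<subseteq> W ` \<Omega>" by (meson open_contains_ball)
  \<comment> \<open>The image is open, so the ray continues inside it beyond the point of largest
    real part.\<close>
  then have "W x + of_real (e/2) \<in> W ` \<Omega>" by (intro subsetD[OF e(2)]) (simp add: dist_norm)
  then obtain w where w: "w \<in> \<Omega>" "W w = W x + of_real (e/2)" by (metis imageE)
  then have "w \<in> X" using x(1) e by (auto simp: X_def)
  from x(2)[OF this] w e show False by simp
qed

section \<open>Boundary behaviour in Jordan domains\<close>

text \<open>Limits at single frontier points suffice: an estimate on the part of \<open>S\<close> in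
  a ball passes to the limit at every frontier point in that ball. Strict inequality may be lost
  there, hence \<open>e / 2\<close>.\<close>

lemma continuous_extension_to_closure:
  fixes f :: "'a::metric_space \<Rightarrow> 'b::real_normed_vector"
  assumes op: "open S" and contf: "continuous_on S f"
    and lim: "\<And>p. p \<in> frontier S \<Longrightarrow> \<exists>l. (f \<longlongrightarrow> l) (at p within S)"
  obtains g where "continuous_on (closure S) g" "\<And>z. z \<in> S \<Longrightarrow> g z = f z"
proof -
  have fr: "p \<in> frontier S" if "p \<in> closure S" "p \<notin> S" for p
    using that op by (simp add: frontier_def interior_open)
  obtain l where l: "\<And>p. p \<in> frontier S \<Longrightarrow> (f \<longlongrightarrow> l p) (at p within S)" using lim by metis
  define g where "g = (\<lambda>p. if p \<in> S then f p else l p)"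
  have gS: "g z = f z" if "z \<in> S" for z using that by (simp add: g_def)
  have gl: "(f \<longlongrightarrow> g p) (at p within S)" if "p \<in> closure S" for p
    using l[OF fr[OF that]] continuous_on_tendsto_subset[OF contf _ order_refl] by (auto simp: g_def)
  have "continuous_on (closure S) g"
    unfolding continuous_on_iff
  proof (intro ballI allI impI)
    fix p and e :: real assume p: "p \<in> closure S" and e: "0 < e"
    have "\<forall>\<^sub>F z in at p within S. dist (f z) (g p) < e / 2" using gl[OF p] e by (intro tendstoD) auto
    then obtain d where d: "d > 0" "\<And>z. z \<in> S \<Longrightarrow> z \<noteq> p \<Longrightarrow> dist z p < d \<Longrightarrow> dist (f z) (g p) < e / 2"
      unfolding eventually_at by blast
    have d': "dist (f z) (g p) < e / 2" if "z \<in> S" "dist z p < d" for z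
      using d(2)[OF that(1) _ that(2)] that(1) e gS by (cases "z = p") auto
    have "dist (g w) (g p) < e" if w: "w \<in> closure S" "dist w p < d" for w
    proof (cases "w \<in> S")
      case True
      then show ?thesis using d'[OF True w(2)] e gS by auto
    next
      case False
      then have nt: "at w within S \<noteq> bot" using at_within_frontier_nontrivial[OF op] fr w by blast
      have "((\<lambda>z. dist (f z) (g p)) \<longlongrightarrow> dist (g w) (g p)) (at w within S)"
        by (intro tendsto_intros gl[OF w(1)])
      moreover have "\<forall>\<^sub>F z in at w within S. dist (f z) (g p) \<le> e / 2"
        unfolding eventually_at
      proof (intro exI[of _ "d - dist w p"] conjI ballI impI)
        show "0 < d - dist w p" using w by simp
        fix z assume z: "z \<in> S" "z \<noteq> w \<and> dist z w < d - dist w p"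
        have "dist z p \<le> dist z w + dist w p" by (rule dist_triangle)
        then show "dist (f z) (g p) \<le> e / 2" using d'[OF z(1)] z(2) by simp
      qed
      ultimately have "dist (g w) (g p) \<le> e / 2" by (rule tendsto_upperbound[OF _ _ nt])
      then show ?thesis using e by simp
    qed
    then show "\<exists>d>0. \<forall>x'\<in>closure S. dist x' p < d \<longrightarrow> dist (g x') (g p) < e"
      using d(1) by blast
  qed
  then show ?thesis using that gS by blast
qed

text \<open>Orientation is left out: curves delivered by \<open>exterior_normal\<close> or
  \<open>regular_domain\<close> may run either way, and positivity is added as the hypothesis
  \<open>pos\<close> where winding numbers matter. \<open>J\<close> and \<open>\<Omega>\<close>
  abbreviate terms in the image, so that another parametrisation with equal image has the same
  domain after rewriting.\<close>

locale jordan_curve =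
  fixes \<gamma> :: "real \<Rightarrow> complex"
  assumes simple: "simple_path \<gamma>" and closed_path: "pathfinish \<gamma> = pathstart \<gamma>"
begin

abbreviation J :: "complex set" where "J \<equiv> path_image \<gamma>"
abbreviation \<Omega> :: "complex set" where "\<Omega> \<equiv> inside (path_image \<gamma>)"

lemma domain_facts: "open \<Omega>" "connected \<Omega>" "bounded \<Omega>" "\<Omega> \<noteq> {}" "frontier \<Omega> = J" "\<Omega> \<inter> J = {}"
    "closure \<Omega> = \<Omega> \<union> J" "compact J" "simply_connected \<Omega>" "compact (closure \<Omega>)" "J \<noteq> {}"
proof -
  note JI = Jordan_inside_outside[OF simple closed_path]
  show "open \<Omega>" "connected \<Omega>" "bounded \<Omega>" "\<Omega> \<noteq> {}" and fr: "frontier \<Omega> = J" using JI by auto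
  show "\<Omega> \<inter> J = {}" by (simp add: inside_no_overlap)
  show "closure \<Omega> = \<Omega> \<union> J" using fr by (simp add: closure_Un_frontier)
  show "compact J" using simple by (simp add: compact_simple_path_image)
  show "simply_connected \<Omega>" using simple by (rule simply_connected_inside_simple_path)
  show "compact (closure \<Omega>)" using JI by simp
  show "J \<noteq> {}" by simp
qed

lemma notin: "p \<in> J \<Longrightarrow> p \<notin> \<Omega>"
  using domain_facts(6) by blast

lemma nontrivial: "p \<in> J \<Longrightarrow> at p within \<Omega> \<noteq> bot"
  using at_within_frontier_nontrivial[OF domain_facts(1)] domain_facts(5) by blast

lemma near_point: "p \<in> J \<Longrightarrow> 0 < d \<Longrightarrow> \<exists>z. z \<in> \<Omega> \<inter> ball p d"
  using domain_facts(7) closure_approachable[of p \<Omega>] by (auto simp: dist_commute)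

lemma endpoints: "\<gamma> 1 = \<gamma> 0"
  using closed_path by (simp add: pathstart_def pathfinish_def)

lemma injD: "\<lbrakk>\<gamma> s = \<gamma> t; 0 \<le> s; s \<le> 1; 0 \<le> t; t \<le> 1\<rbrakk> \<Longrightarrow> s = t \<or> (s = 0 \<and> t = 1) \<or> (s = 1 \<and> t = 0)"
  using simple unfolding simple_path_def loop_free_def by auto

lemma cont: "continuous_on {0..1} \<gamma>"
  using simple by (simp add: simple_path_def path_def)

text \<open>Moves the base point, so that facts about the start \<open>\<gamma> 0\<close> become
  available at every point of the curve.\<close>

lemma shift:
  assumes "a \<in> {0..1}"
  shows "jordan_curve (shiftpath a \<gamma>)" "path_image (shiftpath a \<gamma>) = J" "shiftpath a \<gamma> 0 = \<gamma> a"
  using assms simple closed_path simple_path_shiftpath[of \<gamma> a] closed_shiftpath[of \<gamma> a]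
    path_image_shiftpath[of a \<gamma>] pathstart_shiftpath[of a \<gamma>]
  by (simp_all add: jordan_curve_def pathstart_def)

section \<open>Local structure of the domain at a boundary point\<close>

lemma small_arc_at_start:
  assumes "0 < \<epsilon>"
  obtains \<delta> where "0 < \<delta>" "\<delta> < 1/2" "\<And>s. \<lbrakk>0 \<le> s; s < \<delta>\<rbrakk> \<Longrightarrow> \<gamma> s \<in> ball (\<gamma> 0) \<epsilon>"
    "\<And>s. \<lbrakk>1 - \<delta> < s; s \<le> 1\<rbrakk> \<Longrightarrow> \<gamma> s \<in> ball (\<gamma> 0) \<epsilon>"
proof -
  obtain d0 where d0: "d0 > 0" "\<And>s. \<lbrakk>s \<in> {0..1}; dist s 0 < d0\<rbrakk> \<Longrightarrow> dist (\<gamma> s) (\<gamma> 0) < \<epsilon>"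
    using cont assms unfolding continuous_on_iff by (metis atLeastAtMost_iff order_refl zero_le_one)
  obtain d1 where d1: "d1 > 0" "\<And>s. \<lbrakk>s \<in> {0..1}; dist s 1 < d1\<rbrakk> \<Longrightarrow> dist (\<gamma> s) (\<gamma> 1) < \<epsilon>"
    using cont assms unfolding continuous_on_iff by (metis atLeastAtMost_iff order_refl zero_le_one)
  show ?thesis
  proof (rule that[of "min (1/3) (min d0 d1)"])
    fix s :: real assume "0 \<le> s" "s < min (1/3) (min d0 d1)"
    then show "\<gamma> s \<in> ball (\<gamma> 0) \<epsilon>" using d0(2)[of s] by (auto simp: dist_real_def dist_commute)
  next
    fix s :: real assume "1 - min (1/3) (min d0 d1) < s" "s \<le> 1"
    then show "\<gamma> s \<in> ball (\<gamma> 0) \<epsilon>" using d1(2)[of s] endpoints by (auto simp: dist_real_def dist_commute)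
  qed (use d0 d1 in auto)
qed

lemma start_notin_middle: "\<lbrakk>0 < \<delta>; \<delta> < 1/2\<rbrakk> \<Longrightarrow> \<gamma> 0 \<notin> \<gamma> ` {\<delta>..1 - \<delta>}"
  using injD[of 0] by fastforce

lemma middle_compact_connected:
  assumes "0 < \<delta>" "\<delta> < 1/2"
  shows "compact (\<gamma> ` {\<delta>..1 - \<delta>})" "connected (\<gamma> ` {\<delta>..1 - \<delta>})"
proof -
  have "continuous_on {\<delta>..1 - \<delta>} \<gamma>" using cont assms by (auto intro: continuous_on_subset)
  then show "compact (\<gamma> ` {\<delta>..1 - \<delta>})" "connected (\<gamma> ` {\<delta>..1 - \<delta>})"
    by (auto intro: compact_continuous_image connected_continuous_image)
qed

text \<open>With the base point moved to \<open>p\<close>, the long arc \<open>C\<close> is the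
  image of a middle parameter interval. Its connectedness is what Janiszewski's theorem asks
  for.\<close>

lemma arc_removal:
  assumes "p \<in> J" "0 < \<epsilon>"
  obtains C where "C \<subseteq> J" "closed C" "connected C" "p \<notin> C" "J - C \<subseteq> ball p \<epsilon>"
proof -
  obtain a where a: "a \<in> {0..1}" "p = \<gamma> a" using assms by (auto simp: path_image_def)
  interpret g: jordan_curve "shiftpath a \<gamma>" using shift a by blast
  define g where "g = shiftpath a \<gamma>"
  obtain \<delta> where \<delta>: "0 < \<delta>" "\<delta> < 1/2" "\<And>s. \<lbrakk>0 \<le> s; s < \<delta>\<rbrakk> \<Longrightarrow> g s \<in> ball (g 0) \<epsilon>"
    "\<And>s. \<lbrakk>1 - \<delta> < s; s \<le> 1\<rbrakk> \<Longrightarrow> g s \<in> ball (g 0) \<epsilon>"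
    using g.small_arc_at_start[OF assms(2)] unfolding g_def by blast
  have J: "J = g ` {0..1}" using shift(2)[OF a(1)] by (simp add: path_image_def g_def)
  have g0: "g 0 = p" using shift(3)[OF a(1)] a by (simp add: g_def)
  show ?thesis
  proof (rule that[of "g ` {\<delta>..1 - \<delta>}"])
    show "g ` {\<delta>..1 - \<delta>} \<subseteq> J" using J \<delta> by auto
    show "closed (g ` {\<delta>..1 - \<delta>})" "connected (g ` {\<delta>..1 - \<delta>})" "p \<notin> g ` {\<delta>..1 - \<delta>}"
      using g.middle_compact_connected[OF \<delta>(1,2)] g.start_notin_middle[OF \<delta>(1,2)] g0
      by (auto simp: g_def compact_imp_closed)
    have "g s \<in> ball p \<epsilon>" if "s \<in> {0..1}" "s \<notin> {\<delta>..1 - \<delta>}" for s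
      using \<delta>(3)[of s] \<delta>(4)[of s] that g0 by (cases "s < \<delta>") auto
    then show "J - g ` {\<delta>..1 - \<delta>} \<subseteq> ball p \<epsilon>" unfolding J by blast
  qed
qed

text \<open>Janiszewski's theorem for \<open>J\<close> and the complement of a disc together with \<open>J\<close> minus a small
  arc: neither separates two points of \<open>\<Omega>\<close> that are close to \<open>p\<close>.\<close>

lemma locally_connected_at_boundary:
  assumes p: "p \<in> J" and \<epsilon>: "0 < \<epsilon>"
  obtains d where "0 < d" "d \<le> \<epsilon>"
    "\<And>x y. \<lbrakk>x \<in> \<Omega> \<inter> ball p d; y \<in> \<Omega> \<inter> ball p d\<rbrakk> \<Longrightarrow>
        \<exists>U. connected U \<and> U \<subseteq> \<Omega> \<inter> ball p \<epsilon> \<and> x \<in> U \<and> y \<in> U"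
proof -
  obtain C where C: "C \<subseteq> J" "closed C" "connected C" "p \<notin> C" "J - C \<subseteq> ball p \<epsilon>"
    using arc_removal[OF p \<epsilon>] by blast
  obtain d0 where d0: "d0 > 0" "ball p d0 \<subseteq> - C"
    using C by (meson ComplI open_Compl open_contains_ball)
  define d where "d = min d0 \<epsilon>"
  \<comment> \<open>The radius \<open>d\<close> keeps \<open>ball p d\<close> off \<open>C\<close>,
    so this ball connects \<open>x\<close> and \<open>y\<close> outside \<open>T\<close>; a
    connected set outside \<open>T\<close> in turn lies in \<open>ball p \<epsilon>\<close>.\<close>
  define T where "T = C \<union> - ball p \<epsilon>"
  show ?thesis
  proof (rule that[of d])
    show "0 < d" "d \<le> \<epsilon>" using d0 \<epsilon> by (auto simp: d_def)
    fix x y assume x: "x \<in> \<Omega> \<inter> ball p d" and y: "y \<in> \<Omega> \<inter> ball p d"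
    have "connected_component (- (J \<union> T)) x y"
    proof (rule Janiszewski)
      show "compact J" by (rule domain_facts(8))
      show "closed T" using C by (simp add: T_def closed_Un closed_Compl)
      have "J \<inter> T = C" using C by (auto simp: T_def)
      then show "connected (J \<inter> T)" using C by simp
      show "connected_component (- J) x y"
        unfolding connected_component_def using domain_facts(2) notin x y by (intro exI[of _ \<Omega>]) blast
      have "ball p d \<subseteq> - T" using d0 by (auto simp: T_def d_def)
      then show "connected_component (- T) x y"
        unfolding connected_component_def using x y by (intro exI[of _ "ball p d"]) auto
    qed
    then obtain U where U: "connected U" "U \<subseteq> - (J \<union> T)" "x \<in> U" "y \<in> U"
      unfolding connected_component_def by blast
    have "U \<subseteq> \<Omega>"
    proof (rule ccontr)
      assume "\<not> U \<subseteq> \<Omega>"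
      then have "U \<inter> frontier \<Omega> \<noteq> {}" using U x by (intro connected_Int_frontier) auto
      then show False using U domain_facts(5) by auto
    qed
    then show "\<exists>U. connected U \<and> U \<subseteq> \<Omega> \<inter> ball p \<epsilon> \<and> x \<in> U \<and> y \<in> U"
      using U by (intro exI[of _ U]) (auto simp: T_def)
  qed
qed

text \<open>Near \<open>p\<close> the quotient \<open>k / l\<close> stays in the disc of radius 1
  around 1, where \<open>Ln\<close> is continuous. The difference \<open>D\<close> of
  \<open>q\<close> and \<open>Ln (k / l)\<close> has the constant exponential \<open>l\<close>, so
  distinct values of it are at least \<open>2 * pi\<close> apart; on the connected sets of
  \<open>locally_connected_at_boundary\<close> it is constant, and \<open>q\<close> inherits the
  limit of \<open>Ln (k / l)\<close> up to that constant.\<close>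

lemma log_has_limit:
  fixes k q :: "complex \<Rightarrow> complex"
  assumes p: "p \<in> J" and contq: "continuous_on \<Omega> q" and k: "(k \<longlongrightarrow> l) (at p within \<Omega>)" and l: "l \<noteq> 0"
    and ex: "\<And>z. z \<in> \<Omega> \<Longrightarrow> exp (q z) = k z"
  shows "\<exists>m. (q \<longlongrightarrow> m) (at p within \<Omega>)"
proof -
  have pn: "p \<notin> \<Omega>" using notin[OF p] .
  have "((\<lambda>z. k z / l) \<longlongrightarrow> l / l) (at p within \<Omega>)" using l by (intro tendsto_intros k) auto
  then have kl: "((\<lambda>z. k z / l) \<longlongrightarrow> 1) (at p within \<Omega>)" using l by simp
  then have "\<forall>\<^sub>F z in at p within \<Omega>. dist (k z / l) 1 < 1" by (rule tendstoD) simp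
  then obtain \<epsilon> where \<epsilon>0: "\<epsilon> > 0" "\<forall>z\<in>\<Omega>. z \<noteq> p \<and> dist z p < \<epsilon> \<longrightarrow> dist (k z / l) 1 < 1"
    unfolding eventually_at by blast
  have \<epsilon>: "\<epsilon> > 0" "\<And>z. \<lbrakk>z \<in> \<Omega>; dist z p < \<epsilon>\<rbrakk> \<Longrightarrow> dist (k z / l) 1 < 1"
    using \<epsilon>0 pn by metis+
  have contk: "continuous_on \<Omega> k"
    using continuous_on_exp[OF contq] ex by (simp cong: continuous_on_cong)
  have nonpos: "k z / l \<notin> \<real>\<^sub>\<le>\<^sub>0" if "z \<in> \<Omega>" "dist z p < \<epsilon>" for z
  proof -
    have "\<bar>Re (k z / l - 1)\<bar> < 1" using \<epsilon>(2)[OF that] abs_Re_le_cmod[of "k z / l - 1"] by (simp add: dist_norm)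
    then show ?thesis by (auto simp: complex_nonpos_Reals_iff)
  qed
  obtain d where d: "0 < d" "d \<le> \<epsilon>"
    "\<And>x y. \<lbrakk>x \<in> \<Omega> \<inter> ball p d; y \<in> \<Omega> \<inter> ball p d\<rbrakk> \<Longrightarrow>
        \<exists>U. connected U \<and> U \<subseteq> \<Omega> \<inter> ball p \<epsilon> \<and> x \<in> U \<and> y \<in> U"
    using locally_connected_at_boundary[OF p \<epsilon>(1)] by blast
  obtain x0 where x0: "x0 \<in> \<Omega> \<inter> ball p d" using near_point[OF p d(1)] by blast
  define D where "D = (\<lambda>z. q z - Ln (k z / l))"
  have Dconst: "D z = D x0" if z: "z \<in> \<Omega> \<inter> ball p d" for z
  proof -
    obtain U where U: "connected U" "U \<subseteq> \<Omega> \<inter> ball p \<epsilon>" "x0 \<in> U" "z \<in> U" using d(3)[OF x0 z] by blast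
    have Us: "x \<in> \<Omega>" "dist x p < \<epsilon>" if "x \<in> U" for x using U that by (auto simp: dist_commute)
    have "D constant_on U"
    proof (rule continuous_discrete_range_constant[OF U(1)])
      show "continuous_on U D" unfolding D_def
        using l Us nonpos U by (intro continuous_intros continuous_on_subset[OF contq] continuous_on_subset[OF contk]) auto
      have eD: "exp (D x) = l" if "x \<in> U" for x
      proof -
        have "k x \<noteq> 0" using ex[OF Us(1)[OF that]] by (metis exp_not_eq_zero)
        then show ?thesis using l ex[OF Us(1)[OF that]] by (simp add: D_def exp_diff)
      qed
      fix x assume x: "x \<in> U"
      show "\<exists>e>0. \<forall>y. y \<in> U \<and> D y \<noteq> D x \<longrightarrow> e \<le> norm (D y - D x)"
      proof (intro exI[of _ "2 * pi"] conjI allI impI)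
        fix y assume y: "y \<in> U \<and> D y \<noteq> D x"
        then have "exp (D y) = exp (D x)" using eD x by simp
        then obtain n :: int where n: "D y = D x + (of_int (2 * n) * pi) * \<i>" by (auto simp: exp_eq)
        then have "n \<noteq> 0" using y by auto
        then have "1 \<le> \<bar>real_of_int n\<bar>" by linarith
        moreover have "norm (D y - D x) = 2 * pi * \<bar>real_of_int n\<bar>" using n by (simp add: norm_mult)
        ultimately show "2 * pi \<le> norm (D y - D x)" by simp
      qed simp
    qed
    then show ?thesis using U by (auto simp: constant_on_def)
  qed
  have "((\<lambda>z. Ln (k z / l)) \<longlongrightarrow> Ln 1) (at p within \<Omega>)" by (intro tendsto_Ln kl) simp
  then have "((\<lambda>z. Ln (k z / l) + D x0) \<longlongrightarrow> Ln 1 + D x0) (at p within \<Omega>)" by (intro tendsto_add tendsto_const)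
  moreover have "\<forall>\<^sub>F z in at p within \<Omega>. Ln (k z / l) + D x0 = q z"
    unfolding eventually_at
    using d(1) Dconst by (intro exI[of _ d]) (force simp: D_def dist_commute algebra_simps)
  ultimately have "(q \<longlongrightarrow> Ln 1 + D x0) (at p within \<Omega>)" by (rule Lim_transform_eventually)
  then show ?thesis by blast
qed

lemma log_exists:
  assumes "k holomorphic_on \<Omega>" "\<And>z. z \<in> \<Omega> \<Longrightarrow> k z \<noteq> 0"
  obtains q where "q holomorphic_on \<Omega>" "\<And>z. z \<in> \<Omega> \<Longrightarrow> exp (q z) = k z"
  using simply_connected_eq_holomorphic_log[OF domain_facts(1)] domain_facts(9) assms by metis

text \<open>Two-constants estimate at \<open>e\<close>; the real part of \<open>- 1 / L\<close>, for a branch \<open>L\<close> of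
  \<open>log ((z - e) / R)\<close>, is a barrier.\<close>

lemma boundary_limit_bound:
  assumes e: "e \<in> J" and r: "0 < r" and G: "G holomorphic_on \<Omega> \<inter> ball e r"
    and G1: "\<And>z. z \<in> \<Omega> \<inter> ball e r \<Longrightarrow> norm (G z) \<le> 1" and \<eta>: "0 < \<eta>" "\<eta> < 1"
    and lim: "\<And>p. p \<in> J \<inter> ball e r - {e} \<Longrightarrow> \<exists>l. (G \<longlongrightarrow> l) (at p within \<Omega>) \<and> norm l \<le> \<eta>"
  shows "\<forall>\<^sub>F z in at e within \<Omega>. norm (G z) \<le> 2 * \<eta>"
proof -
  have en: "e \<notin> \<Omega>" using notin[OF e] .
  obtain B where B: "\<And>z. z \<in> closure \<Omega> \<Longrightarrow> norm z \<le> B"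
    using domain_facts(10) by (meson bounded_iff compact_imp_bounded)
  \<comment> \<open>At this scale \<open>(z - e) / R\<close> has norm at most 1/2 on the closure, so
    \<open>Re L \<le> - ln 2\<close>; hence \<open>L\<close> has no zero and
    \<open>Re (1 / L)\<close> is negative.\<close>
  define R where "R = 4 * \<bar>B\<bar> + 1"
  have R: "R > 0" by (simp add: R_def)
  have zR: "norm (z - e) \<le> R / 2" if "z \<in> closure \<Omega>" for z
    using norm_triangle_ineq4[of z e] B[of z] B[of e] that e domain_facts(7) by (auto simp: R_def)
  obtain L where L: "L holomorphic_on \<Omega>" "\<And>z. z \<in> \<Omega> \<Longrightarrow> exp (L z) = (z - e) / of_real R"
    by (rule log_exists[of "\<lambda>z. (z - e) / of_real R"]) (use R en in \<open>auto intro!: holomorphic_intros\<close>)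
  have ReL: "Re (L z) = ln (norm (z - e) / R)" if "z \<in> \<Omega>" for z
  proof -
    have "exp (Re (L z)) = norm (z - e) / R" using L(2)[OF that] R
      by (metis norm_exp_eq_Re norm_divide norm_of_real abs_of_pos)
    then show ?thesis by (metis ln_exp)
  qed
  have ReL2: "Re (L z) \<le> - ln 2" if "z \<in> \<Omega>" for z
  proof -
    have "z \<noteq> e" using that en by auto
    then have "ln (norm (z - e) / R) \<le> ln (1 / 2)"
      using zR[of z] that domain_facts(7) R by (subst ln_le_cancel_iff) (auto simp: field_simps)
    then show ?thesis using ReL[OF that] by (simp add: ln_div)
  qed
  have ln2: "0 < ln (2::real)" by simp
  have Lnz: "L z \<noteq> 0" if "z \<in> \<Omega>" for z using ReL2[OF that] ln2 by auto
  have Llim: "\<exists>m. (L \<longlongrightarrow> m) (at p within \<Omega>)" if "p \<in> J" "p \<noteq> e" for p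
  proof (rule log_has_limit[OF that(1)])
    show "continuous_on \<Omega> L" using L(1) by (rule holomorphic_on_imp_continuous_on)
    show "((\<lambda>z. (z - e) / of_real R) \<longlongrightarrow> (p - e) / of_real R) (at p within \<Omega>)"
      using R by (intro tendsto_intros) auto
  qed (use that R L in auto)
  define r1 where "r1 = r / 2"
  have r1: "r1 > 0" "r1 < r" using r by (auto simp: r1_def)
  define S where "S = \<Omega> - cball e (r1 / 2)"
  have oS: "open S" using domain_facts(1) by (simp add: S_def open_Diff)
  have contL: "continuous_on \<Omega> L" using L(1) by (rule holomorphic_on_imp_continuous_on)
  \<comment> \<open>Away from \<open>e\<close> the logarithm extends continuously to a compact set,
    so it is bounded, imaginary part included. Near \<open>e\<close> its imaginary part may be
    unbounded if the domain spirals; there only the sign of \<open>Re (1 / L)\<close> and the lower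
    bound \<open>norm (L z) \<ge> - Re (L z)\<close> are used.\<close>
  obtain K where K: "\<And>z. z \<in> S \<Longrightarrow> norm (L z) \<le> K"
  proof -
    obtain g where g: "continuous_on (closure S) g" "\<And>z. z \<in> S \<Longrightarrow> g z = L z"
    proof (rule continuous_extension_to_closure[OF oS])
      show "continuous_on S L" using contL by (rule continuous_on_subset) (auto simp: S_def)
      fix p assume p: "p \<in> frontier S"
      have "closure S \<subseteq> - ball e (r1 / 2)" by (rule closure_minimal) (auto simp: S_def)
      then have pe: "p \<noteq> e" using p r1 by (auto simp: frontier_def)
      have pc: "p \<in> closure \<Omega>" using p closure_mono[of S \<Omega>] by (auto simp: S_def frontier_def)
      have "\<exists>m. (L \<longlongrightarrow> m) (at p within \<Omega>)"
      proof (cases "p \<in> \<Omega>")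
        case True
        then show ?thesis using continuous_on_tendsto_subset[OF contL] by blast
      next
        case False
        then show ?thesis using Llim pc pe domain_facts(7) by blast
      qed
      then show "\<exists>m. (L \<longlongrightarrow> m) (at p within S)"
        using tendsto_within_subset[of L _ p \<Omega> S] by (auto simp: S_def)
    qed blast
    have "bounded S" using domain_facts(3) by (rule bounded_subset) (auto simp: S_def)
    then have "compact (closure S)" by simp
    then have "bounded (g ` closure S)" using g(1) by (intro compact_imp_bounded compact_continuous_image)
    then obtain K where "\<And>z. z \<in> closure S \<Longrightarrow> norm (g z) \<le> K" by (auto simp: bounded_iff)
    then show ?thesis using that g(2) closure_subset by (metis subsetD)
  qed
  define \<kappa> where "\<kappa> = ln 2 / (\<bar>K\<bar> + 1)\<^sup>2"
  have \<kappa>: "\<kappa> > 0" using ln2 by (auto simp: \<kappa>_def intro!: divide_pos_pos)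
  have Re1: "Re (1 / L z) = Re (L z) / (norm (L z))\<^sup>2" for z
    by (simp add: Re_divide cmod_power2)
  have Rele0: "Re (1 / L z) \<le> 0" if "z \<in> \<Omega>" for z
  proof -
    have "Re (L z) \<le> 0" using ReL2[OF that] ln2 by linarith
    then show ?thesis unfolding Re1 by (simp add: divide_nonpos_nonneg)
  qed
  have Rele\<kappa>: "Re (1 / L z) \<le> - \<kappa>" if "z \<in> S" for z
  proof -
    have z: "z \<in> \<Omega>" using that by (simp add: S_def)
    have "ln 2 / (\<bar>K\<bar> + 1)\<^sup>2 \<le> ln 2 / (norm (L z))\<^sup>2"
      using K[OF that] ln2 Lnz[OF z] by (intro divide_left_mono power_mono mult_pos_pos) auto
    also have "\<dots> \<le> - Re (L z) / (norm (L z))\<^sup>2"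
      using ReL2[OF z] by (intro divide_right_mono) auto
    finally show ?thesis unfolding Re1 \<kappa>_def by simp
  qed
  \<comment> \<open>On \<open>S\<close>, which contains the circular part of the frontier of
    \<open>D\<close> inside \<Omega>, \<open>Re (1 / L) \<le> - \<kappa>\<close>. With this
    \<open>lam\<close> the barrier lowers the trivial bound 1 for \<open>G\<close> there to
    \<open>\<eta>\<close>, the bound valid on \<open>J\<close>.\<close>
  define lam where "lam = - ln \<eta> / \<kappa>"
  have lam: "lam > 0" using \<eta> \<kappa> by (simp add: lam_def divide_neg_pos)
  have explam: "exp (- (lam * \<kappa>)) = \<eta>" using \<kappa> \<eta> by (simp add: lam_def)
  define D where "D = \<Omega> \<inter> ball e r1"
  have oD: "open D" and D\<Omega>: "D \<subseteq> \<Omega>" and Dr: "D \<subseteq> \<Omega> \<inter> ball e r"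
    using domain_facts(1) r1 by (auto simp: D_def)
  \<comment> \<open>The factor vanishing at \<open>e\<close> occurs once while the rest is raised to
    the power \<open>N\<close>; letting \<open>N\<close> grow removes it from the estimate
    (\<open>Gle\<close>).\<close>
  define \<Phi> where "\<Phi> = (\<lambda>N z. G z ^ N * exp (of_real (real N * lam) * (1 / L z)) * ((z - e) / of_real R))"
  have n\<Phi>: "norm (\<Phi> N z) = norm (G z) ^ N * exp (real N * (lam * Re (1 / L z))) * (norm (z - e) / R)" for N z
    using R by (simp add: \<Phi>_def norm_mult norm_power norm_divide Re_divide mult.assoc)
  have exple1: "exp (real N * (lam * Re (1 / L z))) \<le> 1" if "z \<in> \<Omega>" for N z
    using Rele0[OF that] lam by (simp add: mult_nonneg_nonpos)
  have zR1: "norm (z - e) / R \<le> 1" if "z \<in> \<Omega>" for z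
    using zR[of z] that domain_facts(7) R by (auto simp: field_simps)
  have hol\<Phi>: "\<Phi> N holomorphic_on \<Omega> \<inter> ball e r" for N
    unfolding \<Phi>_def using R Lnz G holomorphic_on_subset[OF L(1), of "\<Omega> \<inter> ball e r"]
    by (intro holomorphic_intros) auto
  have main: "norm (\<Phi> N z) \<le> \<eta> ^ N" if "z \<in> D" for N z
  proof (rule maximum_modulus_limsup[OF oD _ _ _ that])
    show "bounded D" using domain_facts(3) D\<Omega> bounded_subset by blast
    show "\<Phi> N holomorphic_on D" using hol\<Phi> Dr holomorphic_on_subset by blast
    fix p :: complex and \<epsilon> :: real assume p: "p \<in> frontier D" and \<epsilon>: "\<epsilon> > 0"
    have evD: "\<forall>\<^sub>F z in at p within D. z \<in> D" by (simp add: eventually_at_filter)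
    have pD: "p \<notin> D" using p oD by (simp add: frontier_def interior_open)
    have pcl: "p \<in> closure D" using p by (simp add: frontier_def)
    have pc: "p \<in> closure \<Omega>" using pcl closure_mono[OF D\<Omega>] by blast
    have "closure D \<subseteq> cball e r1" by (rule closure_minimal) (auto simp: D_def)
    then have pr1: "p \<in> cball e r1" using pcl by blast
    then have pr: "p \<in> ball e r" using r1 by auto
    show "\<forall>\<^sub>F z in at p within D. norm (\<Phi> N z) \<le> \<eta> ^ N + \<epsilon>"
    proof (cases "p \<in> \<Omega>")
      case True
      then have "((\<lambda>z. norm (\<Phi> N z)) \<longlongrightarrow> norm (\<Phi> N p)) (at p within D)"
        using continuous_on_tendsto_subset[OF holomorphic_on_imp_continuous_on[OF hol\<Phi>] _ Dr] pr
        by (intro tendsto_norm) auto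
      moreover have "norm (\<Phi> N p) \<le> \<eta> ^ N"
      proof -
        have "p \<notin> ball e r1" using pD True by (simp add: D_def)
        then have pS: "p \<in> S" using True r1 by (auto simp: S_def)
        have "real N * (lam * Re (1 / L p)) \<le> real N * (lam * (- \<kappa>))"
          using Rele\<kappa>[OF pS] lam by (intro mult_left_mono) auto
        then have "exp (real N * (lam * Re (1 / L p))) \<le> exp (real N * (- (lam * \<kappa>)))" by simp
        also have "\<dots> = \<eta> ^ N" by (simp only: exp_of_nat_mult explam)
        finally have ex: "exp (real N * (lam * Re (1 / L p))) \<le> \<eta> ^ N" .
        have "norm (G p) ^ N \<le> 1" using G1[of p] True pr by (intro power_le_one) auto
        then have "norm (G p) ^ N * exp (real N * (lam * Re (1 / L p))) * (norm (p - e) / R) \<le> 1 * \<eta> ^ N * 1"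
          using ex zR1[OF True] R \<eta> by (intro mult_mono) auto
        then show ?thesis by (simp add: n\<Phi>)
      qed
      ultimately have "\<forall>\<^sub>F z in at p within D. norm (\<Phi> N z) < \<eta> ^ N + \<epsilon>"
        using \<epsilon> by (intro order_tendstoD) auto
      then show ?thesis by (rule eventually_mono) simp
    next
      case False
      then have pJ: "p \<in> J" using pc domain_facts(7) by blast
      show ?thesis
      proof (cases "p = e")
        case True
        have "((\<lambda>z. norm (z - e) / R) \<longlongrightarrow> norm (p - e) / R) (at p within D)"
          using R by (intro tendsto_intros) auto
        then have "\<forall>\<^sub>F z in at p within D. norm (z - e) / R < \<eta> ^ N + \<epsilon>"
          using \<epsilon> \<eta> True by (intro order_tendstoD) (auto intro: add_pos_pos)
        with evD show ?thesis
        proof eventually_elim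
          case (elim z)
          then have z: "z \<in> \<Omega>" "z \<in> \<Omega> \<inter> ball e r" using D\<Omega> Dr by auto
          have "norm (G z) ^ N \<le> 1" using G1[OF z(2)] by (intro power_le_one) auto
          then have "norm (\<Phi> N z) \<le> 1 * 1 * (norm (z - e) / R)"
            unfolding n\<Phi> using exple1[OF z(1)] R by (intro mult_mono) auto
          then show ?case using elim by simp
        qed
      next
        case False
        then obtain l where l: "(G \<longlongrightarrow> l) (at p within \<Omega>)" "norm l \<le> \<eta>" using lim pJ pr by blast
        have "(G \<longlongrightarrow> l) (at p within D)" using tendsto_within_subset[OF l(1) D\<Omega>] .
        then have "((\<lambda>z. norm (G z) ^ N) \<longlongrightarrow> norm l ^ N) (at p within D)" by (intro tendsto_intros)
        moreover have "norm l ^ N < \<eta> ^ N + \<epsilon>" using power_mono[OF l(2), of N] \<epsilon> by simp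
        ultimately have "\<forall>\<^sub>F z in at p within D. norm (G z) ^ N < \<eta> ^ N + \<epsilon>" by (rule order_tendstoD(2))
        with evD show ?thesis
        proof eventually_elim
          case (elim z)
          then have z: "z \<in> \<Omega>" using D\<Omega> by auto
          have "norm (\<Phi> N z) \<le> norm (G z) ^ N * 1 * 1"
            unfolding n\<Phi> using exple1[OF z] zR1[OF z] R by (intro mult_mono) auto
          then show ?case using elim by simp
        qed
      qed
    qed
  qed
  have Gle: "norm (G z) * exp (lam * Re (1 / L z)) \<le> \<eta>" if z: "z \<in> D" for z
  proof (rule ccontr)
    define x where "x = norm (G z) * exp (lam * Re (1 / L z))"
    define c where "c = norm (z - e) / R"
    have "z \<noteq> e" using z D\<Omega> en by auto
    then have c: "c > 0" using R by (simp add: c_def)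
    assume "\<not> norm (G z) * exp (lam * Re (1 / L z)) \<le> \<eta>"
    then have "1 < x / \<eta>" using \<eta> by (simp add: x_def)
    then obtain N where N: "1 / c < (x / \<eta>) ^ N" using real_arch_pow by blast
    have "x ^ N * c \<le> \<eta> ^ N"
      using main[OF z, of N] by (simp add: n\<Phi> x_def c_def power_mult_distrib exp_of_nat_mult)
    then have "(x / \<eta>) ^ N * c \<le> 1" using \<eta> by (simp add: power_divide field_simps)
    then show False using N c by (simp add: field_simps)
  qed
  \<comment> \<open>With this \<open>M\<close> the barrier costs at most a factor 2 close to
    \<open>e\<close>: \<open>norm (L z) \<ge> M\<close> gives
    \<open>lam * \<bar>Re (1 / L z)\<bar> \<le> lam / M = ln 2\<close>.\<close>
  define M where "M = lam / ln 2"
  have M: "M > 0" using lam ln2 by (simp add: M_def)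
  show ?thesis
    unfolding eventually_at
  proof (intro exI[of _ "min r1 (R * exp (- M))"] conjI ballI impI)
    show "0 < min r1 (R * exp (- M))" using r1 R by simp
    fix z assume z: "z \<in> \<Omega>" "z \<noteq> e \<and> dist z e < min r1 (R * exp (- M))"
    then have zD: "z \<in> D" by (auto simp: D_def dist_commute)
    have "norm (z - e) / R \<le> exp (- M)" using z R by (simp add: dist_norm field_simps)
    then have "ln (norm (z - e) / R) \<le> ln (exp (- M))" using z R by (subst ln_le_cancel_iff) auto
    then have "ln (norm (z - e) / R) \<le> - M" by simp
    then have ReM: "Re (L z) \<le> - M" using ReL[OF z(1)] by simp
    then have nL: "M \<le> norm (L z)" using abs_Re_le_cmod[of "L z"] by linarith
    have "\<bar>Re (1 / L z)\<bar> \<le> norm (1 / L z)" by (rule abs_Re_le_cmod)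
    also have "\<dots> \<le> 1 / M" using nL M by (simp add: norm_divide frac_le)
    finally have "- Re (1 / L z) \<le> 1 / M" by linarith
    then have "lam * (- Re (1 / L z)) \<le> lam * (1 / M)" using lam by (intro mult_left_mono) auto
    then have "- (lam * Re (1 / L z)) \<le> ln 2" using lam ln2 by (simp add: M_def)
    then have e2: "exp (- (lam * Re (1 / L z))) \<le> 2" by (metis exp_le_cancel_iff exp_ln zero_less_numeral)
    have "norm (G z) = norm (G z) * exp (lam * Re (1 / L z)) * exp (- (lam * Re (1 / L z)))"
      by (simp add: mult.assoc flip: exp_add)
    also have "\<dots> \<le> \<eta> * 2" using Gle[OF zD] e2 \<eta> by (intro mult_mono) auto
    finally show "norm (G z) \<le> 2 * \<eta>" by simp
  qed
qed


text \<open>Since \<open>Re f\<close> is continuous at \<open>e\<close>, boundary limits of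
  \<open>X\<close> near \<open>e\<close> are close to \<open>\<i> * y1\<close> or
  \<open>\<i> * y2\<close>. So the product of the two differences is small on the boundary, by
  \<open>boundary_limit_bound\<close> also inside, and a connected set near \<open>e\<close> cannot
  pass from one of two distinct values to the other.\<close>

lemma no_jump:
  assumes hol: "f holomorphic_on \<Omega>" and u: "continuous_on (closure \<Omega>) u"
    and fu: "\<And>z. z \<in> \<Omega> \<Longrightarrow> Re (f z) = u z"
    and \<delta>: "0 < \<delta>" "\<delta> < 1/2"
    and right: "\<And>s. \<lbrakk>0 < s; s < \<delta>\<rbrakk> \<Longrightarrow> ((\<lambda>z. Im (f z)) \<longlongrightarrow> y1) (at (\<gamma> s) within \<Omega>)"
    and left: "\<And>s. \<lbrakk>1 - \<delta> < s; s < 1\<rbrakk> \<Longrightarrow> ((\<lambda>z. Im (f z)) \<longlongrightarrow> y2) (at (\<gamma> s) within \<Omega>)"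
  shows "y1 = y2" "(f \<longlongrightarrow> Complex (u (\<gamma> 0)) y1) (at (\<gamma> 0) within \<Omega>)"
proof -
  define e where "e = \<gamma> 0"
  have e: "e \<in> J" by (auto simp: e_def path_image_def)
  have Jcl: "J \<subseteq> closure \<Omega>" and \<Omega>cl: "\<Omega> \<subseteq> closure \<Omega>" using domain_facts(7) by auto
  define X where "X = (\<lambda>z. f z - of_real (u e))"
  have ulim: "(u \<longlongrightarrow> u p) (at p within \<Omega>)" if "p \<in> J" for p
    using continuous_on_tendsto_subset[OF u _ \<Omega>cl] that Jcl by blast
  obtain r0 where r0: "r0 > 0" "\<And>s. s \<in> {0..1} \<Longrightarrow> \<gamma> s \<in> ball e r0 \<Longrightarrow> s \<in> {0..<\<delta>} \<union> {1-\<delta><..1}"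
  proof -
    have "open (- \<gamma> ` {\<delta>..1 - \<delta>})" "e \<in> - \<gamma> ` {\<delta>..1 - \<delta>}"
      using middle_compact_connected[OF \<delta>] start_notin_middle[OF \<delta>] by (auto simp: e_def compact_imp_closed open_Compl)
    then obtain r where r: "r > 0" "ball e r \<subseteq> - \<gamma> ` {\<delta>..1 - \<delta>}" by (meson open_contains_ball)
    show ?thesis
    proof (rule that[OF r(1)])
      fix s :: real assume s: "s \<in> {0..1}" "\<gamma> s \<in> ball e r"
      then have "s \<notin> {\<delta>..1 - \<delta>}" using r(2) by blast
      then show "s \<in> {0..<\<delta>} \<union> {1-\<delta><..1}" using s by auto
    qed
  qed
  have limX: "\<exists>y\<in>{y1, y2}. (X \<longlongrightarrow> Complex (u p - u e) y) (at p within \<Omega>)"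
    if p: "p \<in> J \<inter> ball e r0 - {e}" for p
  proof -
    obtain s where s: "s \<in> {0..1}" "p = \<gamma> s" using p by (auto simp: path_image_def)
    have "s \<noteq> 0" "s \<noteq> 1" using p s endpoints by (auto simp: e_def)
    then have "(0 < s \<and> s < \<delta>) \<or> (1 - \<delta> < s \<and> s < 1)" using r0(2)[OF s(1)] p s by auto
    then obtain y where y: "y \<in> {y1, y2}" "((\<lambda>z. Im (f z)) \<longlongrightarrow> y) (at p within \<Omega>)"
      using right left s by blast
    have "\<forall>\<^sub>F z in at p within \<Omega>. u z = Re (f z)" using fu by (auto simp: eventually_at_filter)
    then have "((\<lambda>z. Re (f z)) \<longlongrightarrow> u p) (at p within \<Omega>)"
      using ulim p by (auto intro: Lim_transform_eventually)
    with y(2) have "(f \<longlongrightarrow> Complex (u p) y) (at p within \<Omega>)" by (simp add: tendsto_complex_iff)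
    then have "(X \<longlongrightarrow> Complex (u p) y - of_real (u e)) (at p within \<Omega>)"
      unfolding X_def by (intro tendsto_diff tendsto_const)
    moreover have "Complex (u p) y - of_real (u e) = Complex (u p - u e) y" by (simp add: complex_eq_iff)
    ultimately have "(X \<longlongrightarrow> Complex (u p - u e) y) (at p within \<Omega>)" by simp
    then show ?thesis using y by blast
  qed
  \<comment> \<open>Nothing bounds \<open>f\<close> near \<open>e\<close>, hence the division:
    \<open>Re X \<ge> -1\<close> close to \<open>e\<close>, so \<open>X + 2\<close> has norm at
    least 1 and \<open>G\<close> is bounded by \<open>C\<close>.\<close>
  define G where "G = (\<lambda>z. (X z - \<i> * of_real y1) * (X z - \<i> * of_real y2) / (X z + 2)\<^sup>2)"
  define C where "C = (3 + \<bar>y1\<bar>) * (3 + \<bar>y2\<bar>)"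
  have C: "C > 0" by (auto simp: C_def intro!: mult_pos_pos add_pos_nonneg)
  have quot: "norm ((x - \<i> * of_real y) / (x + 2)) \<le> 3 + \<bar>y\<bar>" if "-1 \<le> Re x" for x :: complex and y
  proof -
    have "1 \<le> \<bar>Re (x + 2)\<bar>" using that by simp
    also have "\<dots> \<le> norm (x + 2)" by (rule abs_Re_le_cmod)
    finally have n1: "1 \<le> norm (x + 2)" .
    have "norm (x - \<i> * of_real y) = norm ((x + 2) - (2 + \<i> * of_real y))" by (simp add: algebra_simps)
    also have "\<dots> \<le> norm (x + 2) + norm (2 + \<i> * of_real y)" by (rule norm_triangle_ineq4)
    also have "norm (2 + \<i> * of_real y) \<le> 2 + \<bar>y\<bar>" by (rule norm_triangle_le) (simp add: norm_mult)
    also have "2 + \<bar>y\<bar> \<le> (2 + \<bar>y\<bar>) * norm (x + 2)" using n1 by (simp add: mult_le_cancel_left1)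
    finally have "norm (x - \<i> * of_real y) \<le> (3 + \<bar>y\<bar>) * norm (x + 2)" by (simp add: algebra_simps)
    then show ?thesis using n1 by (simp add: norm_divide divide_le_eq)
  qed
  have Gsplit: "(x - \<i> * of_real y1) * (x - \<i> * of_real y2) / (x + 2)\<^sup>2
      = ((x - \<i> * of_real y1) / (x + 2)) * ((x - \<i> * of_real y2) / (x + 2))" for x :: complex
    by (simp add: power2_eq_square)
  have Glim0: "\<forall>\<^sub>F z in at e within \<Omega>. norm (G z) < \<epsilon>" if \<epsilon>: "\<epsilon> > 0" for \<epsilon>
  proof -
    \<comment> \<open>The term \<open>1/2\<close> secures \<open>\<eta> < 1\<close>; the factor 3
      leaves room for the factor 2 lost in \<open>boundary_limit_bound\<close>.\<close>
    define \<eta> where "\<eta> = min (1/2) (\<epsilon> / (3 * C))"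
    have \<eta>: "0 < \<eta>" "\<eta> < 1" "2 * \<eta> * C < \<epsilon>"
    proof -
      have "\<eta> \<le> \<epsilon> / (3 * C)" by (simp add: \<eta>_def)
      then have "\<eta> * (3 * C) \<le> \<epsilon>" using C by (simp add: pos_le_divide_eq)
      then show "2 * \<eta> * C < \<epsilon>" using \<epsilon> C by (simp add: algebra_simps)
    qed (use \<epsilon> C in \<open>auto simp: \<eta>_def\<close>)
    have "\<exists>d>0. \<forall>z\<in>closure \<Omega>. dist z e < d \<longrightarrow> dist (u z) (u e) < \<eta>"
      using u e Jcl \<eta>(1) unfolding continuous_on_iff by blast
    then obtain d where d: "d > 0" "\<And>z. z \<in> closure \<Omega> \<Longrightarrow> dist z e < d \<Longrightarrow> \<bar>u z - u e\<bar> < \<eta>"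
      by (auto simp: dist_real_def)
    define r where "r = min d r0"
    have r: "r > 0" using d r0 by (simp add: r_def)
    have ReX: "-1 \<le> Re (X z)" if "z \<in> \<Omega> \<inter> ball e r" for z
      using d(2)[of z] that \<Omega>cl fu[of z] \<eta> by (auto simp: X_def r_def dist_commute abs_if split: if_splits)
    have "\<forall>\<^sub>F z in at e within \<Omega>. norm (G z / of_real C) \<le> 2 * \<eta>"
    proof (rule boundary_limit_bound[OF e r _ _ \<eta>(1,2)])
      have X2: "X z + 2 \<noteq> 0" if "z \<in> \<Omega> \<inter> ball e r" for z
        using ReX[OF that] by (auto simp: complex_eq_iff)
      have "X holomorphic_on \<Omega> \<inter> ball e r"
        unfolding X_def by (intro holomorphic_intros holomorphic_on_subset[OF hol]) auto
      then show "(\<lambda>z. G z / of_real C) holomorphic_on \<Omega> \<inter> ball e r"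
        unfolding G_def using X2 C by (intro holomorphic_intros) auto
      show "norm (G z / of_real C) \<le> 1" if z: "z \<in> \<Omega> \<inter> ball e r" for z
      proof -
        have "norm (G z) \<le> C"
          unfolding G_def Gsplit C_def norm_mult by (intro mult_mono quot ReX[OF z]) auto
        then show ?thesis using C by (simp add: norm_divide)
      qed
      fix p assume p: "p \<in> J \<inter> ball e r - {e}"
      then have p0: "p \<in> J \<inter> ball e r0 - {e}" by (auto simp: r_def)
      from limX[OF this] obtain y where y: "y \<in> {y1, y2}" "(X \<longlongrightarrow> Complex (u p - u e) y) (at p within \<Omega>)" by blast
      define x where "x = Complex (u p - u e) y"
      have ud: "\<bar>u p - u e\<bar> < \<eta>" using d(2)[of p] p Jcl by (auto simp: r_def dist_commute)
      then have Rx: "-1 \<le> Re x" using \<eta> by (simp add: x_def)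
      have x2: "x + 2 \<noteq> 0" using Rx by (auto simp: complex_eq_iff)
      have "((\<lambda>z. G z / of_real C) \<longlongrightarrow> ((x - \<i> * of_real y1) * (x - \<i> * of_real y2) / (x + 2)\<^sup>2) / of_real C) (at p within \<Omega>)"
        unfolding G_def using x2 y(2) C by (intro tendsto_intros) (auto simp: x_def)
      moreover have "norm (((x - \<i> * of_real y1) * (x - \<i> * of_real y2) / (x + 2)\<^sup>2) / of_real C) \<le> \<eta>"
      proof -
        have small: "norm ((x - \<i> * of_real y) / (x + 2)) \<le> \<eta>"
        proof -
          have "1 \<le> \<bar>Re (x + 2)\<bar>" using Rx by simp
          also have "\<dots> \<le> norm (x + 2)" by (rule abs_Re_le_cmod)
          finally have n1: "1 \<le> norm (x + 2)" .
          have "x - \<i> * of_real y = of_real (u p - u e)" by (simp add: x_def complex_eq_iff)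
          then have "norm (x - \<i> * of_real y) = \<bar>u p - u e\<bar>" by (simp only: norm_of_real)
          then have "norm (x - \<i> * of_real y) \<le> \<eta> * 1" using ud by simp
          also have "\<dots> \<le> \<eta> * norm (x + 2)" using n1 \<eta> by (intro mult_left_mono) auto
          finally show ?thesis using n1 \<eta>(1) by (simp add: norm_divide divide_le_eq less_imp_le)
        qed
        have C3: "\<eta> * (3 + \<bar>t\<bar>) \<le> \<eta> * C" if "t \<in> {y1, y2}" for t
        proof -
          have "(3 + \<bar>y1\<bar>) * 1 \<le> C" "1 * (3 + \<bar>y2\<bar>) \<le> C" unfolding C_def by (intro mult_mono; simp)+
          then show ?thesis using \<eta>(1) that by (intro mult_left_mono) auto
        qed
        have le: "norm ((x - \<i> * of_real y) / (x + 2)) * norm ((x - \<i> * of_real t) / (x + 2)) \<le> \<eta> * C"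
          if "t \<in> {y1, y2}" for t
          by (rule order_trans[OF mult_mono[OF small quot[OF Rx]] C3[OF that]]) (use \<eta> in auto)
        have "norm (((x - \<i> * of_real y1) / (x + 2)) * ((x - \<i> * of_real y2) / (x + 2))) \<le> \<eta> * C"
          unfolding norm_mult using y(1) le[of y1] le[of y2] by (auto simp: mult.commute)
        then show ?thesis unfolding Gsplit norm_divide[of _ "of_real C"] using C
          by (simp only: norm_of_real abs_of_pos pos_divide_le_eq)
      qed
      ultimately show "\<exists>l. ((\<lambda>z. G z / of_real C) \<longlongrightarrow> l) (at p within \<Omega>) \<and> norm l \<le> \<eta>" by blast
    qed
    then show ?thesis
    proof (rule eventually_mono)
      fix z assume "norm (G z / of_real C) \<le> 2 * \<eta>"
      then have "norm (G z) \<le> 2 * \<eta> * C" using C by (simp add: norm_divide divide_le_eq)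
      then show "norm (G z) < \<epsilon>" using \<eta> by simp
    qed
  qed
  define H where "H = (\<lambda>z. norm (X z - \<i> * of_real y1) * norm (X z - \<i> * of_real y2))"
  have nearX2: "\<forall>\<^sub>F z in at e within \<Omega>. X z + 2 \<noteq> 0"
  proof -
    have "\<forall>\<^sub>F z in at e within \<Omega>. dist (u z) (u e) < 1" using ulim[OF e] by (rule tendstoD) simp
    moreover have "\<forall>\<^sub>F z in at e within \<Omega>. z \<in> \<Omega>" by (simp add: eventually_at_filter)
    ultimately show ?thesis
    proof eventually_elim
      case (elim z)
      then have "Re (X z + 2) > 0" using fu[of z] by (auto simp: X_def dist_real_def abs_if split: if_splits)
      then show ?case by (metis less_irrefl zero_complex.sel(1))
    qed
  qed
  have Hlim: "\<forall>\<^sub>F z in at e within \<Omega>. H z < \<epsilon>" if \<epsilon>: "\<epsilon> > 0" for \<epsilon>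
  proof -
    \<comment> \<open>If \<open>norm X \<ge> M\<close>, both differences have norm at least half of
      \<open>norm X\<close>, and \<open>norm (X + 2) \<le> 2 * norm X\<close>; then
      \<open>norm G < 1/16\<close> is contradictory. Thus a small \<open>G\<close> first bounds
      \<open>X\<close> and then makes \<open>H\<close> small.\<close>
    define M where "M = 2 + 2 * \<bar>y1\<bar> + 2 * \<bar>y2\<bar>"
    have M: "M \<ge> 2" by (simp add: M_def)
    have "\<forall>\<^sub>F z in at e within \<Omega>. norm (G z) < min (1/16) (\<epsilon> / (M + 2)\<^sup>2)"
      using \<epsilon> M by (intro Glim0) (auto intro!: divide_pos_pos)
    with nearX2 show ?thesis
    proof eventually_elim
      case (elim z)
      have HG: "H z = norm (G z) * (norm (X z + 2))\<^sup>2"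
        using elim by (simp add: H_def G_def norm_mult norm_divide norm_power)
      have XM: "norm (X z) < M"
      proof (rule ccontr)
        assume "\<not> norm (X z) < M"
        then have big: "M \<le> norm (X z)" by simp
        have half: "norm (X z) / 2 \<le> norm (X z - \<i> * of_real t)" if "t \<in> {y1, y2}" for t
          using norm_triangle_ineq2[of "X z" "\<i> * of_real t"] big that by (auto simp: M_def norm_mult)
        have "norm (X z + 2) \<le> 2 * norm (X z)" using norm_triangle_ineq[of "X z" 2] big M by simp
        then have "(norm (X z + 2))\<^sup>2 \<le> (2 * norm (X z))\<^sup>2" by (intro power_mono) auto
        then have a: "(norm (X z + 2))\<^sup>2 \<le> 4 * (norm (X z))\<^sup>2" by (simp add: power_mult_distrib)
        have b: "norm (X z) / 2 * (norm (X z) / 2) \<le> H z"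
          unfolding H_def using half by (intro mult_mono) auto
        have "norm (G z) * (norm (X z + 2))\<^sup>2 < 1/16 * (norm (X z + 2))\<^sup>2"
          using elim by (intro mult_strict_right_mono) auto
        then show False using a b HG by (simp add: power2_eq_square)
      qed
      have "norm (X z + 2) \<le> M + 2" using norm_triangle_ineq[of "X z" 2] XM by simp
      then have "H z \<le> norm (G z) * (M + 2)\<^sup>2" unfolding HG by (intro mult_left_mono power_mono) auto
      also have "\<dots> < \<epsilon> / (M + 2)\<^sup>2 * (M + 2)\<^sup>2" using elim M by (intro mult_strict_right_mono) auto
      also have "\<dots> = \<epsilon>" using M by simp
      finally show ?case .
    qed
  qed
  have eq: "y1 = y2"
  proof (rule ccontr)
    assume ne: "y1 \<noteq> y2"
    \<comment> \<open>The threshold \<open>d\<^sup>2 / 16\<close> is below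
      \<open>(d / 2)\<^sup>2\<close>: where the first distance equals \<open>d / 2\<close>, the
      second is at least \<open>d / 2\<close>, and \<open>H\<close> is too large. Points
      \<open>x1\<close>, \<open>x2\<close> near the two boundary pieces lie on different sides of
      this level, so the connected set \<open>U\<close> would have to cross it.\<close>
    define d where "d = \<bar>y1 - y2\<bar>"
    have d: "d > 0" using ne by (simp add: d_def)
    have "\<forall>\<^sub>F z in at e within \<Omega>. H z < d\<^sup>2 / 16" using d by (intro Hlim) auto
    then obtain \<epsilon> where \<epsilon>: "\<epsilon> > 0" "\<forall>z\<in>\<Omega>. z \<noteq> e \<and> dist z e < \<epsilon> \<longrightarrow> H z < d\<^sup>2 / 16"
      unfolding eventually_at by blast
    have H\<epsilon>: "H z < d\<^sup>2 / 16" if "z \<in> \<Omega> \<inter> ball e \<epsilon>" for z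
      using \<epsilon>(2) that notin[OF e] by (auto simp: dist_commute)
    obtain d' where d': "0 < d'" "d' \<le> \<epsilon>"
      "\<And>x y. \<lbrakk>x \<in> \<Omega> \<inter> ball e d'; y \<in> \<Omega> \<inter> ball e d'\<rbrakk> \<Longrightarrow>
        \<exists>U. connected U \<and> U \<subseteq> \<Omega> \<inter> ball e \<epsilon> \<and> x \<in> U \<and> y \<in> U"
      using locally_connected_at_boundary[OF e \<epsilon>(1)] by blast
    obtain \<delta>' where \<delta>': "0 < \<delta>'" "\<delta>' < 1/2" "\<And>s. \<lbrakk>0 \<le> s; s < \<delta>'\<rbrakk> \<Longrightarrow> \<gamma> s \<in> ball e d'"
      "\<And>s. \<lbrakk>1 - \<delta>' < s; s \<le> 1\<rbrakk> \<Longrightarrow> \<gamma> s \<in> ball e d'"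
      using small_arc_at_start[OF d'(1)] unfolding e_def by blast
    define s where "s = min \<delta> \<delta>' / 2"
    have s: "0 < s" "s < \<delta>" "s < \<delta>'" "s < 1/2" using \<delta> \<delta>' by (auto simp: s_def)
    have pick: "\<exists>z. z \<in> \<Omega> \<inter> ball e d' \<and> \<bar>Im (f z) - y\<bar> < d / 4"
      if "t \<in> {0..1}" "\<gamma> t \<in> ball e d'" "((\<lambda>z. Im (f z)) \<longlongrightarrow> y) (at (\<gamma> t) within \<Omega>)" for t y
    proof -
      have "\<forall>\<^sub>F z in at (\<gamma> t) within \<Omega>. dist (Im (f z)) y < d / 4" using that d by (intro tendstoD) auto
      moreover have "\<forall>\<^sub>F z in at (\<gamma> t) within \<Omega>. z \<in> ball e d'"
        using that by (intro eventually_at_topological[THEN iffD2]) (auto intro!: exI[of _ "ball e d'"])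
      moreover have "\<forall>\<^sub>F z in at (\<gamma> t) within \<Omega>. z \<in> \<Omega>" by (simp add: eventually_at_filter)
      ultimately have "\<forall>\<^sub>F z in at (\<gamma> t) within \<Omega>. z \<in> \<Omega> \<inter> ball e d' \<and> \<bar>Im (f z) - y\<bar> < d / 4"
        by eventually_elim (auto simp: dist_real_def)
      moreover have "at (\<gamma> t) within \<Omega> \<noteq> bot" using that by (intro nontrivial) (auto simp: path_image_def)
      ultimately show ?thesis using eventually_happens' by blast
    qed
    obtain x1 where x1: "x1 \<in> \<Omega> \<inter> ball e d'" "\<bar>Im (f x1) - y1\<bar> < d / 4"
      using pick[of s y1] right[of s] \<delta>'(3)[of s] s by auto
    obtain x2 where x2: "x2 \<in> \<Omega> \<inter> ball e d'" "\<bar>Im (f x2) - y2\<bar> < d / 4"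
      using pick[of "1 - s" y2] left[of "1 - s"] \<delta>'(4)[of "1 - s"] s by auto
    obtain U where U: "connected U" "U \<subseteq> \<Omega> \<inter> ball e \<epsilon>" "x1 \<in> U" "x2 \<in> U" using d'(3)[OF x1(1) x2(1)] by blast
    have ImX: "\<bar>Im (f z) - t\<bar> \<le> norm (X z - \<i> * of_real t)" for z t
      using abs_Im_le_cmod[of "X z - \<i> * of_real t"] by (simp add: X_def)
    have far: "d / 2 \<le> norm (X z - \<i> * of_real y2)" if "norm (X z - \<i> * of_real y1) \<le> d / 2" for z
    proof -
      have "d \<le> \<bar>Im (f z) - y1\<bar> + \<bar>Im (f z) - y2\<bar>" unfolding d_def by linarith
      then show ?thesis using ImX[of z y1] ImX[of z y2] that by linarith
    qed
    have dd: "(d / 2) * (3 * d / 4) > d\<^sup>2 / 16" "d / 2 * (d / 2) > d\<^sup>2 / 16"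
      using d by (simp_all add: power2_eq_square field_simps)
    have dtri: "d \<le> \<bar>Im (f z) - y1\<bar> + \<bar>Im (f z) - y2\<bar>" for z unfolding d_def by linarith
    have a1: "norm (X x1 - \<i> * of_real y1) \<le> d / 2"
    proof (rule ccontr)
      assume "\<not> ?thesis"
      moreover have "3 * d / 4 \<le> norm (X x1 - \<i> * of_real y2)" using ImX[of x1 y2] x1(2) dtri[of x1] by linarith
      ultimately have "(d / 2) * (3 * d / 4) \<le> H x1" unfolding H_def using d by (intro mult_mono) auto
      moreover have "H x1 < d\<^sup>2 / 16" using U by (intro H\<epsilon>) blast
      ultimately show False using dd(1) by linarith
    qed
    have a2: "d / 2 \<le> norm (X x2 - \<i> * of_real y1)" using ImX[of x2 y1] x2(2) dtri[of x2] d by linarith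
    have cX: "continuous_on U (\<lambda>z. norm (X z - \<i> * of_real y1))"
      unfolding X_def using U(2) by (intro continuous_intros continuous_on_subset[OF holomorphic_on_imp_continuous_on[OF hol]]) auto
    have "connected ((\<lambda>z. norm (X z - \<i> * of_real y1)) ` U)" using cX U(1) by (rule connected_continuous_image)
    then have "d / 2 \<in> (\<lambda>z. norm (X z - \<i> * of_real y1)) ` U"
      using a1 a2 U by (meson connectedD_interval imageI)
    then obtain z where z: "z \<in> U" "norm (X z - \<i> * of_real y1) = d / 2" by auto
    then have "d / 2 * (d / 2) \<le> H z" unfolding H_def using far[of z] d by (intro mult_mono) auto
    moreover have "H z < d\<^sup>2 / 16" using U z by (intro H\<epsilon>) blast
    ultimately show False using dd(2) by linarith
  qed
  show "y1 = y2" by (rule eq)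
  have "(X \<longlongrightarrow> \<i> * of_real y1) (at e within \<Omega>)"
  proof (rule tendstoI)
    fix \<epsilon> :: real assume \<epsilon>: "0 < \<epsilon>"
    have "\<forall>\<^sub>F z in at e within \<Omega>. H z < \<epsilon>\<^sup>2" using \<epsilon> by (intro Hlim) auto
    then show "\<forall>\<^sub>F z in at e within \<Omega>. dist (X z) (\<i> * of_real y1) < \<epsilon>"
    proof (rule eventually_mono)
      fix z assume "H z < \<epsilon>\<^sup>2"
      then have "(norm (X z - \<i> * of_real y1))\<^sup>2 < \<epsilon>\<^sup>2" using eq by (simp add: H_def power2_eq_square)
      then show "dist (X z) (\<i> * of_real y1) < \<epsilon>" using \<epsilon> by (simp add: dist_norm power_less_imp_less_base)
    qed
  qed
  then have "((\<lambda>z. X z + of_real (u e)) \<longlongrightarrow> \<i> * of_real y1 + of_real (u e)) (at e within \<Omega>)"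
    by (intro tendsto_add tendsto_const)
  moreover have "\<i> * of_real y1 + of_real (u e) = Complex (u (\<gamma> 0)) y1" by (simp add: complex_eq_iff e_def)
  ultimately show "(f \<longlongrightarrow> Complex (u (\<gamma> 0)) y1) (at (\<gamma> 0) within \<Omega>)" by (simp add: X_def e_def)
qed

end

section \<open>Winding numbers, boundary arcs and conformal homeomorphisms\<close>

text \<open>Both paths lift through \<open>exp\<close>, and the lifts add.\<close>

lemma winding_number_mult:
  fixes p q :: "real \<Rightarrow> complex"
  assumes "path p" "path q" "0 \<notin> path_image p" "0 \<notin> path_image q"
  shows "winding_number (\<lambda>t. p t * q t) 0 = winding_number p 0 + winding_number q 0"
proof -
  obtain P where P: "path P" "pathfinish P - pathstart P = 2 * of_real pi * \<i> * winding_number p 0"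
    "\<And>t. t \<in> {0..1} \<Longrightarrow> p t = 0 + exp (P t)"
    using winding_number_as_continuous_log[OF assms(1,3)] by metis
  obtain Q where Q: "path Q" "pathfinish Q - pathstart Q = 2 * of_real pi * \<i> * winding_number q 0"
    "\<And>t. t \<in> {0..1} \<Longrightarrow> q t = 0 + exp (Q t)"
    using winding_number_as_continuous_log[OF assms(2,4)] by metis
  have path: "path (\<lambda>t. P t + Q t)" using P(1) Q(1) unfolding path_def by (intro continuous_intros)
  have "winding_number (\<lambda>t. p t * q t) 0 = winding_number (exp \<circ> (\<lambda>t. P t + Q t)) 0"
    by (rule winding_number_cong) (simp add: P(3) Q(3) exp_add)
  also have "\<dots> = ((pathfinish P - pathstart P) + (pathfinish Q - pathstart Q)) / (2 * of_real pi * \<i>)"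
    unfolding winding_number_compose_exp[OF path] by (simp add: pathfinish_def pathstart_def algebra_simps)
  also have "\<dots> = winding_number p 0 + winding_number q 0"
    unfolding P(2) Q(2) by (simp add: field_simps)
  finally show ?thesis .
qed

lemma winding_number_power:
  fixes p :: "real \<Rightarrow> complex"
  assumes "path p" "0 \<notin> path_image p"
  shows "winding_number (\<lambda>t. p t ^ n) 0 = of_nat n * winding_number p 0"
proof (induction n)
  case 0
  have "winding_number (\<lambda>t. p t ^ 0) 0 = winding_number (linepath 1 1) 0"
    by (rule winding_number_cong) (simp add: linepath_def)
  then show ?case by simp
next
  case (Suc n)
  have pn: "path (\<lambda>t. p t ^ n)" using assms(1) unfolding path_def by (intro continuous_intros)
  have pn0: "0 \<notin> path_image (\<lambda>t. p t ^ n)" using assms(2) by (auto simp: path_image_def)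
  show ?case using winding_number_mult[OF assms(1) pn assms(2) pn0] Suc by (simp add: algebra_simps)
qed

context jordan_curve
begin

section \<open>Connected subsets of the curve, and functions constant on a boundary arc\<close>

lemma frontier_outside_J: "frontier (outside J) = J"
  using Jordan_inside_outside[OF simple closed_path] by auto

lemma outside_notin_closure: "x \<in> outside J \<Longrightarrow> x \<notin> closure \<Omega>"
  using domain_facts(7) inside_Int_outside[of J] outside_no_overlap[of J] by blast

lemma image_closed: "\<lbrakk>0 \<le> a; b \<le> 1\<rbrakk> \<Longrightarrow> closed (\<gamma> ` {a..b})"
  using cont by (intro compact_imp_closed compact_continuous_image) (auto intro: continuous_on_subset)

text \<open>The two parameters cut the curve into two closed arcs that meet only at the cut points;
  the one over \<open>{0..a} \<union> {b..1}\<close> passes through the base point. A connected set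
  missing both cut points lies in one of them.\<close>

lemma no_splitting:
  assumes "0 \<le> a" "a < b" "b \<le> 1" and X: "connected X" "X \<subseteq> J" "\<gamma> a \<notin> X" "\<gamma> b \<notin> X"
    and "X \<inter> \<gamma> ` {a..b} \<noteq> {}" "X \<inter> \<gamma> ` ({0..a} \<union> {b..1}) \<noteq> {}"
  shows False
proof -
  have cl: "closed (\<gamma> ` {a..b})" "closed (\<gamma> ` ({0..a} \<union> {b..1}))"
    using assms by (auto simp: image_Un image_closed intro!: closed_Un)
  have "\<gamma> ` {a..b} \<inter> \<gamma> ` ({0..a} \<union> {b..1}) \<inter> X = {}"
  proof (rule ccontr)
    assume "\<not> ?thesis"
    then obtain v where v: "v \<in> \<gamma> ` {a..b}" "v \<in> \<gamma> ` ({0..a} \<union> {b..1})" "v \<in> X" by blast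
    obtain s where s: "s \<in> {a..b}" "v = \<gamma> s" using v(1) by blast
    obtain t where t: "t \<in> {0..a} \<union> {b..1}" "v = \<gamma> t" using v(2) by blast
    have st: "s \<in> {a..b}" "t \<in> {0..a} \<union> {b..1}" "\<gamma> s = \<gamma> t" "\<gamma> s \<in> X" using s t v(3) by auto
    then have "s = t \<or> (s = 0 \<and> t = 1) \<or> (s = 1 \<and> t = 0)" using injD[OF st(3)] assms by auto
    then have "s = a \<or> s = b" using st assms by auto
    then show False using st X by auto
  qed
  moreover have "{0..1} = {a..b} \<union> ({0..a} \<union> {b..1})" using assms by auto
  then have "X \<subseteq> \<gamma> ` {a..b} \<union> \<gamma> ` ({0..a} \<union> {b..1})"
    using X(2) unfolding path_image_def by (metis image_Un)
  ultimately show False using connected_closedD[OF X(1) _ _ cl] assms(8,9) by blast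
qed

text \<open>If \<open>X\<close> missed a point on each of the two arcs between
  \<open>\<gamma> s\<close> and \<open>\<gamma> t\<close>, cutting the curve at these two points
  would separate \<open>\<gamma> s\<close> from \<open>\<gamma> t\<close>.\<close>

lemma connected_contains_arc:
  assumes X: "connected X" "X \<subseteq> J" and st: "0 \<le> s" "s < t" "t \<le> 1" "\<gamma> s \<in> X" "\<gamma> t \<in> X"
  shows "\<gamma> ` {s<..<t} \<subseteq> X \<or> \<gamma> ` ({0..1} - {s..t}) \<subseteq> X"
proof (rule ccontr)
  assume "\<not> ?thesis"
  then have n: "\<not> \<gamma> ` {s<..<t} \<subseteq> X" "\<not> \<gamma> ` ({0..1} - {s..t}) \<subseteq> X" by blast+
  obtain a where "a \<in> {s<..<t}" "\<gamma> a \<notin> X" using n(1) by blast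
  then have a: "s < a" "a < t" "\<gamma> a \<notin> X" by auto
  obtain b where b: "b \<in> {0..1}" "b \<notin> {s..t}" "\<gamma> b \<notin> X" using n(2) by blast
  show False
  proof (cases "b < s")
    case True
    have "\<gamma> s \<in> X \<inter> \<gamma> ` {b..a}" "\<gamma> t \<in> X \<inter> \<gamma> ` ({0..b} \<union> {a..1})" using st a True by auto
    then have ne: "X \<inter> \<gamma> ` {b..a} \<noteq> {}" "X \<inter> \<gamma> ` ({0..b} \<union> {a..1}) \<noteq> {}" by blast+
    show False using no_splitting[OF _ _ _ X b(3) a(3) ne] a(1,2) b(1) st(3) True by auto
  next
    case False
    then have bt: "t < b" using b by auto
    have "\<gamma> t \<in> X \<inter> \<gamma> ` {a..b}" "\<gamma> s \<in> X \<inter> \<gamma> ` ({0..a} \<union> {b..1})" using st a bt by auto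
    then have ne: "X \<inter> \<gamma> ` {a..b} \<noteq> {}" "X \<inter> \<gamma> ` ({0..a} \<union> {b..1}) \<noteq> {}" by blast+
    show False using no_splitting[OF _ _ _ X a(3) b(3) ne] a(1,2) b(1) st(1) bt by auto
  qed
qed

text \<open>Apply the maximum principle to \<open>(f - \<alpha>) (d / (z - x0)) ^ N\<close> for an exterior point \<open>x0\<close> near \<open>p\<close>, where \<open>d\<close>
  is the distance from \<open>x0\<close> to the rest of the curve.\<close>

lemma constant_if_constant_on_boundary_arc:
  assumes hol: "f holomorphic_on \<Omega>" and contf: "continuous_on (closure \<Omega>) f"
    and p: "p \<in> J" "0 < \<epsilon>" and c: "\<And>q. q \<in> J \<inter> ball p \<epsilon> \<Longrightarrow> f q = \<alpha>" and z: "z \<in> \<Omega>"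
  shows "f z = \<alpha>"
proof -
  have "p \<in> closure (outside J)" using p(1) frontier_outside_J by (auto simp: frontier_def)
  then obtain x0 where x0: "x0 \<in> outside J" "dist x0 p < \<epsilon> / 3"
    using p(2) closure_approachable[of p "outside J"] by (meson divide_pos_pos zero_less_numeral)
  \<comment> \<open>\<open>x0\<close> is within \<open>\<epsilon> / 3\<close> of \<open>p\<close>,
    so points outside \<open>ball p \<epsilon>\<close> have distance at least \<open>d\<close> from
    \<open>x0\<close> and points of \<open>ball p (\<epsilon> / 3)\<close> less than
    \<open>d\<close>. The powers are harmless on the rest of the curve and blow up near
    \<open>p\<close>.\<close>
  define d where "d = 2 * \<epsilon> / 3"
  have d: "d > 0" using p by (simp add: d_def)
  have "compact ((\<lambda>z. f z - \<alpha>) ` closure \<Omega>)"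
    by (intro compact_continuous_image continuous_intros contf domain_facts(10))
  then obtain B where B: "\<And>z. z \<in> closure \<Omega> \<Longrightarrow> norm (f z - \<alpha>) \<le> B"
    by (meson bounded_iff compact_imp_bounded imageI)
  have nz: "w \<noteq> x0" if "w \<in> closure \<Omega>" for w using that outside_notin_closure[OF x0(1)] by auto
  have bd: "norm (f w - \<alpha>) * (d / norm (w - x0)) ^ N \<le> B" if "w \<in> \<Omega>" for w N
  proof -
    have "norm ((f w - \<alpha>) * (of_real d / (w - x0)) ^ N) \<le> B"
    proof (rule maximum_modulus_frontier[of "\<lambda>w. (f w - \<alpha>) * (of_real d / (w - x0)) ^ N" \<Omega> B w])
      have "interior \<Omega> = \<Omega>" using domain_facts(1) by (rule interior_open)
      then show "(\<lambda>w. (f w - \<alpha>) * (of_real d / (w - x0)) ^ N) holomorphic_on interior \<Omega>"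
        using nz domain_facts(7) by (auto intro!: holomorphic_intros hol)
      show "continuous_on (closure \<Omega>) (\<lambda>w. (f w - \<alpha>) * (of_real d / (w - x0)) ^ N)"
        using nz by (intro continuous_intros contf) auto
      show "bounded \<Omega>" by (rule domain_facts(3))
      show "w \<in> \<Omega>" by fact
      fix q assume "q \<in> frontier \<Omega>"
      then have q: "q \<in> J" using domain_facts(5) by simp
      then have qc: "q \<in> closure \<Omega>" using domain_facts(7) by auto
      show "norm ((f q - \<alpha>) * (of_real d / (q - x0)) ^ N) \<le> B"
      proof (cases "q \<in> ball p \<epsilon>")
        case True
        then show ?thesis using c q order_trans[OF norm_ge_zero B[OF qc]] by simp
      next
        case False
        have "dist p q \<le> dist p x0 + dist x0 q" by (rule dist_triangle)
        then have "d \<le> norm (q - x0)" using False x0(2) by (auto simp: d_def dist_norm norm_minus_commute)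
        then have "norm (of_real d / (q - x0)) \<le> 1" using d by (simp add: norm_divide divide_le_eq)
        then have "norm (of_real d / (q - x0)) ^ N \<le> 1" by (simp add: power_le_one)
        then have "norm (f q - \<alpha>) * norm (of_real d / (q - x0)) ^ N \<le> B * 1"
          using B[OF qc] order_trans[OF norm_ge_zero B[OF qc]] by (intro mult_mono) auto
        then show ?thesis by (simp add: norm_mult norm_power)
      qed
    qed
    then show ?thesis using d by (simp add: norm_mult norm_power norm_divide)
  qed
  have loc: "f w = \<alpha>" if w: "w \<in> \<Omega> \<inter> ball p (\<epsilon> / 3)" for w
  proof (rule ccontr)
    assume "f w \<noteq> \<alpha>"
    then have pos: "norm (f w - \<alpha>) > 0" by simp
    have "dist w x0 \<le> dist w p + dist p x0" by (rule dist_triangle)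
    then have "norm (w - x0) < d" using w x0(2) by (auto simp: d_def dist_norm norm_minus_commute)
    moreover have "norm (w - x0) > 0" using nz[of w] w domain_facts(7) by auto
    ultimately have "1 < d / norm (w - x0)" by simp
    then obtain N where "B / norm (f w - \<alpha>) < (d / norm (w - x0)) ^ N" using real_arch_pow by blast
    then show False using bd[of w N] w pos by (simp add: field_simps)
  qed
  show ?thesis
  proof (rule analytic_continuation_open[of "\<Omega> \<inter> ball p (\<epsilon> / 3)" \<Omega> f "\<lambda>_. \<alpha>"])
    show "\<Omega> \<inter> ball p (\<epsilon> / 3) \<noteq> {}" using near_point[OF p(1), of "\<epsilon> / 3"] p(2) by auto
  qed (use domain_facts hol loc z in auto)
qed

text \<open>A logarithm of \<open>k\<close> on \<Omega> extends continuously to the closure by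
  \<open>log_has_limit\<close>, so \<open>k \<circ> \<gamma>\<close> is the exponential of a closed
  path.\<close>

lemma winding_number_image_nonvanishing:
  assumes contk: "continuous_on (closure \<Omega>) k" and hol: "k holomorphic_on \<Omega>"
    and nz: "\<And>z. z \<in> closure \<Omega> \<Longrightarrow> k z \<noteq> 0"
  shows "winding_number (k \<circ> \<gamma>) 0 = 0"
proof -
  obtain q where q: "q holomorphic_on \<Omega>" "\<And>z. z \<in> \<Omega> \<Longrightarrow> exp (q z) = k z"
    using log_exists[OF hol] nz domain_facts(7) by blast
  have contq: "continuous_on \<Omega> q" using q(1) by (rule holomorphic_on_imp_continuous_on)
  obtain g where g: "continuous_on (closure \<Omega>) g" "\<And>z. z \<in> \<Omega> \<Longrightarrow> g z = q z"
  proof (rule continuous_extension_to_closure[OF domain_facts(1) contq])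
    fix p assume "p \<in> frontier \<Omega>"
    then have p: "p \<in> J" using domain_facts(5) by simp
    then have pc: "p \<in> closure \<Omega>" using domain_facts(7) by auto
    show "\<exists>l. (q \<longlongrightarrow> l) (at p within \<Omega>)"
      using continuous_on_tendsto_subset[OF contk pc closure_subset] nz[OF pc] q(2)
      by (intro log_has_limit[OF p contq]) auto
  qed blast
  have "exp (g z) - k z = 0" if "z \<in> closure \<Omega>" for z
    by (rule continuous_constant_on_closure[OF _ _ that, of "\<lambda>z. exp (g z) - k z"])
       (use g q(2) contk in \<open>auto intro!: continuous_intros\<close>)
  then have eg: "exp (g z) = k z" if "z \<in> closure \<Omega>" for z using that by force
  have \<gamma>c: "\<gamma> t \<in> closure \<Omega>" if "t \<in> {0..1}" for t using that domain_facts(7) by (auto simp: path_image_def)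
  have "path (g \<circ> \<gamma>)" unfolding path_def
    using \<gamma>c by (intro continuous_on_compose cont continuous_on_subset[OF g(1)]) auto
  then have "winding_number (exp \<circ> (g \<circ> \<gamma>)) 0 = 0"
    using endpoints by (simp add: winding_number_compose_exp pathfinish_def pathstart_def)
  moreover have "winding_number (k \<circ> \<gamma>) 0 = winding_number (exp \<circ> (g \<circ> \<gamma>)) 0"
    by (rule winding_number_cong) (simp add: eg \<gamma>c)
  ultimately show ?thesis by simp
qed

text \<open>Argument principle for merely continuous boundary values, by induction on the number of
  distinct zeros: dividing by \<open>(z - a) ^ n\<close> removes one zero, and this factor
  contributes \<open>n\<close> times the winding number around \<open>a\<close>, that is
  \<open>n\<close>. Multiplicities leave only an inequality for \<open>card\<close>; the last
  conjunct turns a nonzero winding number into the existence of a zero.\<close>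

lemma winding_number_image_counts_zeros:
  assumes pos: "\<And>z. z \<in> \<Omega> \<Longrightarrow> winding_number \<gamma> z = 1"
    and contG: "continuous_on (closure \<Omega>) G" and hol: "G holomorphic_on \<Omega>"
    and nz: "\<And>z. z \<in> J \<Longrightarrow> G z \<noteq> 0"
  shows "finite {z \<in> \<Omega>. G z = 0} \<and> (\<exists>n. winding_number (G \<circ> \<gamma>) 0 = of_nat n \<and>
      card {z \<in> \<Omega>. G z = 0} \<le> n \<and> ({z \<in> \<Omega>. G z = 0} = {} \<longrightarrow> n = 0))"
proof -
  \<comment> \<open>Stated for arbitrary \<open>G\<close>, since the induction also applies it to
    the quotient \<open>G1\<close>.\<close>
  have finZ: "finite {z \<in> \<Omega>. G z = 0}"
    if G: "continuous_on (closure \<Omega>) G" "G holomorphic_on \<Omega>" "\<And>z. z \<in> J \<Longrightarrow> G z \<noteq> 0" for G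
  proof (cases "{z \<in> \<Omega>. G z = 0} = {}")
    case False
    have eq: "{z \<in> \<Omega>. G z = 0} = {z \<in> closure \<Omega>. G z = 0}" using G(3) domain_facts(7) by auto
    have "compact {z \<in> closure \<Omega>. G z = 0}"
      using continuous_closed_preimage_constant[OF G(1) closed_closure, of 0] domain_facts(3)
      by (auto simp: compact_eq_bounded_closed intro: bounded_subset[OF bounded_closure])
    moreover have "\<not> G constant_on \<Omega>"
    proof
      assume "G constant_on \<Omega>"
      then have G0: "G z = 0" if "z \<in> \<Omega>" for z using False that unfolding constant_on_def by force
      obtain p where "p \<in> J" using domain_facts(11) by blast
      then have "G p = 0" using domain_facts(7) by (intro continuous_constant_on_closure[OF G(1) G0, of p]) blast+
      then show False using G(3) \<open>p \<in> J\<close> by blast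
    qed
    ultimately have "finite {w \<in> {z \<in> \<Omega>. G z = 0}. G w = 0}"
      unfolding eq[symmetric] by (intro holomorphic_compact_finite_zeros[OF G(2) domain_facts(1,2)]) auto
    then show ?thesis by simp
  next
    case True
    then show ?thesis by (simp only: finite.emptyI)
  qed
  have "\<exists>n. winding_number (G \<circ> \<gamma>) 0 = of_nat n \<and>
      card {z \<in> \<Omega>. G z = 0} \<le> n \<and> ({z \<in> \<Omega>. G z = 0} = {} \<longrightarrow> n = 0)"
    if "card {z \<in> \<Omega>. G z = 0} = m" "continuous_on (closure \<Omega>) G" "G holomorphic_on \<Omega>" "\<And>z. z \<in> J \<Longrightarrow> G z \<noteq> 0"
    for m G
    using that
  proof (induction m arbitrary: G)
    case 0
    then have e: "{z \<in> \<Omega>. G z = 0} = {}" using finZ[of G] by simp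
    then have "winding_number (G \<circ> \<gamma>) 0 = 0"
      using 0 domain_facts(7) by (intro winding_number_image_nonvanishing) auto
    then have "winding_number (G \<circ> \<gamma>) 0 = of_nat 0" by simp
    then show ?case using 0(1) by (intro exI[of _ "0::nat"] conjI) (simp_all only: le_refl simp_thms)
  next
    case (Suc m)
    then obtain a where a: "a \<in> \<Omega>" "G a = 0" by (metis (mono_tags, lifting) card.empty empty_Collect_eq nat.distinct(1))
    have nc: "\<not> G constant_on \<Omega>"
    proof
      assume "G constant_on \<Omega>"
      then have G0: "G z = 0" if "z \<in> \<Omega>" for z using a that by (auto simp: constant_on_def)
      obtain p where "p \<in> J" using domain_facts(11) by blast
      then have "G p = 0" using domain_facts(7) by (intro continuous_constant_on_closure[OF Suc.prems(2) G0, of p]) blast+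
      then show False using Suc.prems(4) \<open>p \<in> J\<close> by blast
    qed
    obtain g r n where n: "0 < n" "0 < r" "ball a r \<subseteq> \<Omega>" "g holomorphic_on ball a r"
      "\<And>w. w \<in> ball a r \<Longrightarrow> G w = (w - a) ^ n * g w" "\<And>w. w \<in> ball a r \<Longrightarrow> g w \<noteq> 0"
      using holomorphic_factor_zero_nonconstant[OF Suc.prems(3) domain_facts(1,2) a nc] by metis
    define G1 where "G1 = (\<lambda>z. if z = a then g a else G z / (z - a) ^ n)"
    have G1g: "G1 w = g w" if "w \<in> ball a r" for w using n(5)[OF that] by (simp add: G1_def)
    have GG1: "G z = (z - a) ^ n * G1 z" for z using a n(1) by (simp add: G1_def)
    have "G1 holomorphic_on ball a r" by (rule holomorphic_transform[OF n(4)]) (simp add: G1g)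
    moreover have h1: "G1 holomorphic_on \<Omega> - {a}"
    proof (rule holomorphic_transform)
      show "(\<lambda>z. G z / (z - a) ^ n) holomorphic_on \<Omega> - {a}"
        by (intro holomorphic_intros holomorphic_on_subset[OF Suc.prems(3)]) auto
    qed (auto simp: G1_def)
    ultimately have "G1 holomorphic_on (\<Omega> - {a}) \<union> ball a r"
      using domain_facts(1) by (intro holomorphic_on_Un) (auto intro: open_Diff)
    moreover have un: "(\<Omega> - {a}) \<union> ball a r = \<Omega>" using n a by auto
    ultimately have hol1: "G1 holomorphic_on \<Omega>" by simp
    have un2: "(closure \<Omega> - {a}) \<union> \<Omega> = closure \<Omega>" using a closure_subset by blast
    have cont1: "continuous_on (closure \<Omega>) G1"
    proof -
      have "continuous_on ((closure \<Omega> - {a}) \<union> \<Omega>) G1"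
      proof (rule continuous_on_Un_local_open)
        show "openin (top_of_set (closure \<Omega> - {a} \<union> \<Omega>)) (closure \<Omega> - {a})"
          unfolding un2 by (metis Diff_eq open_Compl closed_singleton openin_open)
        show "openin (top_of_set (closure \<Omega> - {a} \<union> \<Omega>)) \<Omega>"
          unfolding un2 using domain_facts(1) by (intro open_subset closure_subset)
        show "continuous_on \<Omega> G1" using hol1 by (rule holomorphic_on_imp_continuous_on)
        have "continuous_on (closure \<Omega> - {a}) (\<lambda>z. G z / (z - a) ^ n)"
          by (intro continuous_intros continuous_on_subset[OF Suc.prems(2)]) auto
        then show "continuous_on (closure \<Omega> - {a}) G1" by (rule continuous_on_eq) (auto simp: G1_def)
      qed
      then show ?thesis using un2 by simp
    qed
    have nz1: "G1 z \<noteq> 0" if "z \<in> J" for z using GG1[of z] Suc.prems(4)[OF that] by auto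
    have "G z = 0 \<longleftrightarrow> z = a \<or> G1 z = 0" for z using GG1[of z] a(2) n(1) by auto
    then have Z1: "{z \<in> \<Omega>. G z = 0} = insert a {z \<in> \<Omega>. G1 z = 0}" using a(1) by auto
    have Z2: "a \<notin> {z \<in> \<Omega>. G1 z = 0}" using n(2,6) by (simp add: G1_def)
    have c: "card {z \<in> \<Omega>. G1 z = 0} = m"
      using Suc.prems(1) finZ[OF cont1 hol1 nz1] unfolding Z1 by (simp only: card_insert_disjoint[OF _ Z2])
    obtain k where k: "winding_number (G1 \<circ> \<gamma>) 0 = of_nat k" "card {z \<in> \<Omega>. G1 z = 0} \<le> k"
      using Suc.IH[OF c cont1 hol1 nz1] by blast
    have \<gamma>c: "\<gamma> ` {0..1} \<subseteq> closure \<Omega>" using domain_facts(7) by (auto simp: path_image_def)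
    have aJ: "a \<notin> J" using a notin by blast
    have pa: "path (\<lambda>t. \<gamma> t - a)" unfolding path_def by (intro continuous_intros cont)
    have pa0: "0 \<notin> path_image (\<lambda>t. \<gamma> t - a)" using aJ by (auto simp: path_image_def)
    have pan: "path (\<lambda>t. (\<gamma> t - a) ^ n)" unfolding path_def by (intro continuous_intros cont)
    have pan0: "0 \<notin> path_image (\<lambda>t. (\<gamma> t - a) ^ n)" using aJ by (auto simp: path_image_def)
    have pG: "path (G1 \<circ> \<gamma>)" unfolding path_def
      by (intro continuous_on_compose cont continuous_on_subset[OF cont1 \<gamma>c])
    have pG0: "0 \<notin> path_image (G1 \<circ> \<gamma>)" using nz1 by (auto simp: path_image_def)
    have "winding_number (G \<circ> \<gamma>) 0 = winding_number (\<lambda>t. (\<gamma> t - a) ^ n * (G1 \<circ> \<gamma>) t) 0"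
      by (rule winding_number_cong) (simp add: GG1)
    also have "\<dots> = of_nat n * winding_number (\<lambda>t. \<gamma> t - a) 0 + winding_number (G1 \<circ> \<gamma>) 0"
      by (simp only: winding_number_mult[OF pan pG pan0 pG0] winding_number_power[OF pa pa0])
    also have "\<dots> = of_nat (n + k)"
      using k pos[OF a(1)] by (simp add: winding_number_offset[of \<gamma> a, symmetric])
    finally have "winding_number (G \<circ> \<gamma>) 0 = of_nat (n + k)" .
    moreover have "card {z \<in> \<Omega>. G z = 0} \<le> n + k" using Suc.prems(1) k(2) c n(1) by linarith
    moreover have "{z \<in> \<Omega>. G z = 0} \<noteq> {}" using Z1 by blast
    ultimately show ?case by blast
  qed
  then show ?thesis using finZ[OF contG hol nz] contG hol nz by blast
qed

text \<open>For injectivity on the boundary suppose \<open>f x = f y = w\<close>. Convexity of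
  \<open>R\<close> makes the preimages \<open>V n\<close> of small discs around \<open>w\<close>
  connected, so the intersection \<open>K\<close> of their closures is a connected subset of
  \<open>J\<close> that contains \<open>x\<close> and \<open>y\<close> and on which \<open>f\<close>
  equals \<open>w\<close>. It contains an arc, and \<open>f\<close> would be constant.\<close>

lemma homeomorphism_of_conformal:
  assumes contf: "continuous_on (closure \<Omega>) f" and hol: "f holomorphic_on \<Omega>"
    and R: "open R" "convex R" and im: "f ` \<Omega> = R" and inj: "inj_on f \<Omega>"
    and bd: "\<And>z. z \<in> J \<Longrightarrow> f z \<notin> R"
  shows "\<exists>g. homeomorphism (closure \<Omega>) (closure R) f g"
proof -
  obtain h where h: "h holomorphic_on R" "\<And>z. z \<in> \<Omega> \<Longrightarrow> h (f z) = z"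
    using holomorphic_has_inverse[OF hol domain_facts(1) inj] im by metis
  have conth: "continuous_on R h" using h(1) by (rule holomorphic_on_imp_continuous_on)
  have cr: "continuous_on \<Omega> f" using hol by (rule holomorphic_on_imp_continuous_on)
  have False if xy: "x \<in> J" "y \<in> J" "x \<noteq> y" "f x = f y" for x y
  proof -
    define w where "w = f x"
    define V where "V = (\<lambda>n::nat. {z \<in> \<Omega>. f z \<in> ball w (inverse (real (Suc n)))})"
    have V\<Omega>: "V n \<subseteq> \<Omega>" for n by (auto simp: V_def)
    have "V n = h ` (R \<inter> ball w (inverse (real (Suc n))))" for n
    proof
      show "V n \<subseteq> h ` (R \<inter> ball w (inverse (real (Suc n))))"
      proof
        fix z assume "z \<in> V n"
        then have "z = h (f z)" "f z \<in> R \<inter> ball w (inverse (real (Suc n)))" using h(2) im by (auto simp: V_def)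
        then show "z \<in> h ` (R \<inter> ball w (inverse (real (Suc n))))" by (rule image_eqI)
      qed
      show "h ` (R \<inter> ball w (inverse (real (Suc n)))) \<subseteq> V n"
        using im h(2) by (auto simp: V_def)
    qed
    moreover have "connected (h ` (R \<inter> ball w (inverse (real (Suc n)))))" for n
      using R by (intro connected_continuous_image continuous_on_subset[OF conth] convex_connected convex_Int) auto
    ultimately have cV: "connected (closure (V n))" for n by (simp add: connected_imp_connected_closure)
    have coV: "compact (closure (V n))" for n
      using bounded_subset[OF domain_facts(3) V\<Omega>] by simp
    define K where "K = (\<Inter>n. closure (V n))"
    have "connected K" unfolding K_def
    proof (rule connected_nest[OF coV cV])
      fix m n :: nat assume "m \<le> n"
      then have le: "inverse (real (Suc n)) \<le> inverse (real (Suc m))" by (intro le_imp_inverse_le) auto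
      have "V n \<subseteq> V m" unfolding V_def using less_le_trans[OF _ le] by auto
      then show "closure (V n) \<subseteq> closure (V m)" by (rule closure_mono)
    qed
    have inK: "v \<in> K" if v: "v \<in> J" "f v = w" for v
      unfolding K_def
    proof (intro INT_I)
      fix n :: nat
      have vc: "v \<in> closure \<Omega>" using v domain_facts(7) by auto
      have "(f \<longlongrightarrow> w) (at v within \<Omega>)"
        using continuous_on_tendsto_subset[OF contf vc closure_subset] v by simp
      then have "\<forall>\<^sub>F z in at v within \<Omega>. dist (f z) w < inverse (real (Suc n))" by (rule tendstoD) simp
      moreover have "\<forall>\<^sub>F z in at v within \<Omega>. z \<in> \<Omega>" by (simp add: eventually_at_filter)
      ultimately have ev: "\<forall>\<^sub>F z in at v within \<Omega>. z \<in> V n"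
        by eventually_elim (auto simp: V_def dist_commute)
      have "\<exists>z\<in>V n. dist z v < e" if "e > 0" for e
      proof -
        have "\<forall>\<^sub>F z in at v within \<Omega>. dist z v < e" using that by (auto simp: eventually_at)
        with ev have "\<forall>\<^sub>F z in at v within \<Omega>. z \<in> V n \<and> dist z v < e" by eventually_elim auto
        then show ?thesis using eventually_happens'[OF nontrivial[OF v(1)]] by blast
      qed
      then show "v \<in> closure (V n)" by (simp add: closure_approachable)
    qed
    have fK: "v \<in> closure \<Omega> \<and> f v = w" if v: "v \<in> K" for v
    proof
      show vc: "v \<in> closure \<Omega>" using v closure_mono[OF V\<Omega>] by (auto simp: K_def)
      have "dist w (f v) \<le> inverse (real (Suc n))" for n
      proof -
        have "f ` closure (V n) \<subseteq> cball w (inverse (real (Suc n)))"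
          by (intro image_closure_subset continuous_on_subset[OF contf] closure_mono V\<Omega>) (auto simp: V_def)
        moreover have "v \<in> closure (V n)" using v by (simp add: K_def)
        ultimately have "f v \<in> cball w (inverse (real (Suc n)))" by blast
        then show ?thesis by simp
      qed
      then have "dist w (f v) \<le> 0" using LIMSEQ_inverse_real_of_nat by (intro LIMSEQ_le_const) auto
      then show "f v = w" by simp
    qed
    have wR: "w \<notin> R" using bd xy by (simp add: w_def)
    have KJ: "K \<subseteq> J" using fK domain_facts(7) wR im by blast
    \<comment> \<open>A connected \<open>K\<close> with two points contains one of the two open arcs
      between them; a parameter \<open>m\<close> of that arc has positive distance to the closed
      remainder \<open>C\<close> of the curve.\<close>
    have "\<exists>p \<epsilon>. p \<in> J \<and> 0 < \<epsilon> \<and> J \<inter> ball p \<epsilon> \<subseteq> K"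
    proof -
      have local: ?thesis if C: "closed C" "m \<in> {0..1}" "\<gamma> m \<notin> C" "J - C \<subseteq> K" for C m
      proof -
        obtain \<epsilon> where "\<epsilon> > 0" "ball (\<gamma> m) \<epsilon> \<subseteq> - C"
          using C(1,3) by (meson ComplI open_Compl open_contains_ball)
        then show ?thesis using C by (intro exI[of _ "\<gamma> m"] exI[of _ \<epsilon>]) (auto simp: path_image_def)
      qed
      have ordered: ?thesis
        if st: "0 \<le> s" "s < t" "t \<le> 1" "\<gamma> s \<in> K" "\<gamma> t \<in> K" "\<gamma> s \<noteq> \<gamma> t" for s t
        using connected_contains_arc[OF \<open>connected K\<close> KJ st(1-5)]
      proof
        assume a: "\<gamma> ` {s<..<t} \<subseteq> K"
        show ?thesis
        proof (rule local[of "\<gamma> ` {0..s} \<union> \<gamma> ` {t..1}" "(s + t) / 2"])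
          show "\<gamma> ((s + t) / 2) \<notin> \<gamma> ` {0..s} \<union> \<gamma> ` {t..1}"
          proof
            assume "\<gamma> ((s + t) / 2) \<in> \<gamma> ` {0..s} \<union> \<gamma> ` {t..1}"
            then obtain x where "x \<in> {0..s} \<union> {t..1}" "\<gamma> ((s + t) / 2) = \<gamma> x" by blast
            then show False using injD[of "(s + t) / 2" x] st by auto
          qed
          have "{0..1} \<subseteq> {0..s} \<union> {t..1} \<union> {s<..<t}" using st by auto
          then show "J - (\<gamma> ` {0..s} \<union> \<gamma> ` {t..1}) \<subseteq> K" using a unfolding path_image_def by blast
        qed (use st in \<open>auto intro!: closed_Un image_closed\<close>)
      next
        assume a: "\<gamma> ` ({0..1} - {s..t}) \<subseteq> K"
        \<comment> \<open>A parameter outside \<open>{s..t}\<close>: beyond \<open>t\<close> if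
          \<open>s = 0\<close>, otherwise before \<open>s\<close>. The case \<open>s = 0\<close>,
          \<open>t = 1\<close> is excluded because the two points differ.\<close>
        define m where "m = (if s = 0 then (t + 1) / 2 else s / 2)"
        have "s \<noteq> 0 \<or> t \<noteq> 1" using st(6) endpoints by auto
        then have m: "0 < m" "m < 1" "m \<notin> {s..t}" using st by (auto simp: m_def)
        show ?thesis
        proof (rule local[of "\<gamma> ` {s..t}" m])
          show "\<gamma> m \<notin> \<gamma> ` {s..t}"
          proof
            assume "\<gamma> m \<in> \<gamma> ` {s..t}"
            then obtain x where "x \<in> {s..t}" "\<gamma> m = \<gamma> x" by blast
            then show False using injD[of m x] st m by auto
          qed
          show "J - \<gamma> ` {s..t} \<subseteq> K" using a unfolding path_image_def by blast
        qed (use st m in \<open>auto intro!: image_closed\<close>)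
      qed
      obtain s t where st: "s \<in> {0..1}" "t \<in> {0..1}" "x = \<gamma> s" "y = \<gamma> t"
        using xy by (auto simp: path_image_def)
      have "x \<in> K" "y \<in> K" using inK xy by (auto simp: w_def)
      then show ?thesis using ordered[of s t] ordered[of t s] st xy(3) by (cases s t rule: linorder_cases) auto
    qed
    then obtain p \<epsilon> where pe: "p \<in> J" "0 < \<epsilon>" "J \<inter> ball p \<epsilon> \<subseteq> K" by blast
    obtain z where z: "z \<in> \<Omega>" using domain_facts(4) by blast
    have "f z = w"
      by (rule constant_if_constant_on_boundary_arc[OF hol contf pe(1,2) _ z]) (use pe fK in blast)
    then show False using wR im z by blast
  qed
  then have "inj_on f (closure \<Omega>)"
    using inj bd im domain_facts(7) unfolding inj_on_def by (metis Un_iff imageI)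
  moreover have "f ` closure \<Omega> = closure R"
  proof
    show "f ` closure \<Omega> \<subseteq> closure R"
      using im closure_subset[of R] by (intro image_closure_subset[OF contf]) auto
    have "compact (f ` closure \<Omega>)" by (intro compact_continuous_image contf domain_facts(10))
    moreover have "R \<subseteq> f ` closure \<Omega>" using im closure_subset by blast
    ultimately show "closure R \<subseteq> f ` closure \<Omega>" by (intro closure_minimal compact_imp_closed)
  qed
  ultimately show ?thesis using homeomorphism_compact[OF domain_facts(10) contf] by blast
qed

end

section \<open>Boundary collars of regular curves\<close>

lemma complex_orthogonal_line:
  fixes w n T :: complex
  assumes "w \<bullet> T = 0" "n \<bullet> T = 0" "T \<noteq> 0" "norm n = 1"
  shows "w = of_real (w \<bullet> n) * n"
proof -
  have nn: "Re n * Re n + Im n * Im n = 1"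
    using assms(4) by (simp add: cmod_def power2_eq_square)
  have e1: "Re w * Re T + Im w * Im T = 0" and e2: "Re n * Re T + Im n * Im T = 0"
    using assms by (auto simp: inner_complex_def)
  have x: "(Re w * Im n - Im w * Re n) * Re T = Im n * (Re w * Re T + Im w * Im T) - Im w * (Re n * Re T + Im n * Im T)"
    "(Re w * Im n - Im w * Re n) * Im T = Re w * (Re n * Re T + Im n * Im T) - Re n * (Re w * Re T + Im w * Im T)"
    by (simp_all add: algebra_simps)
  have "Re T \<noteq> 0 \<or> Im T \<noteq> 0" using assms(3) by (auto simp: complex_eq_iff)
  then have k: "Re w * Im n - Im w * Re n = 0" using x e1 e2 by auto
  have "Re w = (Re w * Re n + Im w * Im n) * Re n" "Im w = (Re w * Re n + Im w * Im n) * Im n"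
    using k nn by algebra+
  then show ?thesis by (simp add: complex_eq_iff inner_complex_def)
qed

context jordan_curve
begin

lemma connected_in_side:
  assumes "connected B" "B \<inter> J = {}" "B \<inter> \<Omega> \<noteq> {}"
  shows "B \<subseteq> \<Omega>"
proof (rule ccontr)
  assume "\<not> B \<subseteq> \<Omega>"
  then have "B \<inter> frontier \<Omega> \<noteq> {}" using assms by (intro connected_Int_frontier) auto
  then show False using assms(2) domain_facts(5) by auto
qed

lemma complement_cases: "z \<notin> J \<Longrightarrow> z \<in> \<Omega> \<or> z \<in> outside J"
  using inside_Un_outside[of J] by blast

text \<open>If \<open>J\<close> had a point off the other curve, that curve would lie on an arc of \<open>J\<close>, whose
  complement is connected.\<close>

lemma simple_closed_subcurve:
  assumes "jordan_curve \<delta>" "path_image \<delta> \<subseteq> J"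
  shows "path_image \<delta> = J"
proof (rule ccontr)
  assume ne: "path_image \<delta> \<noteq> J"
  interpret d: jordan_curve \<delta> by fact
  obtain q where q: "q \<in> J" "q \<notin> path_image \<delta>" using ne assms(2) by blast
  obtain a where a: "a \<in> {0..1}" "q = \<gamma> a" using q by (auto simp: path_image_def)
  interpret g: jordan_curve "shiftpath a \<gamma>" using shift a by blast
  define g where "g = shiftpath a \<gamma>"
  have "open (- path_image \<delta>)" using d.domain_facts(8) by (simp add: compact_imp_closed open_Compl)
  then obtain \<epsilon> where \<epsilon>: "\<epsilon> > 0" "ball q \<epsilon> \<subseteq> - path_image \<delta>"
    using q(2) by (meson ComplI open_contains_ball)
  obtain \<eta> where \<eta>: "0 < \<eta>" "\<eta> < 1/2" "\<And>s. \<lbrakk>0 \<le> s; s < \<eta>\<rbrakk> \<Longrightarrow> g s \<in> ball (g 0) \<epsilon>"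
    "\<And>s. \<lbrakk>1 - \<eta> < s; s \<le> 1\<rbrakk> \<Longrightarrow> g s \<in> ball (g 0) \<epsilon>"
    using g.small_arc_at_start[OF \<epsilon>(1)] unfolding g_def by blast
  have g0: "g 0 = q" using shift(3)[OF a(1)] a by (simp add: g_def)
  define C where "C = g ` {\<eta>..1 - \<eta>}"
  have J: "J = g ` {0..1}" using shift(2)[OF a(1)] by (simp add: path_image_def g_def)
  have "g s \<in> ball q \<epsilon>" if "s \<in> {0..1}" "s \<notin> {\<eta>..1 - \<eta>}" for s
    using \<eta>(3)[of s] \<eta>(4)[of s] that g0 by (cases "s < \<eta>") auto
  then have "J - C \<subseteq> ball q \<epsilon>" unfolding J C_def by blast
  then have \<delta>C: "path_image \<delta> \<subseteq> C" using assms(2) \<epsilon>(2) by blast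
  have CJ: "C \<subseteq> J" using J \<eta> by (auto simp: C_def)
  have "inj_on g {\<eta>..1 - \<eta>}" using g.injD \<eta> unfolding g_def by (fastforce intro!: inj_onI)
  moreover have "continuous_on {\<eta>..1 - \<eta>} g"
    using g.cont \<eta> unfolding g_def by (auto intro: continuous_on_subset)
  ultimately have "{\<eta>..1 - \<eta>} homeomorphic C"
    using homeomorphism_compact[of "{\<eta>..1 - \<eta>}" g C] by (auto simp: homeomorphic_def C_def)
  then have "C homeomorphic {\<eta>..1 - \<eta>}" by (rule homeomorphic_sym[THEN iffD1])
  then have cC: "connected (- C)"
    by (rule connected_complement_homeomorphic_convex_compact) auto
  \<comment> \<open>The connected set \<open>- C\<close> misses the curve \<open>\<delta>\<close>;
    if it met the inside of \<open>\<delta>\<close>, it would lie there and be bounded. So this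
    inside lies in \<open>J\<close>, impossible for a nonempty open set since \<Omega> accumulates
    at each point of \<open>J\<close>.\<close>
  have "inside (path_image \<delta>) \<subseteq> C"
  proof (rule ccontr)
    assume "\<not> ?thesis"
    then have "- C \<subseteq> inside (path_image \<delta>)"
      using \<delta>C cC by (intro d.connected_in_side) auto
    then have "bounded (- C)" using d.domain_facts(3) bounded_subset by blast
    moreover have "bounded C" using CJ domain_facts(8) by (meson bounded_subset compact_imp_bounded)
    ultimately have "bounded (UNIV :: complex set)" by (metis Compl_partition bounded_Un)
    then show False by simp
  qed
  then have sub: "inside (path_image \<delta>) \<subseteq> J" using CJ by blast
  obtain z where z: "z \<in> inside (path_image \<delta>)" using d.domain_facts(4) by blast
  then have "z \<in> closure \<Omega>" using sub domain_facts(7) by blast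
  then have "inside (path_image \<delta>) \<inter> \<Omega> \<noteq> {}"
    using z d.domain_facts(1) open_Int_closure_eq_empty by blast
  then show False using sub domain_facts(6) by blast
qed

text \<open>Coordinates \<open>(t, s)\<close> with one fixed direction \<open>m\<close>, the normal
  at \<open>t0\<close>: the normal at each \<open>t\<close> would be merely continuous in
  \<open>t\<close>, while the map with fixed \<open>m\<close> is as smooth as the curve. Positive
  \<open>s\<close> leads into \<Omega> and negative \<open>s\<close> outside, the coordinates cover
  a neighbourhood of \<open>\<gamma> t0\<close>, and the last clause is a Lipschitz bound for their
  inverse.\<close>

lemma flow_box:
  assumes reg: "regular_off S \<gamma>" and t0: "t0 \<in> {0<..<1} - S" and \<delta>0: "0 < \<delta>0"
  obtains m \<delta> s0 \<rho> L where
    "norm m = 1" "m \<bullet> vector_derivative \<gamma> (at t0) = 0" "0 < \<delta>" "\<delta> \<le> \<delta>0"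
    "{t0-\<delta>..t0+\<delta>} \<subseteq> {0<..<1} - S" "0 < s0" "0 < \<rho>"
    "\<And>t s. \<lbrakk>t \<in> {t0-\<delta>..t0+\<delta>}; 0 < s; s \<le> s0\<rbrakk> \<Longrightarrow> \<gamma> t - of_real s * m \<in> \<Omega> \<and> \<gamma> t + of_real s * m \<in> outside J"
    "\<And>z. z \<in> ball (\<gamma> t0) \<rho> \<Longrightarrow> \<exists>t\<in>{t0-\<delta>..t0+\<delta>}. \<exists>s. \<bar>s\<bar> \<le> s0 \<and> z = \<gamma> t - of_real s * m"
    "\<And>t t1 s s1. \<lbrakk>t \<in> {t0-\<delta>..t0+\<delta>}; t1 \<in> {t0-\<delta>..t0+\<delta>}\<rbrakk> \<Longrightarrow>
        \<bar>t - t1\<bar> + \<bar>s - s1\<bar> \<le> L * norm ((\<gamma> t - of_real s * m) - (\<gamma> t1 - of_real s1 * m))"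
proof -
  define D where "D = (\<lambda>t. vector_derivative \<gamma> (at t))"
  have hasD: "(\<gamma> has_vector_derivative D t) (at t)" if "t \<in> {0..1} - S" for t
    using reg that by (auto simp: regular_off_def C1_differentiable_on_eq D_def vector_derivative_works[symmetric])
  have contD: "continuous_on ({0<..<1} - S) D"
    using reg unfolding regular_off_def C1_differentiable_on_eq D_def by (auto intro: continuous_on_subset)
  have opS: "open ({0<..<1} - S)" using reg by (auto simp: regular_off_def finite_imp_closed open_Diff)
  define T where "T = D t0"
  have T: "T \<noteq> 0" using reg t0 by (auto simp: regular_off_def T_def D_def)
  \<comment> \<open>Half of the value of \<open>D t \<bullet> T\<close> at \<open>t0\<close>, so
    \<open>c < D t \<bullet> T\<close> persists nearby; the component along \<open>T\<close> then
    grows at rate at least \<open>c\<close> and recovers \<open>t\<close>.\<close>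
  define c where "c = (norm T)\<^sup>2 / 2"
  have c: "c > 0" using T by (simp add: c_def)
  have "open (({0<..<1} - S) \<inter> (\<lambda>t. D t \<bullet> T) -` {c<..})"
    by (rule continuous_open_preimage[OF _ opS open_greaterThan]) (intro continuous_intros contD)
  moreover have "t0 \<in> ({0<..<1} - S) \<inter> (\<lambda>t. D t \<bullet> T) -` {c<..}"
    using t0 T by (auto simp: c_def T_def[symmetric] dot_square_norm)
  ultimately obtain d0 where d0: "d0 > 0" "cball t0 d0 \<subseteq> ({0<..<1} - S) \<inter> (\<lambda>t. D t \<bullet> T) -` {c<..}"
    by (meson open_contains_cball)
  define \<delta>1 where "\<delta>1 = min d0 \<delta>0"
  have \<delta>1: "0 < \<delta>1" "\<delta>1 \<le> \<delta>0" using d0 \<delta>0 by (auto simp: \<delta>1_def)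
  define I where "I = {t0-\<delta>1..t0+\<delta>1}"
  have "I \<subseteq> cball t0 d0" by (auto simp: I_def \<delta>1_def cball_eq_atLeastAtMost)
  then have Isub: "I \<subseteq> {0<..<1} - S" and Ic: "\<And>t. t \<in> I \<Longrightarrow> c < D t \<bullet> T"
    using d0(2) by blast+
  have IS: "x \<in> {0..1} - S" if "x \<in> I" for x using subsetD[OF Isub that] by auto
  have lt: "c * (b - a) \<le> (\<gamma> b - \<gamma> a) \<bullet> T" if "a \<in> I" "b \<in> I" "a < b" for a b
  proof -
    have inI: "x \<in> I" if "a \<le> x" "x \<le> b" for x using that \<open>a \<in> I\<close> \<open>b \<in> I\<close> by (auto simp: I_def)
    have "((\<lambda>t. \<gamma> t \<bullet> T) has_real_derivative D x \<bullet> T) (at x)" if "a \<le> x" "x \<le> b" for x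
    proof -
      have "(\<gamma> has_derivative (\<lambda>h. h *\<^sub>R D x)) (at x)"
        using hasD[OF IS[OF inI[OF that]]] by (simp add: has_vector_derivative_def)
      then have "((\<lambda>t. \<gamma> t \<bullet> T) has_derivative (\<lambda>h. (h *\<^sub>R D x) \<bullet> T)) (at x)" by (rule has_derivative_inner_left)
      then show ?thesis by (simp add: has_field_derivative_def mult_commute_abs)
    qed
    then obtain x where x: "a < x" "x < b" "\<gamma> b \<bullet> T - \<gamma> a \<bullet> T = (b - a) * (D x \<bullet> T)"
      using MVT2[OF \<open>a < b\<close>, of "\<lambda>t. \<gamma> t \<bullet> T" "\<lambda>x. D x \<bullet> T"] by auto
    have "(b - a) * c \<le> (b - a) * (D x \<bullet> T)" using Ic[OF inI[of x]] x that by (intro mult_left_mono) auto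
    then show ?thesis using x by (simp add: inner_diff_left mult.commute)
  qed
  have mvt: "c * \<bar>t - t1\<bar> \<le> \<bar>(\<gamma> t - \<gamma> t1) \<bullet> T\<bar>" if "t \<in> I" "t1 \<in> I" for t t1
  proof -
    show ?thesis
    proof (cases t t1 rule: linorder_cases)
      case less
      then show ?thesis using lt[OF that less] by (simp add: inner_diff_left abs_if)
    next
      case greater
      then show ?thesis using lt[OF that(2,1) greater] by (simp add: inner_diff_left abs_if)
    qed simp
  qed
  have "compact (D ` I)" using contD Isub by (intro compact_continuous_image) (auto intro: continuous_on_subset simp: I_def)
  then obtain M where M: "\<And>t. t \<in> I \<Longrightarrow> norm (D t) \<le> M"
    by (meson bounded_iff compact_imp_bounded imageI)
  have lip: "norm (\<gamma> t - \<gamma> t1) \<le> M * \<bar>t - t1\<bar>" if "t \<in> I" "t1 \<in> I" for t t1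
  proof -
    have "norm (\<gamma> t - \<gamma> t1) \<le> M * norm (t - t1)"
    proof (rule differentiable_bound[of I \<gamma> "\<lambda>t h. h *\<^sub>R D t"])
      show "convex I" by (simp add: I_def)
      fix x assume x: "x \<in> I"
      then show "(\<gamma> has_derivative (\<lambda>h. h *\<^sub>R D x)) (at x within I)"
        using hasD[OF IS[OF x]] by (simp add: has_vector_derivative_def has_derivative_at_withinI)
      show "onorm (\<lambda>h. h *\<^sub>R D x) \<le> M"
      proof (rule onorm_le)
        fix h :: real
        show "norm (h *\<^sub>R D x) \<le> M * norm h"
          using mult_right_mono[OF M[OF x], of "norm h"] by (simp add: mult.commute)
      qed
    qed (use that in auto)
    then show ?thesis by simp
  qed
  have t0I: "t0 \<in> I" using \<delta>1 by (simp add: I_def)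
  have Mnn: "M \<ge> 0" using order_trans[OF norm_ge_zero M[OF t0I]] .
  define n where "n = \<i> * T / of_real (norm T)"
  have n: "norm n = 1" "n \<bullet> T = 0" using T by (auto simp: n_def norm_mult norm_divide inner_complex_def)
  \<comment> \<open>The first term controls the change of \<open>t\<close>, the second what this
    change contributes to \<open>s\<close>, and 1 accounts for the displacement itself.\<close>
  define L where "L = norm T / c + M * (norm T / c) + 1"
  have Lip: "\<bar>t - t1\<bar> + \<bar>s - s1\<bar> \<le> L * norm ((\<gamma> t - of_real s * m) - (\<gamma> t1 - of_real s1 * m))"
    if "t \<in> I" "t1 \<in> I" "norm m = 1" "m \<bullet> T = 0" for t t1 s s1 m
  proof -
    define w where "w = (\<gamma> t - of_real s * m) - (\<gamma> t1 - of_real s1 * m)"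
    have weq: "w = (\<gamma> t - \<gamma> t1) - (s - s1) *\<^sub>R m" by (simp add: w_def scaleR_conv_of_real algebra_simps)
    have "w \<bullet> T = (\<gamma> t - \<gamma> t1) \<bullet> T" using that(4) by (simp add: weq inner_diff_left)
    then have "c * \<bar>t - t1\<bar> \<le> norm w * norm T"
      using mvt[OF that(1,2)] Cauchy_Schwarz_ineq2[of w T] by simp
    then have a: "\<bar>t - t1\<bar> \<le> norm T / c * norm w" using c by (simp add: field_simps)
    have "(s - s1) *\<^sub>R m = (\<gamma> t - \<gamma> t1) - w" by (simp add: weq)
    then have "\<bar>s - s1\<bar> = norm ((\<gamma> t - \<gamma> t1) - w)" using that(3) by (metis mult.right_neutral norm_scaleR)
    also have "\<dots> \<le> M * \<bar>t - t1\<bar> + norm w"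
      using norm_triangle_ineq4[of "\<gamma> t - \<gamma> t1" w] lip[OF that(1,2)] by linarith
    also have "\<dots> \<le> M * (norm T / c * norm w) + norm w" using a Mnn by (intro add_mono mult_left_mono) auto
    finally have "\<bar>t - t1\<bar> + \<bar>s - s1\<bar> \<le> L * norm w" using a by (simp add: L_def algebra_simps)
    then show ?thesis by (simp add: w_def)
  qed
  define p where "p = \<gamma> t0"
  have Ii: "0 < t0 - \<delta>1" "t0 + \<delta>1 < 1" using Isub \<delta>1 by (auto simp: I_def subset_iff)
  obtain r where r: "r > 0" "ball p r \<inter> \<gamma> ` ({0..t0-\<delta>1} \<union> {t0+\<delta>1..1}) = {}"
  proof -
    have "open (- \<gamma> ` ({0..t0-\<delta>1} \<union> {t0+\<delta>1..1}))"
      unfolding image_Un using Ii \<delta>1 by (intro open_Compl closed_Un image_closed) auto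
    moreover have "p \<in> - \<gamma> ` ({0..t0-\<delta>1} \<union> {t0+\<delta>1..1})"
    proof (rule ComplI)
      assume "p \<in> \<gamma> ` ({0..t0-\<delta>1} \<union> {t0+\<delta>1..1})"
      then obtain x where "x \<in> {0..t0-\<delta>1} \<union> {t0+\<delta>1..1}" "\<gamma> t0 = \<gamma> x" unfolding p_def by blast
      then show False using injD[of t0 x] Ii \<delta>1 by auto
    qed
    ultimately obtain r where "r > 0" "ball p r \<subseteq> - \<gamma> ` ({0..t0-\<delta>1} \<union> {t0+\<delta>1..1})"
      by (meson open_contains_ball)
    then show ?thesis using that by blast
  qed
  \<comment> \<open>Half of the radius that is free of the far part of the curve: since the choice
    of \<open>\<delta>\<close> gives \<open>norm (\<gamma> t - p) < s0\<close>, the whole collar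
    stays in \<open>ball p r\<close>.\<close>
  define s0 where "s0 = r / 2"
  define \<delta> where "\<delta> = min \<delta>1 (s0 / (2 * (M + 1)))"
  have s0: "s0 > 0" using r by (simp add: s0_def)
  have \<delta>: "0 < \<delta>" "\<delta> \<le> \<delta>1" using \<delta>1 s0 Mnn by (auto simp: \<delta>_def)
  define I' where "I' = {t0-\<delta>..t0+\<delta>}"
  have I'I: "I' \<subseteq> I" using \<delta> by (auto simp: I_def I'_def)
  have close: "norm (\<gamma> t - p) < s0" "norm (\<gamma> t - p) \<le> s0 / 2" if "t \<in> I'" for t
  proof -
    have "norm (\<gamma> t - p) \<le> M * \<bar>t - t0\<bar>" unfolding p_def using that I'I t0I by (intro lip) auto
    also have "\<dots> \<le> (M + 1) * (s0 / (2 * (M + 1)))"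
      using that Mnn by (intro mult_mono) (auto simp: I'_def \<delta>_def)
    also have "\<dots> = s0 / 2" using Mnn by (simp add: field_simps)
    finally show "norm (\<gamma> t - p) \<le> s0 / 2" .
    then show "norm (\<gamma> t - p) < s0" using s0 by linarith
  qed
  \<comment> \<open>In \<open>ball p r\<close> only curve points with parameter in \<open>I\<close>
    occur; comparing with such a point, for which \<open>s1 = 0\<close>, the bound
    \<open>Lip\<close> forces \<open>s = 0\<close>.\<close>
  have offJ: "\<gamma> t - of_real s * m \<notin> J"
    if t: "t \<in> I'" and s: "\<bar>s\<bar> \<le> s0" "s \<noteq> 0" and m: "norm m = 1" "m \<bullet> T = 0" for t s m
  proof
    assume "\<gamma> t - of_real s * m \<in> J"
    then obtain x where x: "x \<in> {0..1}" "\<gamma> t - of_real s * m = \<gamma> x" by (auto simp: path_image_def)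
    have "norm (\<gamma> x - p) \<le> norm (\<gamma> t - p) + norm (of_real s * m)"
      unfolding x(2)[symmetric] using norm_triangle_ineq4[of "\<gamma> t - p" "of_real s * m"] by (simp add: algebra_simps)
    also have "\<dots> < r" using close(1)[OF t] s m by (simp add: norm_mult s0_def)
    finally have "\<gamma> x \<in> ball p r" by (simp add: dist_norm norm_minus_commute)
    then have "x \<notin> {0..t0-\<delta>1} \<union> {t0+\<delta>1..1}" using r(2) by blast
    then have "x \<in> I" using x(1) by (auto simp: I_def)
    then have "\<bar>t - x\<bar> + \<bar>s - 0\<bar> \<le> L * norm ((\<gamma> t - of_real s * m) - (\<gamma> x - of_real 0 * m))"
      using t I'I m by (intro Lip) auto
    then show False using x(2) s by simp
  qed
  define side where "side = (\<lambda>m. (\<lambda>(t, s). \<gamma> t - of_real s * m) ` (I' \<times> {0<..s0}))"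
  have conn: "connected (side m)" for m
    unfolding side_def
  proof (rule connected_continuous_image)
    have "continuous_on (I' \<times> {0<..s0}) (\<lambda>x. \<gamma> (fst x))"
      by (rule continuous_on_compose2[OF cont]) (use I'I Isub in \<open>auto intro!: continuous_intros\<close>)
    then show "continuous_on (I' \<times> {0<..s0}) (\<lambda>(t, s). \<gamma> t - of_real s * m)"
      unfolding case_prod_unfold by (intro continuous_intros)
    show "connected (I' \<times> {0<..s0})" by (intro connected_Times) (auto simp: I'_def)
  qed
  have sideJ: "side m \<inter> J = {}" if "norm m = 1" "m \<bullet> T = 0" for m
    using offJ[OF _ _ _ that] unfolding side_def by force
  \<comment> \<open>The second bound places \<open>z \<bullet> T\<close> between its values at
    \<open>t0 - \<delta>\<close> and \<open>t0 + \<delta>\<close>, so the intermediate value theorem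
    finds \<open>t\<close>; the first keeps the remaining normal displacement within
    \<open>s0\<close>.\<close>
  define \<rho> where "\<rho> = min (s0 / 2) (c * \<delta> / (norm T + 1))"
  have \<rho>: "\<rho> > 0" using s0 c \<delta> by (auto simp: \<rho>_def intro!: divide_pos_pos add_nonneg_pos)
  have cover: "\<exists>t\<in>I'. \<exists>s. \<bar>s\<bar> \<le> s0 \<and> z = \<gamma> t - of_real s * m"
    if z: "z \<in> ball p \<rho>" and m: "norm m = 1" "m \<bullet> T = 0" for z m
  proof -
    have "\<bar>(z - p) \<bullet> T\<bar> \<le> norm (z - p) * norm T" by (rule Cauchy_Schwarz_ineq2)
    also have "\<dots> \<le> norm (z - p) * (norm T + 1)" by (intro mult_left_mono) auto
    also have "\<dots> < c * \<delta>"
      using z by (auto simp: \<rho>_def dist_norm norm_minus_commute pos_less_divide_eq add_nonneg_pos)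
    finally have zT: "\<bar>z \<bullet> T - p \<bullet> T\<bar> < c * \<delta>" by (simp add: inner_diff_left)
    have ends: "t0 - \<delta> \<in> I" "t0 + \<delta> \<in> I" using \<delta> by (auto simp: I_def)
    have up: "p \<bullet> T + c * \<delta> \<le> \<gamma> (t0 + \<delta>) \<bullet> T" and down: "\<gamma> (t0 - \<delta>) \<bullet> T \<le> p \<bullet> T - c * \<delta>"
      using lt[OF t0I ends(2)] lt[OF ends(1) t0I] \<delta> by (auto simp: p_def inner_diff_left)
    have "continuous_on {t0-\<delta>..t0+\<delta>} (\<lambda>t. \<gamma> t \<bullet> T)"
      unfolding I'_def[symmetric] using I'I IS by (intro continuous_intros continuous_on_subset[OF cont]) blast
    then obtain t where t: "t \<in> I'" "\<gamma> t \<bullet> T = z \<bullet> T"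
      using IVT'[of "\<lambda>t. \<gamma> t \<bullet> T" "t0 - \<delta>" "z \<bullet> T" "t0 + \<delta>"] up down zT \<delta> by (auto simp: I'_def abs_less_iff)
    define s where "s = (\<gamma> t - z) \<bullet> m"
    have "\<gamma> t - z = of_real s * m"
      unfolding s_def using t m T by (intro complex_orthogonal_line) (auto simp: inner_diff_left)
    then have zeq: "z = \<gamma> t - of_real s * m" by (simp add: algebra_simps)
    have "\<bar>s\<bar> = norm (\<gamma> t - z)" using zeq m by (simp add: norm_mult)
    also have "\<dots> \<le> norm (\<gamma> t - p) + norm (p - z)" using norm_triangle_ineq[of "\<gamma> t - p" "p - z"] by simp
    also have "\<dots> \<le> s0" using close(2)[OF t(1)] z by (auto simp: \<rho>_def dist_norm)
    finally show ?thesis using t zeq by blast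
  qed
  have pJ: "p \<in> J" using t0 by (auto simp: p_def path_image_def)
  \<comment> \<open>Each side is connected and misses \<open>J\<close>, and off \<open>J\<close> the
    two sides cover a ball around \<open>p\<close>. Both \<Omega> and the outside come arbitrarily
    close to \<open>p\<close>, so one side lies in \<Omega> and the other does not meet it. This
    selects the sign of \<open>n\<close>.\<close>
  have which: "\<exists>m. norm m = 1 \<and> m \<bullet> T = 0 \<and> side m \<subseteq> \<Omega> \<and> side (- m) \<inter> \<Omega> = {}"
  proof -
    have nn: "norm (- n) = 1" "(- n) \<bullet> T = 0" using n by auto
    have in_side: "z \<in> side n \<or> z \<in> side (- n)" if z: "z \<in> ball p \<rho>" "z \<notin> J" for z
    proof -
      obtain t s where ts: "t \<in> I'" "\<bar>s\<bar> \<le> s0" "z = \<gamma> t - of_real s * n" using cover[OF z(1) n] by blast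
      have "s \<noteq> 0"
      proof
        assume "s = 0"
        then have "z \<in> J" using ts I'I Isub by (fastforce simp: path_image_def)
        then show False using z by blast
      qed
      then show ?thesis
      proof (cases "s > 0")
        case True
        then have "z \<in> side n" unfolding side_def using ts by (intro image_eqI[of _ _ "(t, s)"]) auto
        then show ?thesis ..
      next
        case False
        then have "z \<in> side (- n)" unfolding side_def using ts \<open>s \<noteq> 0\<close> by (intro image_eqI[of _ _ "(t, - s)"]) auto
        then show ?thesis ..
      qed
    qed
    obtain z1 where z1: "z1 \<in> \<Omega>" "z1 \<in> ball p \<rho>" using near_point[OF pJ \<rho>] by blast
    have "p \<in> closure (outside J)" using pJ frontier_outside_J by (auto simp: frontier_def)
    then obtain z2 where z2: "z2 \<in> outside J" "z2 \<in> ball p \<rho>"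
      using \<rho> closure_approachable[of p "outside J"] by (auto simp: dist_commute)
    have z1J: "z1 \<notin> J" and z2J: "z2 \<notin> J" and z2\<Omega>: "z2 \<notin> \<Omega>"
      using z1 z2 domain_facts(6) outside_no_overlap[of J] inside_Int_outside[of J] by blast+
    have out: "side m' \<inter> \<Omega> = {}" if "z2 \<in> side m'" "norm m' = 1" "m' \<bullet> T = 0" for m'
      using connected_in_side[OF conn sideJ[OF that(2,3)]] that z2\<Omega> by blast
    have inn: "side m' \<subseteq> \<Omega>" if "z1 \<in> side m'" "norm m' = 1" "m' \<bullet> T = 0" for m'
      using connected_in_side[OF conn sideJ[OF that(2,3)]] that z1 by blast
    show ?thesis
    proof (cases "z1 \<in> side n")
      case True
      then have "side n \<subseteq> \<Omega>" using inn n by blast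
      moreover have "z2 \<in> side (- n)" using in_side[OF z2(2) z2J] calculation z2\<Omega> by blast
      ultimately show ?thesis using n out[OF _ nn] by blast
    next
      case False
      then have "side (- n) \<subseteq> \<Omega>" using inn[OF _ nn] in_side[OF z1(2) z1J] by blast
      moreover have "z2 \<in> side n" using in_side[OF z2(2) z2J] calculation z2\<Omega> by blast
      ultimately show ?thesis using nn out[OF _ n] by (intro exI[of _ "- n"]) auto
    qed
  qed
  then obtain m where m: "norm m = 1" "m \<bullet> T = 0" "side m \<subseteq> \<Omega>" "side (- m) \<inter> \<Omega> = {}" by blast
  show ?thesis
  proof (rule that[of m \<delta> s0 \<rho> L])
    show "norm m = 1" "m \<bullet> vector_derivative \<gamma> (at t0) = 0" using m by (auto simp: T_def D_def)
    show "0 < \<delta>" "\<delta> \<le> \<delta>0" "0 < s0" "0 < \<rho>" using \<delta> \<delta>1 s0 \<rho> by auto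
    show "{t0-\<delta>..t0+\<delta>} \<subseteq> {0<..<1} - S" using I'I Isub by (simp add: I'_def)
    show "\<gamma> t - of_real s * m \<in> \<Omega> \<and> \<gamma> t + of_real s * m \<in> outside J"
      if "t \<in> {t0-\<delta>..t0+\<delta>}" "0 < s" "s \<le> s0" for t s
    proof
      show "\<gamma> t - of_real s * m \<in> \<Omega>"
        using m(3) that by (auto simp: side_def I'_def image_subset_iff)
      have "\<gamma> t - of_real s * (- m) \<in> side (- m)"
        unfolding side_def using that by (intro image_eqI[of _ _ "(t, s)"]) (auto simp: I'_def)
      then have *: "\<gamma> t + of_real s * m \<in> side (- m)" by simp
      then have "\<gamma> t + of_real s * m \<notin> J" using sideJ[of "- m"] m by auto
      then show "\<gamma> t + of_real s * m \<in> outside J" using complement_cases m(4) * by blast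
    qed
    show "\<exists>t\<in>{t0-\<delta>..t0+\<delta>}. \<exists>s. \<bar>s\<bar> \<le> s0 \<and> z = \<gamma> t - of_real s * m" if "z \<in> ball (\<gamma> t0) \<rho>" for z
      using cover[of z m] that m by (simp add: I'_def p_def)
    show "\<bar>t - t1\<bar> + \<bar>s - s1\<bar> \<le> L * norm ((\<gamma> t - of_real s * m) - (\<gamma> t1 - of_real s1 * m))"
      if "t \<in> {t0-\<delta>..t0+\<delta>}" "t1 \<in> {t0-\<delta>..t0+\<delta>}" for t t1 s s1
      using that I'I m by (intro Lip) (auto simp: I'_def)
  qed
qed

end

section \<open>Harmonic conjugates and their boundary values\<close>

text \<open>Mean value theorem in direction \<open>a\<close>, then the first order expansion of the
  gradient at \<open>z0\<close> alone. The second difference is symmetric in \<open>a\<close> and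
  \<open>b\<close>, the comparison term \<open>H b \<bullet> a\<close> not visibly so; exchanging
  them will give the symmetry of \<open>H\<close>.\<close>

lemma second_difference_bound:
  fixes u :: "'a::real_inner \<Rightarrow> real" and g :: "'a \<Rightarrow> 'a"
  assumes du: "\<And>z. z \<in> ball z0 r \<Longrightarrow> (u has_derivative (\<lambda>v. g z \<bullet> v)) (at z)"
    and dg: "\<And>w. norm w < r \<Longrightarrow> norm (g (z0 + w) - g z0 - H w) \<le> \<epsilon> * norm w"
    and H: "linear H" and t: "0 < t" "t * (norm a + norm b) < r" and \<epsilon>: "0 \<le> \<epsilon>"
  shows "\<bar>u (z0 + t *\<^sub>R a + t *\<^sub>R b) - u (z0 + t *\<^sub>R a) - u (z0 + t *\<^sub>R b) + u z0 - t * t * (H b \<bullet> a)\<bar>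
      \<le> t * t * (2 * \<epsilon> * (norm a + norm b) * norm a)"
proof -
  have small: "norm (s *\<^sub>R a + c *\<^sub>R b) \<le> t * (norm a + norm b)" if "0 \<le> s" "s \<le> t" "0 \<le> c" "c \<le> t" for s c
  proof -
    have "norm (s *\<^sub>R a + c *\<^sub>R b) \<le> s * norm a + c * norm b"
      using norm_triangle_ineq[of "s *\<^sub>R a" "c *\<^sub>R b"] that by simp
    also have "\<dots> \<le> t * norm a + t * norm b" using that by (intro add_mono mult_right_mono) auto
    finally show ?thesis by (simp add: algebra_simps)
  qed
  have inb: "z0 + s *\<^sub>R a + c *\<^sub>R b \<in> ball z0 r" if "0 \<le> s" "s \<le> t" "0 \<le> c" "c \<le> t" for s c
  proof -
    have "dist z0 (z0 + w) = norm w" for w by (simp add: dist_norm)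
    then show ?thesis unfolding add.assoc mem_ball using small[OF that] t(2) by simp
  qed
  define \<phi> where "\<phi> = (\<lambda>s. u (z0 + s *\<^sub>R a + t *\<^sub>R b) - u (z0 + s *\<^sub>R a + 0 *\<^sub>R b))"
  have der: "((\<lambda>s. u (z0 + s *\<^sub>R a + c *\<^sub>R b)) has_real_derivative (g (z0 + s *\<^sub>R a + c *\<^sub>R b) \<bullet> a)) (at s)"
    if "0 \<le> s" "s \<le> t" "0 \<le> c" "c \<le> t" for s c
  proof -
    have "((\<lambda>s. z0 + s *\<^sub>R a + c *\<^sub>R b) has_derivative (\<lambda>h. h *\<^sub>R a)) (at s)"
      by (auto intro!: derivative_eq_intros)
    from has_derivative_compose[OF this du[OF inb[OF that]]]
    show ?thesis by (simp add: has_field_derivative_def mult_commute_abs)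
  qed
  have "(\<phi> has_real_derivative (g (z0 + s *\<^sub>R a + t *\<^sub>R b) \<bullet> a - g (z0 + s *\<^sub>R a + 0 *\<^sub>R b) \<bullet> a)) (at s)"
    if "0 \<le> s" "s \<le> t" for s
    unfolding \<phi>_def using that t by (intro DERIV_diff der) auto
  then obtain \<xi> where \<xi>: "0 < \<xi>" "\<xi> < t"
    "\<phi> t - \<phi> 0 = (t - 0) * (g (z0 + \<xi> *\<^sub>R a + t *\<^sub>R b) \<bullet> a - g (z0 + \<xi> *\<^sub>R a + 0 *\<^sub>R b) \<bullet> a)"
    using MVT2[OF t(1), of \<phi> "\<lambda>s. g (z0 + s *\<^sub>R a + t *\<^sub>R b) \<bullet> a - g (z0 + s *\<^sub>R a + 0 *\<^sub>R b) \<bullet> a"] by auto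
  define R where "R = (\<lambda>w. g (z0 + w) - g z0 - H w)"
  have R: "norm (R (\<xi> *\<^sub>R a + c *\<^sub>R b)) \<le> \<epsilon> * (t * (norm a + norm b))" if "0 \<le> c" "c \<le> t" for c
  proof -
    have n: "norm (\<xi> *\<^sub>R a + c *\<^sub>R b) \<le> t * (norm a + norm b)" using small \<xi> that by simp
    then have "norm (R (\<xi> *\<^sub>R a + c *\<^sub>R b)) \<le> \<epsilon> * norm (\<xi> *\<^sub>R a + c *\<^sub>R b)"
      unfolding R_def using t(2) by (intro dg) auto
    also have "\<dots> \<le> \<epsilon> * (t * (norm a + norm b))" using n \<epsilon> by (intro mult_left_mono) auto
    finally show ?thesis .
  qed
  have Hd: "H (\<xi> *\<^sub>R a + t *\<^sub>R b) - H (\<xi> *\<^sub>R a + 0 *\<^sub>R b) = t *\<^sub>R H b"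
    by (simp add: linear_add[OF H] linear_scale[OF H])
  have gd: "g (z0 + \<xi> *\<^sub>R a + t *\<^sub>R b) - g (z0 + \<xi> *\<^sub>R a + 0 *\<^sub>R b)
      = t *\<^sub>R H b + (R (\<xi> *\<^sub>R a + t *\<^sub>R b) - R (\<xi> *\<^sub>R a + 0 *\<^sub>R b))"
    unfolding Hd[symmetric] by (simp add: R_def add.assoc)
  have "\<phi> t - \<phi> 0 = t * ((t *\<^sub>R H b + (R (\<xi> *\<^sub>R a + t *\<^sub>R b) - R (\<xi> *\<^sub>R a + 0 *\<^sub>R b))) \<bullet> a)"
    unfolding gd[symmetric] \<xi>(3) by (simp add: inner_diff_left)
  then have eq: "\<phi> t - \<phi> 0 - t * t * (H b \<bullet> a) = t * ((R (\<xi> *\<^sub>R a + t *\<^sub>R b) - R (\<xi> *\<^sub>R a + 0 *\<^sub>R b)) \<bullet> a)"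
    by (simp add: inner_add_left algebra_simps)
  have "\<bar>(R (\<xi> *\<^sub>R a + t *\<^sub>R b) - R (\<xi> *\<^sub>R a + 0 *\<^sub>R b)) \<bullet> a\<bar>
      \<le> norm (R (\<xi> *\<^sub>R a + t *\<^sub>R b) - R (\<xi> *\<^sub>R a + 0 *\<^sub>R b)) * norm a" by (rule Cauchy_Schwarz_ineq2)
  also have "\<dots> \<le> (\<epsilon> * (t * (norm a + norm b)) + \<epsilon> * (t * (norm a + norm b))) * norm a"
    using R[of t] R[of 0] t norm_triangle_ineq4 by (intro mult_right_mono order_trans[OF norm_triangle_ineq4 add_mono]) auto
  finally have le: "\<bar>(R (\<xi> *\<^sub>R a + t *\<^sub>R b) - R (\<xi> *\<^sub>R a + 0 *\<^sub>R b)) \<bullet> a\<bar>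
      \<le> (\<epsilon> * (t * (norm a + norm b)) + \<epsilon> * (t * (norm a + norm b))) * norm a" .
  have "\<bar>\<phi> t - \<phi> 0 - t * t * (H b \<bullet> a)\<bar>
      \<le> t * ((\<epsilon> * (t * (norm a + norm b)) + \<epsilon> * (t * (norm a + norm b))) * norm a)"
    unfolding eq abs_mult using mult_left_mono[OF le, of t] t by simp
  also have "\<dots> = t * t * (2 * \<epsilon> * (norm a + norm b) * norm a)" by (simp add: algebra_simps)
  finally show ?thesis by (simp add: \<phi>_def diff_diff_eq2 add.commute)
qed

lemma gradient_derivative_symmetric:
  fixes u :: "'a::real_inner \<Rightarrow> real" and g :: "'a \<Rightarrow> 'a"
  assumes "open S" "z0 \<in> S" and du: "\<And>z. z \<in> S \<Longrightarrow> (u has_derivative (\<lambda>v. g z \<bullet> v)) (at z)"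
    and dg: "(g has_derivative H) (at z0)"
  shows "H a \<bullet> b = H b \<bullet> a"
proof -
  have lin: "linear H" using dg by (rule has_derivative_linear)
  define c where "c = norm a + norm b + 1"
  have c: "c \<ge> 1" "norm a \<le> c" "norm b \<le> c" "norm a + norm b \<le> c" by (simp_all add: c_def)
  have "\<bar>H b \<bullet> a - H a \<bullet> b\<bar> \<le> e" if e: "e > 0" for e
  proof -
    \<comment> \<open>Each of the two comparisons, for \<open>a\<close>, \<open>b\<close> and for
      \<open>b\<close>, \<open>a\<close>, then costs at most
      \<open>2 * \<epsilon> * c * c = e / 2\<close>.\<close>
    define \<epsilon> where "\<epsilon> = e / (4 * c * c)"
    have cc: "c * c \<ge> 1" using c mult_mono[of 1 c 1 c] by simp
    have \<epsilon>: "\<epsilon> > 0" using e cc by (simp add: \<epsilon>_def mult.assoc)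
    obtain d where d: "d > 0" "\<And>y. norm (y - z0) < d \<Longrightarrow> norm (g y - g z0 - H (y - z0)) \<le> \<epsilon> * norm (y - z0)"
      using dg \<epsilon> unfolding has_derivative_at_alt by blast
    obtain r0 where r0: "r0 > 0" "ball z0 r0 \<subseteq> S" using assms(1,2) by (meson open_contains_ball)
    define r where "r = min d r0"
    have r: "r > 0" using d r0 by (simp add: r_def)
    define t where "t = r / (2 * c)"
    have t: "t > 0" using r c by (simp add: t_def)
    have "t * (norm a + norm b) \<le> t * c" using c t by (intro mult_left_mono) auto
    also have "\<dots> = r / 2" using c by (simp add: t_def)
    finally have tr: "t * (norm a + norm b) < r" "t * (norm b + norm a) < r" using r by (simp_all add: add.commute)
    have du': "(u has_derivative (\<lambda>v. g z \<bullet> v)) (at z)" if "z \<in> ball z0 r" for z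
      using that r0 by (intro du) (auto simp: r_def)
    have dg': "norm (g (z0 + w) - g z0 - H w) \<le> \<epsilon> * norm w" if "norm w < r" for w
      using d(2)[of "z0 + w"] that by (simp add: r_def)
    note ab = second_difference_bound[OF du' dg' lin t tr(1) less_imp_le[OF \<epsilon>]]
    note ba = second_difference_bound[OF du' dg' lin t tr(2) less_imp_le[OF \<epsilon>]]
    have bnd: "2 * \<epsilon> * (norm x + norm y) * norm x \<le> e / 2" if "norm x + norm y \<le> c" "norm x \<le> c" for x y :: 'a
    proof -
      have "2 * \<epsilon> * (norm x + norm y) * norm x \<le> 2 * \<epsilon> * c * c"
        using that \<epsilon> c by (intro mult_mono) auto
      also have "\<dots> = e / 2" using c by (simp add: \<epsilon>_def)
      finally show ?thesis .
    qed
    have b1: "2 * \<epsilon> * (norm a + norm b) * norm a \<le> e / 2" using c by (intro bnd) auto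
    have b2: "2 * \<epsilon> * (norm b + norm a) * norm b \<le> e / 2" using c by (intro bnd) auto
    have tt: "0 \<le> t * t" by simp
    from mult_left_mono[OF b1 tt] mult_left_mono[OF b2 tt] have "\<bar>t * t * (H b \<bullet> a) - t * t * (H a \<bullet> b)\<bar> \<le> t * t * e"
      using ab ba by (simp add: algebra_simps abs_le_iff)
    then have "t * t * \<bar>H b \<bullet> a - H a \<bullet> b\<bar> \<le> t * t * e"
      by (simp add: abs_mult flip: right_diff_distrib)
    then show ?thesis using t by simp
  qed
  then have "\<bar>H b \<bullet> a - H a \<bullet> b\<bar> \<le> 0" by (rule field_le_epsilon) simp
  then show ?thesis by simp
qed

text \<open>\<open>cnj g\<close>, that is \<open>u\<^sub>x - \<i> u\<^sub>y\<close>, is holomorphic: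
  symmetry of the second derivative and the Laplace equation are its Cauchy-Riemann equations. The
  real part of a primitive differs from \<open>u\<close> by a constant.\<close>

lemma harmonic_real_part:
  assumes op: "open S" and sc: "simply_connected S" and har: "harmonic_on u S"
  obtains f where "f holomorphic_on S" "\<And>z. z \<in> S \<Longrightarrow> Re (f z) = u z"
proof -
  obtain g H where du: "\<And>z. z \<in> S \<Longrightarrow> (u has_derivative (\<lambda>v. g z \<bullet> v)) (at z)"
    and dg: "\<And>z. z \<in> S \<Longrightarrow> (g has_derivative H z) (at z)"
    and lap: "\<And>z. z \<in> S \<Longrightarrow> Re (H z 1) + Im (H z \<i>) = 0"
    using har unfolding harmonic_on_def by blast
  have con: "connected S" using sc simply_connected_imp_connected by blast
  have "(\<lambda>z. cnj (g z)) holomorphic_on S"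
  proof (rule holomorphic_onI)
    fix z assume z: "z \<in> S"
    have "Im (H z 1) = Re (H z \<i>)"
      using gradient_derivative_symmetric[OF op z du dg[OF z], of 1 \<i>] by (simp add: inner_complex_def)
    then have Hi: "cnj (H z \<i>) = cnj (H z 1) * \<i>"
      using lap[OF z] by (simp add: complex_eq_iff)
    have lin: "linear (H z)" using dg[OF z] by (rule has_derivative_linear)
    have H: "cnj (H z v) = cnj (H z 1) * v" for v
    proof -
      have "v = Re v *\<^sub>R 1 + Im v *\<^sub>R \<i>" by (simp add: complex_eq_iff)
      then have "H z v = Re v *\<^sub>R H z 1 + Im v *\<^sub>R H z \<i>"
        by (metis linear_add[OF lin] linear_scale[OF lin])
      then have "cnj (H z v) = Re v *\<^sub>R cnj (H z 1) + Im v *\<^sub>R cnj (H z \<i>)" by simp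
      also have "\<dots> = cnj (H z 1) * (Re v *\<^sub>R 1 + Im v *\<^sub>R \<i>)" unfolding Hi by (simp add: algebra_simps)
      finally show ?thesis using \<open>v = _\<close> by simp
    qed
    have "((\<lambda>z. cnj (g z)) has_derivative (\<lambda>v. cnj (H z v))) (at z)"
      using dg[OF z] by (rule has_derivative_cnj)
    moreover have "(\<lambda>v. cnj (H z v)) = (*) (cnj (H z 1))" by (rule ext) (rule H)
    ultimately have "((\<lambda>z. cnj (g z)) has_field_derivative cnj (H z 1)) (at z)"
      by (simp only: has_field_derivative_def)
    then show "(\<lambda>z. cnj (g z)) field_differentiable at z within S"
      using field_differentiable_at_within field_differentiable_def by blast
  qed
  then obtain h where h: "\<And>z. z \<in> S \<Longrightarrow> (h has_field_derivative cnj (g z)) (at z)"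
    using sc simply_connected_eq_global_primitive[OF op] by metis
  have dh: "((\<lambda>z. Re (h z) - u z) has_derivative (\<lambda>v. 0)) (at z)" if z: "z \<in> S" for z
  proof -
    have "(h has_derivative (\<lambda>v. cnj (g z) * v)) (at z)" using h[OF z] by (simp add: has_field_derivative_def)
    then have "((\<lambda>z. Re (h z)) has_derivative (\<lambda>v. Re (cnj (g z) * v))) (at z)" by (rule has_derivative_Re)
    from has_derivative_diff[OF this du[OF z]]
    show ?thesis by (simp add: inner_complex_def)
  qed
  obtain k where k: "\<And>z. z \<in> S \<Longrightarrow> Re (h z) - u z = k"
    using has_derivative_zero_unique_connected[OF op con dh] by metis
  show ?thesis
  proof (rule that[of "\<lambda>z. h z - of_real k"])
    show "(\<lambda>z. h z - of_real k) holomorphic_on S"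
      using h op by (intro holomorphic_intros) (auto simp: holomorphic_on_open)
    show "Re (h z - of_real k) = u z" if "z \<in> S" for z using k[OF that] by simp
  qed
qed

text \<open>In the plane two vectors orthogonal to \<open>m\<close> are parallel. For the gradient
  and the tangent at a Neumann point this says that the tangential derivative of
  \<open>Im f\<close>, computed from \<open>f' = cnj g\<close>, is zero.\<close>

lemma orthogonal_same_line:
  fixes a b m :: complex
  assumes "a \<bullet> m = 0" "b \<bullet> m = 0" "m \<noteq> 0"
  shows "Im (cnj a * b) = 0"
proof -
  have "Im (cnj a * b) * Re m = Im b * (a \<bullet> m) - Im a * (b \<bullet> m)"
    "Im (cnj a * b) * Im m = Re a * (b \<bullet> m) - Re b * (a \<bullet> m)"
    by (simp_all add: inner_complex_def algebra_simps)
  then show ?thesis using assms by (auto simp: complex_eq_iff)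
qed

section \<open>Regularity of a conjugate up to the boundary\<close>

context jordan_curve
begin

lemma exterior_normal_exists:
  assumes reg: "regular_off S \<gamma>" and t: "t \<in> {0<..<1} - S"
  obtains m where "exterior_normal \<Omega> (\<gamma> t) m" "m \<bullet> vector_derivative \<gamma> (at t) = 0"
proof -
  obtain m \<delta> s0 where m: "norm m = 1" "m \<bullet> vector_derivative \<gamma> (at t) = 0" "0 < \<delta>" "0 < s0"
    "\<And>x s. \<lbrakk>x \<in> {t-\<delta>..t+\<delta>}; 0 < s; s \<le> s0\<rbrakk> \<Longrightarrow> \<gamma> x - of_real s * m \<in> \<Omega> \<and> \<gamma> x + of_real s * m \<in> outside J"
    using flow_box[OF reg t zero_less_one] by metis
  have "\<forall>\<^sub>F s in at_right 0. \<gamma> t - of_real s * m \<in> \<Omega> \<and> \<gamma> t + of_real s * m \<notin> closure \<Omega>"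
    unfolding eventually_at_right_field
  proof (intro exI[of _ s0] conjI allI impI)
    fix s assume "0 < s" "s < s0"
    then show "\<gamma> t - of_real s * m \<in> \<Omega>" "\<gamma> t + of_real s * m \<notin> closure \<Omega>"
      using m(5)[of t s] m(3) outside_notin_closure by auto
  qed (use m in auto)
  then have "exterior_normal \<Omega> (\<gamma> t) m"
    unfolding exterior_normal_def using m simple closed_path reg t domain_facts(5) by auto
  then show ?thesis using that m by blast
qed

text \<open>By \<open>simple_closed_subcurve\<close> a single curve of the family already
  parametrises \<open>J\<close>; it has a normal at every regular parameter other than the base
  point.\<close>

lemma finitely_many_without_normal:
  assumes "regular_domain \<Omega>"
  shows "finite {p \<in> frontier \<Omega>. \<nexists>n. exterior_normal \<Omega> p n}"
proof -
  obtain \<Gamma> where \<Gamma>: "\<forall>\<delta>\<in>\<Gamma>. regular_jordan_curve \<delta>" "J = (\<Union>\<delta>\<in>\<Gamma>. path_image \<delta>)"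
    using assms domain_facts(5) unfolding regular_domain_def by auto
  then obtain \<delta> where \<delta>: "\<delta> \<in> \<Gamma>" using domain_facts(11) by blast
  then obtain S where S: "regular_off S \<delta>" and jc: "jordan_curve \<delta>"
    using \<Gamma> by (auto simp: regular_jordan_curve_def jordan_curve_def)
  interpret d: jordan_curve \<delta> by (rule jc)
  have eq: "path_image \<delta> = J" using \<delta> \<Gamma> by (intro simple_closed_subcurve[OF jc]) auto
  have "{p \<in> frontier \<Omega>. \<nexists>n. exterior_normal \<Omega> p n} \<subseteq> \<delta> ` (S \<union> {0, 1})"
  proof
    fix p assume p: "p \<in> {p \<in> frontier \<Omega>. \<nexists>n. exterior_normal \<Omega> p n}"
    then have "p \<in> path_image \<delta>" using domain_facts(5) eq by simp
    then obtain t where t: "t \<in> {0..1}" "p = \<delta> t" by (auto simp: path_image_def)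
    have "t \<in> S \<union> {0, 1}"
    proof (rule ccontr)
      assume "t \<notin> S \<union> {0, 1}"
      then have "t \<in> {0<..<1} - S" using t by auto
      then obtain m where "exterior_normal d.\<Omega> (\<delta> t) m" using d.exterior_normal_exists[OF S] by blast
      then show False using p t by (simp add: eq)
    qed
    then show "p \<in> \<delta> ` (S \<union> {0, 1})" using t by blast
  qed
  moreover have "finite (\<delta> ` (S \<union> {0, 1}))" using S by (auto simp: regular_off_def)
  ultimately show ?thesis by (rule finite_subset)
qed

text \<open>In a flow box \<open>f' = cnj g\<close> is bounded, so \<open>f\<close> is Lipschitz
  near \<open>p\<close> and has boundary limits. Under the Neumann condition the tangential
  derivative of \<open>Im f\<close> tends to zero uniformly, so these limits have constant imaginary
  part; this half is conditional because near Dirichlet points only the limits are wanted. The box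
  is built on the curve \<open>\<delta>\<close> that comes with the normal, possibly a
  parametrisation other than \<open>\<gamma>\<close>.\<close>

lemma boundary_regularity:
  assumes hol: "f holomorphic_on \<Omega>" and fu: "\<And>z. z \<in> \<Omega> \<Longrightarrow> Re (f z) = u z"
    and E: "finite E" "E \<subseteq> J"
    and du: "\<And>z. z \<in> closure \<Omega> - E \<Longrightarrow> (u has_derivative (\<lambda>v. g z \<bullet> v)) (at z within closure \<Omega>)"
    and contg: "continuous_on (closure \<Omega> - E) g"
    and p: "p \<in> J - E" and n: "exterior_normal \<Omega> p n" and \<epsilon>: "0 < \<epsilon>"
  shows "\<exists>\<eta>>0. (\<forall>q \<in> J \<inter> ball p \<eta>. \<exists>l. (f \<longlongrightarrow> l) (at q within \<Omega>)) \<and>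
     ((\<forall>q n. q \<in> J \<inter> ball p \<epsilon> - E \<longrightarrow> exterior_normal \<Omega> q n \<longrightarrow> g q \<bullet> n = 0) \<longrightarrow>
       (\<exists>y. \<forall>q \<in> J \<inter> ball p \<eta>. ((\<lambda>z. Im (f z)) \<longlongrightarrow> y) (at q within \<Omega>)))"
proof -
  obtain \<delta> S t0 where \<delta>: "simple_path \<delta>" "pathfinish \<delta> = pathstart \<delta>" "regular_off S \<delta>"
    "path_image \<delta> \<subseteq> frontier \<Omega>" "t0 \<in> {0<..<1} - S" "\<delta> t0 = p"
    using n unfolding exterior_normal_def by blast
  have jc: "jordan_curve \<delta>" using \<delta> by (simp add: jordan_curve_def)
  interpret d: jordan_curve \<delta> by (rule jc)
  have eq: "path_image \<delta> = J" using \<delta> domain_facts(5) by (intro simple_closed_subcurve[OF jc]) auto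
  have "open (- E)" using E by (simp add: finite_imp_closed open_Compl)
  then obtain \<epsilon>1 where \<epsilon>1: "\<epsilon>1 > 0" "ball p \<epsilon>1 \<subseteq> - E" using p by (meson ComplI DiffD2 open_contains_ball)
  \<comment> \<open>Keeps the boundary piece away from \<open>E\<close>, where \<open>g\<close> is
    uncontrolled, and inside the ball on which the Neumann condition may be assumed.\<close>
  define \<epsilon>2 where "\<epsilon>2 = min \<epsilon> \<epsilon>1"
  have \<epsilon>2: "\<epsilon>2 > 0" using \<epsilon> \<epsilon>1 by (simp add: \<epsilon>2_def)
  have "t0 \<in> {0..1}" using \<delta>(5) by auto
  then obtain \<delta>0 where \<delta>0: "\<delta>0 > 0" "\<And>t. t \<in> {0..1} \<Longrightarrow> dist t t0 < \<delta>0 \<Longrightarrow> dist (\<delta> t) (\<delta> t0) < \<epsilon>2"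
    using d.cont \<epsilon>2 unfolding continuous_on_iff by blast
  have \<delta>02: "0 < \<delta>0 / 2" using \<delta>0 by simp
  obtain m \<delta>1 s0 \<rho> L where m: "norm m = 1" and "m \<bullet> vector_derivative \<delta> (at t0) = 0"
    and \<delta>1: "0 < \<delta>1" "\<delta>1 \<le> \<delta>0 / 2"
    and I01: "{t0-\<delta>1..t0+\<delta>1} \<subseteq> {0<..<1} - S" and s0: "0 < s0" and \<rho>: "0 < \<rho>"
    and sides0: "\<And>t s. \<lbrakk>t \<in> {t0-\<delta>1..t0+\<delta>1}; 0 < s; s \<le> s0\<rbrakk> \<Longrightarrow>
        \<delta> t - of_real s * m \<in> d.\<Omega> \<and> \<delta> t + of_real s * m \<in> outside d.J"
    and cover0: "\<And>z. z \<in> ball (\<delta> t0) \<rho> \<Longrightarrow> \<exists>t\<in>{t0-\<delta>1..t0+\<delta>1}. \<exists>s. \<bar>s\<bar> \<le> s0 \<and> z = \<delta> t - of_real s * m"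
    and Lip0: "\<And>t t1 s s1. \<lbrakk>t \<in> {t0-\<delta>1..t0+\<delta>1}; t1 \<in> {t0-\<delta>1..t0+\<delta>1}\<rbrakk> \<Longrightarrow>
        \<bar>t - t1\<bar> + \<bar>s - s1\<bar> \<le> L * norm ((\<delta> t - of_real s * m) - (\<delta> t1 - of_real s1 * m))"
    by (rule d.flow_box[OF \<delta>(3,5) \<delta>02]) (rule that; assumption)
  define I where "I = {t0-\<delta>1..t0+\<delta>1}"
  define \<Phi> where "\<Phi> = (\<lambda>t s. \<delta> t - of_real s * m)"
  have t0I: "t0 \<in> I" using \<delta>1 by (simp add: I_def)
  have I1: "t \<in> {0..1}" "t \<in> {0<..<1} - S" "t \<in> {0..1} - S" if "t \<in> I" for t
    using subsetD[OF I01, of t] that by (auto simp: I_def)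
  have In: "\<Phi> t s \<in> \<Omega>" and Out: "\<delta> t + of_real s * m \<in> outside J" if "t \<in> I" "0 < s" "s \<le> s0" for t s
    using sides0[of t s] that by (auto simp: I_def \<Phi>_def eq)
  have \<delta>q: "\<delta> t \<in> J \<inter> ball p \<epsilon>2" if "t \<in> I" for t
  proof -
    have "dist t t0 < \<delta>0" using that \<delta>1 \<delta>0(1) by (auto simp: I_def dist_real_def)
    then have "dist (\<delta> t) (\<delta> t0) < \<epsilon>2" using \<delta>0(2) I1(1)[OF that] by blast
    moreover have "\<delta> t \<in> J" using I1(1)[OF that] eq by (auto simp: path_image_def)
    ultimately show ?thesis using \<delta>(6) by (simp add: dist_commute)
  qed
  have \<delta>E: "\<delta> t \<in> J - E" if "t \<in> I" for t using \<delta>q[OF that] \<epsilon>1(2) by (auto simp: \<epsilon>2_def)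
  have \<Phi>0: "\<Phi> t 0 = \<delta> t" for t by (simp add: \<Phi>_def)
  have \<Phi>c: "\<Phi> t s \<in> closure \<Omega> - E" if "t \<in> I" "0 \<le> s" "s \<le> s0" for t s
  proof (cases "s = 0")
    case True
    then show ?thesis using \<delta>E[OF that(1)] domain_facts(7) by (simp add: \<Phi>0)
  next
    case False
    then have "\<Phi> t s \<in> \<Omega>" using In that by simp
    then show ?thesis using E(2) domain_facts(7) notin by blast
  qed
  define K where "K = I \<times> {0..s0}"
  have coK: "compact K" by (simp add: K_def I_def compact_Times)
  have cont\<delta>: "continuous_on K (\<lambda>x. \<delta> (fst x))"
    by (rule continuous_on_compose2[OF d.cont]) (use I1 in \<open>auto simp: K_def intro!: continuous_intros\<close>)
  have cont\<Phi>: "continuous_on K (\<lambda>x. \<Phi> (fst x) (snd x))"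
    unfolding \<Phi>_def by (intro continuous_intros cont\<delta>)
  have contG: "continuous_on K (\<lambda>x. g (\<Phi> (fst x) (snd x)))"
    by (rule continuous_on_compose2[OF contg cont\<Phi>]) (use \<Phi>c in \<open>auto simp: K_def\<close>)
  \<comment> \<open>The collar including \<open>s = 0\<close> is compact, and \<open>g\<close> is
    continuous on it: here continuity of the gradient up to the boundary is used.\<close>
  obtain M where M: "\<And>t s. \<lbrakk>t \<in> I; 0 \<le> s; s \<le> s0\<rbrakk> \<Longrightarrow> norm (g (\<Phi> t s)) \<le> M"
  proof -
    have "bounded ((\<lambda>x. g (\<Phi> (fst x) (snd x))) ` K)"
      by (intro compact_imp_bounded compact_continuous_image contG coK)
    then obtain M where "\<And>x. x \<in> K \<Longrightarrow> norm (g (\<Phi> (fst x) (snd x))) \<le> M" by (auto simp: bounded_iff)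
    then show ?thesis using that[of M] by (force simp: K_def)
  qed
  define D where "D = (\<lambda>t. vector_derivative \<delta> (at t))"
  have hasD: "(\<delta> has_vector_derivative D t) (at t)" if "t \<in> I" for t
    using \<delta>(3) I1(3)[OF that]
    by (auto simp: regular_off_def C1_differentiable_on_eq D_def vector_derivative_works[symmetric])
  have contD: "continuous_on I D"
    using \<delta>(3) I1(3) unfolding regular_off_def C1_differentiable_on_eq D_def by (auto intro: continuous_on_subset)
  obtain M2 where M2: "\<And>t. t \<in> I \<Longrightarrow> norm (D t) \<le> M2"
  proof -
    have "bounded (D ` I)" using contD by (intro compact_imp_bounded compact_continuous_image) (auto simp: I_def)
    then show ?thesis using that by (auto simp: bounded_iff)
  qed
  have s0': "0 \<le> s0" using s0 by simp
  have Mnn: "0 \<le> M" using order_trans[OF norm_ge_zero M[OF t0I order_refl s0']] .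
  have M2nn: "0 \<le> M2" using order_trans[OF norm_ge_zero M2[OF t0I]] .
  have fd: "(f has_field_derivative cnj (g z)) (at z)" if z: "z \<in> \<Omega>" for z
  proof -
    have fd: "(f has_field_derivative deriv f z) (at z)" using holomorphic_derivI[OF hol domain_facts(1) z] .
    then have "(f has_derivative (\<lambda>v. deriv f z * v)) (at z)" by (simp add: has_field_derivative_def)
    then have 1: "((\<lambda>z. Re (f z)) has_derivative (\<lambda>v. Re (deriv f z * v))) (at z)" by (rule has_derivative_Re)
    have "z \<in> closure \<Omega> - E" using z E(2) domain_facts(7) notin by blast
    then have "(u has_derivative (\<lambda>v. g z \<bullet> v)) (at z within \<Omega>)"
      by (intro has_derivative_subset[OF du] closure_subset)
    then have 2: "(u has_derivative (\<lambda>v. g z \<bullet> v)) (at z)" unfolding at_within_open[OF z domain_facts(1)] .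
    have "(u has_derivative (\<lambda>v. Re (deriv f z * v))) (at z)"
      by (rule has_derivative_transform_within_open[OF 1 domain_facts(1) z]) (simp add: fu)
    then have e: "(\<lambda>v. Re (deriv f z * v)) = (\<lambda>v. g z \<bullet> v)" using 2 has_derivative_unique by blast
    have "Re (deriv f z) = Re (g z)" using fun_cong[OF e, of 1] by (simp add: inner_complex_def)
    moreover have "Im (deriv f z) = - Im (g z)" using fun_cong[OF e, of \<i>] by (simp add: inner_complex_def)
    ultimately have "deriv f z = cnj (g z)" by (simp add: complex_eq_iff)
    then show ?thesis using fd by simp
  qed
  have step_s: "norm (f (\<Phi> t s) - f (\<Phi> t s1)) \<le> M * \<bar>s - s1\<bar>"
    if t: "t \<in> I" and s: "0 < s" "s \<le> s0" "0 < s1" "s1 \<le> s0" for t s s1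
  proof -
    have "norm ((f \<circ> \<Phi> t) s - (f \<circ> \<Phi> t) s1) \<le> M * norm (s - s1)"
    proof (rule differentiable_bound[of "{0<..s0}" _ "\<lambda>s h. h *\<^sub>R (- m * cnj (g (\<Phi> t s)))"])
      fix x assume x: "x \<in> {0<..s0}"
      have "(\<Phi> t has_vector_derivative - m) (at x)"
        unfolding \<Phi>_def has_vector_derivative_def
        by (auto intro!: derivative_eq_intros simp: scaleR_conv_of_real)
      from field_vector_diff_chain_at[OF this fd[OF In[OF t]]] x
      show "((f \<circ> \<Phi> t) has_derivative (\<lambda>h. h *\<^sub>R (- m * cnj (g (\<Phi> t x))))) (at x within {0<..s0})"
        by (auto simp: has_vector_derivative_def intro: has_derivative_at_withinI)
      show "onorm (\<lambda>h. h *\<^sub>R (- m * cnj (g (\<Phi> t x)))) \<le> M"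
      proof (rule onorm_le)
        fix h :: real
        have "norm (g (\<Phi> t x)) \<le> M" using M[OF t, of x] x by auto
        then show "norm (h *\<^sub>R (- m * cnj (g (\<Phi> t x)))) \<le> M * norm h"
          using m mult_right_mono[of "norm (g (\<Phi> t x))" M "norm h"] by (simp add: norm_mult mult.commute)
      qed
    qed (use s in auto)
    then show ?thesis by simp
  qed
  have dt: "((\<lambda>t. f (\<Phi> t s)) has_vector_derivative D t * cnj (g (\<Phi> t s))) (at t)"
    if t: "t \<in> I" and s: "0 < s" "s \<le> s0" for t s
  proof -
    have "((\<lambda>t. \<Phi> t s) has_vector_derivative D t - 0) (at t)"
      unfolding \<Phi>_def by (intro has_vector_derivative_diff hasD t has_vector_derivative_const)
    then have "((\<lambda>t. \<Phi> t s) has_vector_derivative D t) (at t)" by simp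
    from field_vector_diff_chain_at[OF this fd[OF In[OF t s]]] show ?thesis by (simp add: o_def)
  qed
  have step_t: "norm (f (\<Phi> t s) - f (\<Phi> t1 s)) \<le> (M2 * M) * \<bar>t - t1\<bar>"
    if t: "t \<in> I" "t1 \<in> I" and s: "0 < s" "s \<le> s0" for t t1 s
  proof -
    have "norm (f (\<Phi> t s) - f (\<Phi> t1 s)) \<le> (M2 * M) * norm (t - t1)"
    proof (rule differentiable_bound[of I "\<lambda>t. f (\<Phi> t s)" "\<lambda>t h. h *\<^sub>R (D t * cnj (g (\<Phi> t s)))"])
      show "convex I" by (simp add: I_def)
      fix x assume x: "x \<in> I"
      show "((\<lambda>t. f (\<Phi> t s)) has_derivative (\<lambda>h. h *\<^sub>R (D x * cnj (g (\<Phi> x s))))) (at x within I)"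
        using dt[OF x s] by (auto simp: has_vector_derivative_def intro: has_derivative_at_withinI)
      show "onorm (\<lambda>h. h *\<^sub>R (D x * cnj (g (\<Phi> x s)))) \<le> M2 * M"
      proof (rule onorm_le)
        fix h :: real
        have "norm (D x) * norm (g (\<Phi> x s)) \<le> M2 * M" using M[OF x, of s] M2[OF x] s M2nn by (intro mult_mono) auto
        then show "norm (h *\<^sub>R (D x * cnj (g (\<Phi> x s)))) \<le> M2 * M * norm h"
          using mult_right_mono[of "norm (D x) * norm (g (\<Phi> x s))" "M2 * M" "norm h"] by (simp add: norm_mult mult.commute)
      qed
    qed (use t in auto)
    then show ?thesis by simp
  qed
  have coverJ: "\<exists>t\<in>I. q = \<delta> t" if q: "q \<in> J \<inter> ball p \<rho>" for q
  proof -
    obtain t s where ts: "t \<in> I" "\<bar>s\<bar> \<le> s0" "q = \<Phi> t s" using cover0[of q] q by (auto simp: I_def \<Phi>_def \<delta>(6))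
    have "\<not> 0 < s" using In[of t s] ts q notin by auto
    moreover have "\<not> s < 0" using Out[of t "- s"] ts q outside_notin_closure[of q] domain_facts(7) by (auto simp: \<Phi>_def)
    ultimately show ?thesis using ts \<Phi>0 by (metis linorder_neqE_linordered_idom)
  qed
  have cover\<Omega>: "\<exists>t\<in>I. \<exists>s. 0 < s \<and> s \<le> s0 \<and> z = \<Phi> t s" if z: "z \<in> \<Omega> \<inter> ball p \<rho>" for z
  proof -
    obtain t s where ts: "t \<in> I" "\<bar>s\<bar> \<le> s0" "z = \<Phi> t s" using cover0[of z] z by (auto simp: I_def \<Phi>_def \<delta>(6))
    have "s \<noteq> 0"
    proof
      assume "s = 0"
      then have "z \<in> J" using ts \<delta>E[OF ts(1)] by (simp add: \<Phi>0)
      then show False using z notin by blast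
    qed
    moreover have "\<not> s < 0"
      using Out[of t "- s"] ts z outside_notin_closure[of z] domain_facts(7) by (auto simp: \<Phi>_def)
    ultimately show ?thesis using ts by (intro bexI[of _ t] exI[of _ s]) auto
  qed
  define V where "V = \<Omega> \<inter> ball p \<rho>"
  \<comment> \<open>From \<open>z\<close> to \<open>z1\<close> along coordinate lines inside
    \<Omega>: first \<open>s\<close> changes at fixed \<open>t\<close>, then \<open>t\<close> at
    fixed \<open>s1\<close>. The straight segment could leave \<Omega>.\<close>
  have lipV: "norm (f z - f z1) \<le> (M + M2 * M) * \<bar>L\<bar> * norm (z - z1)" if "z \<in> V" "z1 \<in> V" for z z1
  proof -
    obtain t s where ts: "t \<in> I" "0 < s" "s \<le> s0" "z = \<Phi> t s" using cover\<Omega> \<open>z \<in> V\<close> unfolding V_def by blast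
    obtain t1 s1 where ts1: "t1 \<in> I" "0 < s1" "s1 \<le> s0" "z1 = \<Phi> t1 s1" using cover\<Omega> \<open>z1 \<in> V\<close> unfolding V_def by blast
    have l: "\<bar>t - t1\<bar> + \<bar>s - s1\<bar> \<le> \<bar>L\<bar> * norm (z - z1)"
      using Lip0[of t t1 s s1] ts ts1 mult_right_mono[OF abs_ge_self norm_ge_zero, of L "z - z1"] by (auto simp: \<Phi>_def I_def)
    have "norm (f z - f z1) \<le> norm (f (\<Phi> t s) - f (\<Phi> t s1)) + norm (f (\<Phi> t s1) - f (\<Phi> t1 s1))"
      unfolding ts(4) ts1(4) using norm_triangle_ineq[of "f (\<Phi> t s) - f (\<Phi> t s1)" "f (\<Phi> t s1) - f (\<Phi> t1 s1)"] by simp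
    also have "\<dots> \<le> M * \<bar>s - s1\<bar> + M2 * M * \<bar>t - t1\<bar>"
      using ts ts1 by (intro add_mono step_s step_t) auto
    also have "\<dots> \<le> (M + M2 * M) * (\<bar>t - t1\<bar> + \<bar>s - s1\<bar>)" using Mnn M2nn by (simp add: algebra_simps)
    also have "\<dots> \<le> (M + M2 * M) * (\<bar>L\<bar> * norm (z - z1))" using l Mnn M2nn by (intro mult_left_mono) auto
    finally show ?thesis by (simp add: mult.assoc)
  qed
  have ucont: "uniformly_continuous_on V f"
  proof (rule lipschitz_on_uniformly_continuous)
    show "((M + M2 * M) * \<bar>L\<bar>)-lipschitz_on V f"
      using lipV Mnn M2nn by (intro lipschitz_onI) (auto simp: dist_norm)
  qed
  have lims: "\<exists>l. (f \<longlongrightarrow> l) (at q within \<Omega>)" if q: "q \<in> J \<inter> ball p \<rho>" for q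
  proof -
    have "q \<in> ball p \<rho> \<inter> closure \<Omega>" using q domain_facts(7) by auto
    then have "q \<in> closure V" unfolding V_def
      using open_Int_closure_subset[of "ball p \<rho>" \<Omega>] by (auto simp: Int_commute)
    then obtain l where "(f \<longlongrightarrow> l) (at q within V)"
      using uniformly_continuous_on_extension_at_closure[OF ucont] by metis
    moreover have "at q within V = at q within \<Omega>"
      by (rule at_within_nhd[of q "ball p \<rho>"]) (use q in \<open>auto simp: V_def\<close>)
    ultimately show ?thesis by auto
  qed
  have "\<exists>y. \<forall>q \<in> J \<inter> ball p \<rho>. ((\<lambda>z. Im (f z)) \<longlongrightarrow> y) (at q within \<Omega>)"
    if neu: "\<forall>q n. q \<in> J \<inter> ball p \<epsilon> - E \<longrightarrow> exterior_normal \<Omega> q n \<longrightarrow> g q \<bullet> n = 0"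
  proof -
    \<comment> \<open>The tangential derivative of \<open>Im f\<close> along the curve shifted by
      \<open>s\<close>; \<open>h0\<close> is the Neumann condition, and uniform continuity carries
      it over to small \<open>s\<close>.\<close>
    define h where "h = (\<lambda>x. Im (D (fst x) * cnj (g (\<Phi> (fst x) (snd x)))))"
    have "continuous_on K (\<lambda>x. D (fst x))"
      by (rule continuous_on_compose2[OF contD]) (auto simp: K_def intro!: continuous_intros)
    then have "continuous_on K h" unfolding h_def using contG by (intro continuous_intros)
    then have uch: "uniformly_continuous_on K h" using coK by (rule compact_uniformly_continuous)
    have h0: "h (t, 0) = 0" if t: "t \<in> I" for t
    proof -
      obtain mt where mt: "exterior_normal d.\<Omega> (\<delta> t) mt" "mt \<bullet> D t = 0"
        using d.exterior_normal_exists[OF \<delta>(3) I1(2)[OF t]] unfolding D_def by metis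
      have ne: "exterior_normal \<Omega> (\<delta> t) mt" using mt(1) by (simp add: eq)
      then have "norm mt = 1" by (simp add: exterior_normal_def)
      then have mt0: "mt \<noteq> 0" by auto
      have "\<delta> t \<in> J \<inter> ball p \<epsilon> - E" using \<delta>q[OF t] \<delta>E[OF t] by (auto simp: \<epsilon>2_def)
      then have "g (\<delta> t) \<bullet> mt = 0" using neu ne by blast
      then have "Im (cnj (g (\<delta> t)) * D t) = 0" using mt(2) mt0 by (intro orthogonal_same_line) (auto simp: inner_commute)
      then show ?thesis by (simp add: h_def \<Phi>0 algebra_simps)
    qed
    have diff: "\<forall>\<^sub>F s in at_right 0. dist (Im (f (\<Phi> t s)) - Im (f (\<Phi> t0 s))) 0 < e"
      if t: "t \<in> I" and e: "0 < e" for t e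
    proof -
      obtain d where d: "d > 0" "\<And>x y. \<lbrakk>x \<in> K; y \<in> K; dist x y < d\<rbrakk> \<Longrightarrow> dist (h x) (h y) < e / 2"
        using uch e unfolding uniformly_continuous_on_def by (metis half_gt_zero)
      show ?thesis unfolding eventually_at_right_field
      proof (intro exI[of _ "min d s0"] conjI allI impI)
        show "0 < min d s0" using d s0 by simp
        fix s assume s: "0 < s" "s < min d s0"
        have hs: "\<bar>h (x, s)\<bar> < e / 2" if "x \<in> I" for x
          using d(2)[of "(x, s)" "(x, 0)"] h0[OF that] s that by (auto simp: K_def dist_Pair_Pair dist_real_def)
        have "norm (Im (f (\<Phi> t s)) - Im (f (\<Phi> t0 s))) \<le> e / 2 * norm (t - t0)"
        proof (rule differentiable_bound[of I "\<lambda>t. Im (f (\<Phi> t s))" "\<lambda>t v. v * h (t, s)"])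
          show "convex I" by (simp add: I_def)
          fix x assume x: "x \<in> I"
          have "((\<lambda>t. f (\<Phi> t s)) has_derivative (\<lambda>v. v *\<^sub>R (D x * cnj (g (\<Phi> x s))))) (at x)"
            using dt[OF x, of s] s by (simp add: has_vector_derivative_def)
          then have "((\<lambda>t. Im (f (\<Phi> t s))) has_derivative (\<lambda>v. Im (v *\<^sub>R (D x * cnj (g (\<Phi> x s)))))) (at x)"
            by (rule has_derivative_Im)
          then have "((\<lambda>t. Im (f (\<Phi> t s))) has_derivative (\<lambda>v. v * h (x, s))) (at x)"
            by (simp only: h_def scaleR_complex.sel fst_conv snd_conv)
          then show "((\<lambda>t. Im (f (\<Phi> t s))) has_derivative (\<lambda>v. v * h (x, s))) (at x within I)"
            by (rule has_derivative_at_withinI)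
          show "onorm (\<lambda>v. v * h (x, s)) \<le> e / 2"
          proof (rule onorm_le)
            fix v :: real
            show "norm (v * h (x, s)) \<le> e / 2 * norm v"
              using mult_right_mono[of "\<bar>h (x, s)\<bar>" "e / 2" "\<bar>v\<bar>"] hs[OF x] by (simp add: abs_mult mult.commute)
          qed
        qed (use t t0I in auto)
        also have "\<dots> \<le> e / 2 * 1"
          using I1(1)[OF t] I1(1)[OF t0I] e by (intro mult_left_mono) (auto simp: abs_le_iff)
        finally show "dist (Im (f (\<Phi> t s)) - Im (f (\<Phi> t0 s))) 0 < e" using e by (simp add: dist_real_def)
      qed
    qed
    \<comment> \<open>Approach along \<open>m\<close> stays in \<Omega>, so it detects the limits
      found above; comparing the shifted curves then compares boundary values.\<close>
    have path: "filterlim (\<lambda>s. \<Phi> t s) (at (\<delta> t) within \<Omega>) (at_right 0)" if t: "t \<in> I" for t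
      unfolding filterlim_at
    proof
      have "((\<lambda>s. \<Phi> t s) \<longlongrightarrow> \<delta> t - of_real 0 * m) (at_right 0)" unfolding \<Phi>_def by (intro tendsto_intros)
      then show "((\<lambda>s. \<Phi> t s) \<longlongrightarrow> \<delta> t) (at_right 0)" by simp
      show "\<forall>\<^sub>F s in at_right 0. \<Phi> t s \<in> \<Omega> \<and> \<Phi> t s \<noteq> \<delta> t"
        unfolding eventually_at_right_field
      proof (intro exI[of _ s0] conjI allI impI)
        fix s assume s: "0 < s" "s < s0"
        then show "\<Phi> t s \<in> \<Omega>" using In[OF t] by simp
        then show "\<Phi> t s \<noteq> \<delta> t" using \<delta>E[OF t] notin by auto
      qed (rule s0)
    qed
    have pJ: "p \<in> J \<inter> ball p \<rho>" using p \<rho> by simp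
    obtain lp where lp: "(f \<longlongrightarrow> lp) (at p within \<Omega>)" using lims[OF pJ] by blast
    have Imt: "((\<lambda>s. Im (f (\<Phi> t s))) \<longlongrightarrow> Im l) (at_right 0)" if "t \<in> I" "(f \<longlongrightarrow> l) (at (\<delta> t) within \<Omega>)" for t l
      using filterlim_compose[OF tendsto_Im[OF that(2)] path[OF that(1)]] .
    have "((\<lambda>z. Im (f z)) \<longlongrightarrow> Im lp) (at q within \<Omega>)" if q: "q \<in> J \<inter> ball p \<rho>" for q
    proof -
      obtain t where t: "t \<in> I" "q = \<delta> t" using coverJ[OF q] by blast
      obtain l where l: "(f \<longlongrightarrow> l) (at q within \<Omega>)" using lims[OF q] by blast
      have "((\<lambda>s. Im (f (\<Phi> t s)) - Im (f (\<Phi> t0 s))) \<longlongrightarrow> Im l - Im lp) (at_right 0)"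
        using l lp t t0I \<delta>(6) by (intro tendsto_diff Imt) auto
      moreover have "((\<lambda>s. Im (f (\<Phi> t s)) - Im (f (\<Phi> t0 s))) \<longlongrightarrow> 0) (at_right 0)"
        using diff[OF t(1)] by (intro tendstoI)
      ultimately have "Im l - Im lp = 0" using tendsto_unique[OF trivial_limit_at_right_real] by blast
      then show ?thesis using tendsto_Im[OF l] by simp
    qed
    then show ?thesis by blast
  qed
  then show ?thesis using \<rho> lims by (intro exI[of _ \<rho>]) blast
qed


section \<open>Conjugates along whole boundary arcs\<close>

lemma param_inj: "inj_on \<gamma> {0<..<1}"
  using injD by (fastforce intro!: inj_onI)

lemma finite_params: "finite E \<Longrightarrow> finite {s \<in> {0<..<1}. \<gamma> s \<in> E}"
  using finite_vimage_IntI[OF _ param_inj, of E] by (auto simp: vimage_def Int_def elim: rev_finite_subset)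

lemma infinite_arc:
  assumes "0 \<le> a" "a < b" "b \<le> 1"
  shows "infinite (\<gamma> ` {a<..<b})"
proof
  assume "finite (\<gamma> ` {a<..<b})"
  moreover have "inj_on \<gamma> {a<..<b}" using assms by (intro inj_on_subset[OF param_inj]) auto
  ultimately have "finite {a<..<b}" by (rule finite_imageD)
  then show False using assms infinite_Ioo by blast
qed

lemma arc_neighbourhood:
  assumes "0 \<le> a" "a < t" "t < b" "b \<le> 1"
  obtains \<epsilon> where "0 < \<epsilon>" "J \<inter> ball (\<gamma> t) \<epsilon> \<subseteq> \<gamma> ` {a<..<b}"
proof -
  define C where "C = \<gamma> ` {0..a} \<union> \<gamma> ` {b..1}"
  have "closed C" unfolding C_def using assms by (intro closed_Un image_closed) auto
  moreover have "\<gamma> t \<in> - C"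
  proof (rule ComplI)
    assume "\<gamma> t \<in> C"
    then obtain x where "x \<in> {0..a} \<union> {b..1}" "\<gamma> t = \<gamma> x" unfolding C_def by blast
    then show False using injD[of t x] assms by auto
  qed
  ultimately obtain \<epsilon> where \<epsilon>: "0 < \<epsilon>" "ball (\<gamma> t) \<epsilon> \<subseteq> - C" by (meson open_Compl open_contains_ball)
  have "{0..1} \<subseteq> {a<..<b} \<union> {0..a} \<union> {b..1}" by auto
  then have "J - C \<subseteq> \<gamma> ` {a<..<b}" unfolding path_image_def C_def by blast
  then show ?thesis using that \<epsilon> by blast
qed

lemma param_near:
  assumes "t \<in> {0<..<1}" "0 < \<epsilon>"
  obtains \<eta> where "0 < \<eta>" "\<And>s. \<bar>s - t\<bar> < \<eta> \<Longrightarrow> s \<in> {0<..<1} \<and> \<gamma> s \<in> J \<inter> ball (\<gamma> t) \<epsilon>"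
proof -
  have "t \<in> {0..1}" using assms by auto
  then obtain d where d: "d > 0" "\<And>s. s \<in> {0..1} \<Longrightarrow> dist s t < d \<Longrightarrow> dist (\<gamma> s) (\<gamma> t) < \<epsilon>"
    using cont assms(2) unfolding continuous_on_iff by blast
  show ?thesis
  proof (rule that[of "min d (min t (1 - t))"])
    fix s assume s: "\<bar>s - t\<bar> < min d (min t (1 - t))"
    then have "s \<in> {0<..<1}" by auto
    moreover have "dist (\<gamma> s) (\<gamma> t) < \<epsilon>" using d(2)[of s] s calculation by (auto simp: dist_real_def)
    ultimately show "s \<in> {0<..<1} \<and> \<gamma> s \<in> J \<inter> ball (\<gamma> t) \<epsilon>" by (auto simp: path_image_def dist_commute)
  qed (use d assms in auto)
qed

text \<open>Off \<open>E\<close> the boundary value of \<open>Im f\<close> is locally constant by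
  \<open>boundary_regularity\<close>. At a point of \<open>E\<close> it is constant on either side,
  and \<open>no_jump\<close>, with the base point moved there, joins the two sides. Connectedness of
  the parameter interval leaves one value \<open>y\<close>.\<close>

lemma conjugate_constant_on_neumann_arc:
  assumes hol: "f holomorphic_on \<Omega>" and fu: "\<And>z. z \<in> \<Omega> \<Longrightarrow> Re (f z) = u z"
    and u: "continuous_on (closure \<Omega>) u"
    and E: "finite E" "E \<subseteq> J"
    and du: "\<And>z. z \<in> closure \<Omega> - E \<Longrightarrow> (u has_derivative (\<lambda>v. g z \<bullet> v)) (at z within closure \<Omega>)"
    and contg: "continuous_on (closure \<Omega> - E) g"
    and normal: "\<And>p. p \<in> J - E \<Longrightarrow> \<exists>n. exterior_normal \<Omega> p n"
    and ab: "0 \<le> a" "a < b" "b \<le> 1"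
    and neu: "\<And>q n. q \<in> \<gamma> ` {a..b} - E \<Longrightarrow> exterior_normal \<Omega> q n \<Longrightarrow> g q \<bullet> n = 0"
  obtains y where "\<And>t. t \<in> {a<..<b} \<Longrightarrow> (f \<longlongrightarrow> Complex (u (\<gamma> t)) y) (at (\<gamma> t) within \<Omega>)"
proof -
  define lim where "lim = (\<lambda>t y. ((\<lambda>z. Im (f z)) \<longlongrightarrow> y) (at (\<gamma> t) within \<Omega>))"
  define Y where "Y = (\<lambda>t. SOME y. lim t y)"
  have in01: "t \<in> {0<..<1}" if "t \<in> {a<..<b}" for t using that ab by auto
  have \<gamma>J: "\<gamma> t \<in> J" if "t \<in> {0<..<1}" for t using that by (auto simp: path_image_def)
  have Yeq: "Y t = y" if "lim t y" "t \<in> {0<..<1}" for t y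
  proof -
    have "lim t (Y t)" unfolding Y_def using that(1) by (rule someI)
    then show ?thesis using that(1) tendsto_unique[OF nontrivial[OF \<gamma>J[OF that(2)]]] unfolding lim_def by blast
  qed
  \<comment> \<open>The condition includes \<open>s = t\<close>, so at an exceptional point it
    asserts the existence of the limit as well.\<close>
  define P where "P = (\<lambda>t. \<exists>\<eta>>0. \<exists>y. \<forall>s. \<bar>s - t\<bar> < \<eta> \<longrightarrow> lim s y)"
  have constP: "\<exists>y. \<forall>s\<in>A. lim s y" if A: "connected A" "A \<subseteq> {0<..<1}" "\<And>t. t \<in> A \<Longrightarrow> P t" for A
  proof (cases "A = {}")
    case False
    then obtain t0 where t0: "t0 \<in> A" by blast
    have "Y s = Y t0" if "s \<in> A" for s
    proof (rule connected_local_const[OF A(1) that t0], intro ballI)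
      fix t assume t: "t \<in> A"
      then obtain \<eta> y where \<eta>: "\<eta> > 0" "\<And>s. \<bar>s - t\<bar> < \<eta> \<Longrightarrow> lim s y" using A(3) unfolding P_def by blast
      then have "Y t = y" using Yeq t A(2) by (metis abs_zero diff_self subsetD)
      moreover have "Y s = y" if "s \<in> A" "\<bar>s - t\<bar> < \<eta>" for s using Yeq \<eta>(2)[OF that(2)] that(1) A(2) by blast
      ultimately show "\<forall>\<^sub>F s in at t within A. Y t = Y s"
        using \<eta>(1) unfolding eventually_at by (intro exI[of _ \<eta>]) (auto simp: dist_real_def)
    qed
    moreover have "lim s (Y s)" if s: "s \<in> A" for s
    proof -
      obtain \<eta> y where "\<eta> > 0" "\<And>x. \<bar>x - s\<bar> < \<eta> \<Longrightarrow> lim x y" using A(3)[OF s] unfolding P_def by blast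
      then have "lim s y" by simp
      then show ?thesis using Yeq s A(2) by blast
    qed
    ultimately show ?thesis by metis
  qed auto
  have Poff: "P t" if t: "t \<in> {a<..<b}" "\<gamma> t \<notin> E" for t
  proof -
    obtain \<epsilon> where \<epsilon>: "0 < \<epsilon>" "J \<inter> ball (\<gamma> t) \<epsilon> \<subseteq> \<gamma> ` {a<..<b}" using arc_neighbourhood[of a t b] ab t by auto
    have pJE: "\<gamma> t \<in> J - E" using \<gamma>J[OF in01[OF t(1)]] t(2) by simp
    obtain n where n: "exterior_normal \<Omega> (\<gamma> t) n" using normal[OF pJE] by blast
    have neu': "\<forall>q n. q \<in> J \<inter> ball (\<gamma> t) \<epsilon> - E \<longrightarrow> exterior_normal \<Omega> q n \<longrightarrow> g q \<bullet> n = 0"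
    proof (intro allI impI)
      fix q n assume q: "q \<in> J \<inter> ball (\<gamma> t) \<epsilon> - E" "exterior_normal \<Omega> q n"
      then have "q \<in> \<gamma> ` {a<..<b}" using \<epsilon>(2) by blast
      moreover have "{a<..<b} \<subseteq> {a..b}" by auto
      ultimately have "q \<in> \<gamma> ` {a..b} - E" using q by blast
      then show "g q \<bullet> n = 0" using neu q by blast
    qed
    obtain \<eta> y where \<eta>: "\<eta> > 0" "\<forall>q \<in> J \<inter> ball (\<gamma> t) \<eta>. ((\<lambda>z. Im (f z)) \<longlongrightarrow> y) (at q within \<Omega>)"
      using boundary_regularity[OF hol fu E du contg pJE n \<epsilon>(1)] neu' by auto
    obtain \<eta>' where \<eta>': "0 < \<eta>'" "\<And>s. \<bar>s - t\<bar> < \<eta>' \<Longrightarrow> s \<in> {0<..<1} \<and> \<gamma> s \<in> J \<inter> ball (\<gamma> t) \<eta>"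
      using param_near[OF in01[OF t(1)] \<eta>(1)] by blast
    then show ?thesis unfolding P_def lim_def using \<eta>(2) by blast
  qed
  have P: "P t" if t: "t \<in> {a<..<b}" for t
  proof -
    \<comment> \<open>The other exceptional parameters; they are finitely many, so both sides of
      \<open>t\<close> are free of them for a short while.\<close>
    define F where "F = {s \<in> {0<..<1}. \<gamma> s \<in> E} - {t}"
    have "finite F" using finite_params[OF E(1)] by (simp add: F_def)
    then have "open ({a<..<b} - F)" by (simp add: finite_imp_closed open_Diff)
    moreover have "t \<in> {a<..<b} - F" using t by (simp add: F_def)
    ultimately obtain \<eta>0 where \<eta>0: "\<eta>0 > 0" "ball t \<eta>0 \<subseteq> {a<..<b} - F" by (meson open_contains_ball)
    define \<eta> where "\<eta> = min \<eta>0 (1/3)"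
    have \<eta>: "0 < \<eta>" "\<eta> < 1/2" using \<eta>0 by (auto simp: \<eta>_def)
    have near: "s \<in> {a<..<b} \<and> P s" if "\<bar>s - t\<bar> < \<eta>" "s \<noteq> t" for s
    proof -
      have "s \<in> {a<..<b} - F" using that \<eta>0(2) by (auto simp: \<eta>_def dist_real_def subset_iff)
      moreover have "\<gamma> s \<notin> E" using calculation that(2) in01 by (auto simp: F_def)
      ultimately show ?thesis using Poff by blast
    qed
    have t01: "t \<in> {0<..<1}" using in01[OF t] .
    have n1: "s \<in> {0<..<1}" "P s" if "s \<in> {t<..<t+\<eta>}" for s using near[of s] that in01 by (auto simp: abs_if)
    have n2: "s \<in> {0<..<1}" "P s" if "s \<in> {t-\<eta><..<t}" for s using near[of s] that in01 by (auto simp: abs_if)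
    have "\<exists>y. \<forall>s\<in>{t<..<t+\<eta>}. lim s y" by (rule constP) (use n1 in auto)
    then obtain y1 where y1: "\<And>s. s \<in> {t<..<t+\<eta>} \<Longrightarrow> lim s y1" by blast
    have "\<exists>y. \<forall>s\<in>{t-\<eta><..<t}. lim s y" by (rule constP) (use n2 in auto)
    then obtain y2 where y2: "\<And>s. s \<in> {t-\<eta><..<t} \<Longrightarrow> lim s y2" by blast
    have t01': "t \<in> {0..1}" using t01 by auto
    have gJ: "path_image (shiftpath t \<gamma>) = J" and g0: "shiftpath t \<gamma> 0 = \<gamma> t" using shift[OF t01'] by blast+
    interpret g: jordan_curve "shiftpath t \<gamma>" using shift[OF t01'] by blast
    have r: "((\<lambda>z. Im (f z)) \<longlongrightarrow> y1) (at (shiftpath t \<gamma> s) within \<Omega>)" if s: "0 < s" "s < \<eta>" for s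
    proof -
      have "t + s < 1" using n1(1)[of "t + s"] s by auto
      then have "shiftpath t \<gamma> s = \<gamma> (t + s)" by (simp add: shiftpath_def)
      then show ?thesis using y1[of "t + s"] s by (simp add: lim_def)
    qed
    \<comment> \<open>Parameters just before \<open>t\<close> appear at the end of the shifted
      curve, hence the reduction by 1.\<close>
    have l: "((\<lambda>z. Im (f z)) \<longlongrightarrow> y2) (at (shiftpath t \<gamma> s) within \<Omega>)" if s: "1 - \<eta> < s" "s < 1" for s
    proof -
      have "0 < t + s - 1" using n2(1)[of "t + s - 1"] s by auto
      then have "shiftpath t \<gamma> s = \<gamma> (t + s - 1)" by (simp add: shiftpath_def)
      then show ?thesis using y2[of "t + s - 1"] s by (simp add: lim_def)
    qed
    have nj: "y1 = y2" "(f \<longlongrightarrow> Complex (u (\<gamma> t)) y1) (at (\<gamma> t) within \<Omega>)"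
      using g.no_jump[of f u \<eta> y1 y2] hol u fu \<eta> r l unfolding gJ g0 by blast+
    then have "lim t y1" using tendsto_Im[OF nj(2)] by (simp add: lim_def)
    then have "lim s y1" if "\<bar>s - t\<bar> < \<eta>" for s
      using y1[of s] y2[of s] nj(1) that by (cases s t rule: linorder_cases) auto
    then show ?thesis unfolding P_def using \<eta>(1) by blast
  qed
  obtain y where y: "\<And>s. s \<in> {a<..<b} \<Longrightarrow> lim s y"
    using constP[of "{a<..<b}"] P in01 by (metis connected_Ioo subsetI)
  show ?thesis
  proof (rule that[of y])
    fix t assume t: "t \<in> {a<..<b}"
    have p: "\<gamma> t \<in> J" using \<gamma>J in01 t by blast
    then have "(u \<longlongrightarrow> u (\<gamma> t)) (at (\<gamma> t) within \<Omega>)"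
      using domain_facts(7) by (intro continuous_on_tendsto_subset[OF u _ closure_subset]) auto
    moreover have "\<forall>\<^sub>F z in at (\<gamma> t) within \<Omega>. u z = Re (f z)" using fu by (auto simp: eventually_at_filter)
    ultimately have "((\<lambda>z. Re (f z)) \<longlongrightarrow> u (\<gamma> t)) (at (\<gamma> t) within \<Omega>)" by (rule Lim_transform_eventually)
    then show "(f \<longlongrightarrow> Complex (u (\<gamma> t)) y) (at (\<gamma> t) within \<Omega>)"
      using y[OF t] by (simp add: tendsto_complex_iff lim_def)
  qed
qed

text \<open>\<open>half_plane_bound\<close> for \<open>\<i> * f\<close> and
  \<open>-\<i> * f\<close>: where \<open>u\<close> is 0 or 1, continuity of \<open>u\<close> alone
  fixes the limit of the height, so exceptional points on Dirichlet arcs cause no trouble. Two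
  distinct boundary values of \<open>u\<close> exclude a constant \<open>f\<close>.\<close>

lemma conjugate_bounded:
  assumes hol: "f holomorphic_on \<Omega>" and fu: "\<And>z. z \<in> \<Omega> \<Longrightarrow> Re (f z) = u z"
    and u: "continuous_on (closure \<Omega>) u" and pq: "p \<in> J" "q \<in> J" "u p \<noteq> u q"
    and bd: "\<And>p. p \<in> J \<Longrightarrow> u p \<in> {0, 1} \<or> (\<exists>l. (f \<longlongrightarrow> l) (at p within \<Omega>) \<and> \<bar>Im l\<bar> \<le> B)"
    and z: "z \<in> \<Omega>"
  shows "\<bar>Im (f z)\<bar> \<le> B"
proof -
  have nc: "\<not> f constant_on \<Omega>"
  proof
    assume "f constant_on \<Omega>"
    then obtain k where k: "\<And>z. z \<in> \<Omega> \<Longrightarrow> u z = k" using fu unfolding constant_on_def by metis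
    have "u p = k" "u q = k" using continuous_constant_on_closure[OF u k] pq domain_facts(7) by blast+
    then show False using pq by simp
  qed
  have ulim: "((\<lambda>z. Re (f z)) \<longlongrightarrow> u p) (at p within \<Omega>)" if p: "p \<in> J" for p
  proof -
    have "(u \<longlongrightarrow> u p) (at p within \<Omega>)"
      using domain_facts(7) p by (intro continuous_on_tendsto_subset[OF u _ closure_subset]) auto
    moreover have "\<forall>\<^sub>F z in at p within \<Omega>. u z = Re (f z)" using fu by (auto simp: eventually_at_filter)
    ultimately show ?thesis by (rule Lim_transform_eventually)
  qed
  have main: "Re (k * f z) \<le> B" if k: "k \<in> {\<i>, -\<i>}" for k
  proof (rule half_plane_bound[OF domain_facts(1-3) _ _ _ _ z])
    show "(\<lambda>z. k * f z) holomorphic_on \<Omega>" by (intro holomorphic_intros hol)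
    show "\<not> (\<lambda>z. k * f z) constant_on \<Omega>"
    proof
      assume "(\<lambda>z. k * f z) constant_on \<Omega>"
      then obtain c where c: "\<And>z. z \<in> \<Omega> \<Longrightarrow> k * f z = c" unfolding constant_on_def by blast
      have "k \<noteq> 0" using k by auto
      then have "f z = c / k" if "z \<in> \<Omega>" for z using c[OF that] by (simp add: field_simps)
      then show False using nc unfolding constant_on_def by blast
    qed
    show "finite {0, 1, - 1 :: real}" by simp
    fix p assume "p \<in> frontier \<Omega>"
    then have p: "p \<in> J" using domain_facts(5) by simp
    from bd[OF p] show "(\<exists>\<omega>. ((\<lambda>z. k * f z) \<longlongrightarrow> \<omega>) (at p within \<Omega>) \<and> Re \<omega> \<le> B) \<or>
        (\<exists>\<tau>\<in>{0, 1, - 1}. ((\<lambda>z. Im (k * f z)) \<longlongrightarrow> \<tau>) (at p within \<Omega>))"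
    proof
      assume "u p \<in> {0, 1}"
      moreover have "((\<lambda>z. Im (k * f z)) \<longlongrightarrow> Im k * u p) (at p within \<Omega>)"
        using tendsto_mult_left[OF ulim[OF p], of "Im k"] k by auto
      moreover have "Im k * u p \<in> {0, 1, - 1}" using k calculation(1) by auto
      ultimately show ?thesis by blast
    next
      assume "\<exists>l. (f \<longlongrightarrow> l) (at p within \<Omega>) \<and> \<bar>Im l\<bar> \<le> B"
      then obtain l where l: "(f \<longlongrightarrow> l) (at p within \<Omega>)" "\<bar>Im l\<bar> \<le> B" by blast
      have "Re (k * l) \<le> B" using l(2) k by auto
      then show ?thesis using tendsto_mult_left[OF l(1), of k] by blast
    qed
  qed
  show ?thesis using main[of \<i>] main[of "-\<i>"] by (simp add: abs_le_iff)
qed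

text \<open>\<open>Re (- \<i> * f1 - c * f2)\<close> is \<open>Im f1 - c * u2\<close>, with boundary
  value \<open>b1 - c\<close> on the first arc and \<open>b3\<close> on the third; they agree for
  \<open>c = b1 - b3\<close>. On the second and fourth arc the imaginary part is
  \<open>- c * d2\<close> and \<open>- 1 - c * d4\<close>. The factors \<open>k = 1\<close> and
  \<open>k = -1\<close> give the two inequalities.\<close>

lemma conjugate_is_multiple:
  assumes t: "0 < t2" "t2 < t3" "t3 < t4" "t4 < 1"
    and hol: "f1 holomorphic_on \<Omega>" "f2 holomorphic_on \<Omega>"
    and fu: "\<And>z. z \<in> \<Omega> \<Longrightarrow> Re (f1 z) = u1 z" "\<And>z. z \<in> \<Omega> \<Longrightarrow> Re (f2 z) = u2 z"
    and u: "continuous_on (closure \<Omega>) u1" "continuous_on (closure \<Omega>) u2"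
    and E: "finite E" "E \<subseteq> J" "{\<gamma> 0, \<gamma> t2, \<gamma> t3, \<gamma> t4} \<subseteq> E"
    and lim: "\<And>p. p \<in> J - E \<Longrightarrow> \<exists>l. (f1 \<longlongrightarrow> l) (at p within \<Omega>)"
      "\<And>p. p \<in> J - E \<Longrightarrow> \<exists>l. (f2 \<longlongrightarrow> l) (at p within \<Omega>)"
    and u1: "\<And>s. s \<in> {t2..t3} \<Longrightarrow> u1 (\<gamma> s) = 0" "\<And>s. s \<in> {t4..1} \<Longrightarrow> u1 (\<gamma> s) = 1"
    and u2: "\<And>s. s \<in> {t3..t4} \<Longrightarrow> u2 (\<gamma> s) = 0" "\<And>s. s \<in> {0..t2} \<Longrightarrow> u2 (\<gamma> s) = 1"
    and f1: "\<And>s. s \<in> {0<..<t2} \<Longrightarrow> (f1 \<longlongrightarrow> Complex (u1 (\<gamma> s)) b1) (at (\<gamma> s) within \<Omega>)"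
      "\<And>s. s \<in> {t3<..<t4} \<Longrightarrow> (f1 \<longlongrightarrow> Complex (u1 (\<gamma> s)) b3) (at (\<gamma> s) within \<Omega>)"
    and f2: "\<And>s. s \<in> {t2<..<t3} \<Longrightarrow> (f2 \<longlongrightarrow> Complex (u2 (\<gamma> s)) d2) (at (\<gamma> s) within \<Omega>)"
      "\<And>s. s \<in> {t4<..<1} \<Longrightarrow> (f2 \<longlongrightarrow> Complex (u2 (\<gamma> s)) d4) (at (\<gamma> s) within \<Omega>)"
    and z: "z \<in> \<Omega>"
  shows "Im (f1 z) = (b1 - b3) * u2 z + b3"
proof -
  define c where "c = b1 - b3"
  have \<gamma>J: "\<gamma> s \<in> J" if "0 \<le> s" "s \<le> 1" for s using that by (auto simp: path_image_def)
  \<comment> \<open>The corner \<open>\<gamma> 0 = \<gamma> 1\<close> is taken at parameter 1, where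
    the Dirichlet value of \<open>u1\<close> is known; \<open>cases3\<close> takes it at 0 for
    \<open>u2\<close>.\<close>
  have cases: "\<exists>s. p = \<gamma> s \<and> (s \<in> {0<..<t2} \<or> s \<in> {t2..t3} \<or> s \<in> {t3<..<t4} \<or> s \<in> {t4..1})" if p: "p \<in> J" for p
  proof -
    obtain s where s: "s \<in> {0..1}" "p = \<gamma> s" using p by (auto simp: path_image_def)
    show ?thesis
    proof (cases "s = 0")
      case True
      then show ?thesis using s endpoints t by (intro exI[of _ 1]) auto
    next
      case False
      then show ?thesis using s t by (intro exI[of _ s]) auto
    qed
  qed
  have cases2: "\<exists>s. p = \<gamma> s \<and> (s \<in> {0<..<t2} \<or> s \<in> {t2<..<t3} \<or> s \<in> {t3<..<t4} \<or> s \<in> {t4<..<1})" if p: "p \<in> J - E" for p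
  proof -
    obtain s where s: "s \<in> {0..1}" "p = \<gamma> s" using p by (auto simp: path_image_def)
    have "s \<noteq> 0" "s \<noteq> 1" "s \<noteq> t2" "s \<noteq> t3" "s \<noteq> t4" using s p E(3) endpoints by auto
    then show ?thesis using s t by (intro exI[of _ s]) auto
  qed
  have cases3: "\<exists>s. p = \<gamma> s \<and> (s \<in> {0..t2} \<or> s \<in> {t2<..<t3} \<or> s \<in> {t3..t4} \<or> s \<in> {t4<..<1})" if p: "p \<in> J" for p
  proof -
    obtain s where s: "s \<in> {0..1}" "p = \<gamma> s" using p by (auto simp: path_image_def)
    show ?thesis
    proof (cases "s = 1")
      case True
      then show ?thesis using s endpoints t by (intro exI[of _ 0]) auto
    next
      case False
      then show ?thesis using s t by (intro exI[of _ s]) auto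
    qed
  qed
  \<comment> \<open>\<open>mixed_boundary_maximum\<close> requires an upper bound for the comparison
    function; the part coming from \<open>Im f1\<close> is supplied here.\<close>
  define B1 where "B1 = \<bar>b1\<bar> + \<bar>b3\<bar>"
  have B1: "\<bar>Im (f1 z)\<bar> \<le> B1" if z: "z \<in> \<Omega>" for z
  proof (rule conjugate_bounded[OF hol(1) fu(1) u(1) _ _ _ _ z])
    show "\<gamma> t2 \<in> J" "\<gamma> t4 \<in> J" "u1 (\<gamma> t2) \<noteq> u1 (\<gamma> t4)" using \<gamma>J u1 t by auto
    fix p assume "p \<in> J"
    from cases[OF this] show "u1 p \<in> {0, 1} \<or> (\<exists>l. (f1 \<longlongrightarrow> l) (at p within \<Omega>) \<and> \<bar>Im l\<bar> \<le> B1)"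
    proof (elim exE conjE disjE)
      fix s assume s: "p = \<gamma> s" "s \<in> {0<..<t2}"
      have "\<bar>Im (Complex (u1 (\<gamma> s)) b1)\<bar> \<le> B1" by (simp add: B1_def)
      then show ?thesis using f1(1)[OF s(2)] s(1) by blast
    next
      fix s assume s: "p = \<gamma> s" "s \<in> {t3<..<t4}"
      have "\<bar>Im (Complex (u1 (\<gamma> s)) b3)\<bar> \<le> B1" by (simp add: B1_def)
      then show ?thesis using f1(2)[OF s(2)] s(1) by blast
    qed (use u1 in auto)
  qed
  define B2 where "B2 = \<bar>d2\<bar> + \<bar>d4\<bar>"
  have B2: "\<bar>Im (f2 z)\<bar> \<le> B2" if z: "z \<in> \<Omega>" for z
  proof (rule conjugate_bounded[OF hol(2) fu(2) u(2) _ _ _ _ z])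
    show "\<gamma> 0 \<in> J" "\<gamma> t3 \<in> J" "u2 (\<gamma> 0) \<noteq> u2 (\<gamma> t3)" using \<gamma>J u2 t by auto
    fix p assume "p \<in> J"
    from cases3[OF this] show "u2 p \<in> {0, 1} \<or> (\<exists>l. (f2 \<longlongrightarrow> l) (at p within \<Omega>) \<and> \<bar>Im l\<bar> \<le> B2)"
    proof (elim exE conjE disjE)
      fix s assume s: "p = \<gamma> s" "s \<in> {t2<..<t3}"
      have "\<bar>Im (Complex (u2 (\<gamma> s)) d2)\<bar> \<le> B2" by (simp add: B2_def)
      then show ?thesis using f2(1)[OF s(2)] s(1) by blast
    next
      fix s assume s: "p = \<gamma> s" "s \<in> {t4<..<1}"
      have "\<bar>Im (Complex (u2 (\<gamma> s)) d4)\<bar> \<le> B2" by (simp add: B2_def)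
      then show ?thesis using f2(2)[OF s(2)] s(1) by blast
    qed (use u2 in auto)
  qed
  have bdd: "bounded (u2 ` closure \<Omega>)" using u(2) domain_facts(10) by (intro compact_imp_bounded compact_continuous_image)
  then obtain C2 where C2: "\<And>z. z \<in> \<Omega> \<Longrightarrow> \<bar>u2 z\<bar> \<le> C2"
    using closure_subset[of \<Omega>] by (auto simp: bounded_iff)
  have Relim: "Re l = v p" if l: "(f \<longlongrightarrow> l) (at p within \<Omega>)" "p \<in> J" "continuous_on (closure \<Omega>) v"
      "\<And>z. z \<in> \<Omega> \<Longrightarrow> Re (f z) = v z" for f l p v
  proof -
    have "(v \<longlongrightarrow> v p) (at p within \<Omega>)"
      using domain_facts(7) l(2) by (intro continuous_on_tendsto_subset[OF l(3) _ closure_subset]) auto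
    moreover have "\<forall>\<^sub>F z in at p within \<Omega>. v z = Re (f z)" using l(4) by (auto simp: eventually_at_filter)
    ultimately have "((\<lambda>z. Re (f z)) \<longlongrightarrow> v p) (at p within \<Omega>)" by (rule Lim_transform_eventually)
    then show ?thesis using tendsto_Re[OF l(1)] tendsto_unique[OF nontrivial[OF l(2)]] by blast
  qed
  have E\<Omega>: "E \<inter> \<Omega> = {}" using E(2) domain_facts(6) by blast
  \<comment> \<open>Arcs are infinite and \<open>E\<close> is finite; this supplies the point
    \<open>q\<close> of \<open>mixed_boundary_maximum\<close> on the first arc.\<close>
  have free: "\<exists>s. s \<in> {a<..<b} \<and> \<gamma> s \<in> J - E" if "0 \<le> a" "a < b" "b \<le> 1" for a b
  proof -
    have "\<not> \<gamma> ` {a<..<b} \<subseteq> E" using infinite_arc[OF that] E(1) finite_subset by blast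
    then obtain s where "s \<in> {a<..<b}" "\<gamma> s \<notin> E" by blast
    then show ?thesis using \<gamma>J[of s] that by auto
  qed
  have main: "Re (k * (- \<i> * f1 z - of_real c * f2 z)) \<le> Re k * b3" if z: "z \<in> \<Omega>" and k: "k \<in> {1, -1}" for z k
  proof -
    define X where "X = (\<lambda>z. k * (- \<i> * f1 z - of_real c * f2 z))"
    have Xlim: "\<exists>\<omega>. (X \<longlongrightarrow> \<omega>) (at (\<gamma> s) within \<Omega>) \<and> Re \<omega> \<le> Re k * b3"
      if s: "s \<in> {0<..<t2} \<or> s \<in> {t3<..<t4}" "\<gamma> s \<in> J - E" for s
    proof -
      obtain l2 where l2: "(f2 \<longlongrightarrow> l2) (at (\<gamma> s) within \<Omega>)" using lim(2)[OF s(2)] by blast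
      have R: "Re l2 = u2 (\<gamma> s)" using Relim[OF l2 _ u(2) fu(2)] s(2) by blast
      obtain l1 where l1: "(f1 \<longlongrightarrow> l1) (at (\<gamma> s) within \<Omega>)" "Im l1 - c * u2 (\<gamma> s) = b3"
      proof (cases "s \<in> {0<..<t2}")
        case True
        then show ?thesis using that[OF f1(1)[OF True]] u2(2)[of s] by (simp add: c_def)
      next
        case False
        then have s': "s \<in> {t3<..<t4}" using s by blast
        then show ?thesis using that[OF f1(2)[OF s']] u2(1)[of s] by simp
      qed
      have "(X \<longlongrightarrow> k * (- \<i> * l1 - of_real c * l2)) (at (\<gamma> s) within \<Omega>)"
        unfolding X_def by (intro tendsto_intros l1 l2)
      moreover have "Re (k * (- \<i> * l1 - of_real c * l2)) = Re k * b3" using k l1(2) R by auto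
      ultimately show ?thesis by (metis order_refl)
    qed
    \<comment> \<open>Four heights, so that one finite set serves both signs of
      \<open>k\<close>.\<close>
    have Xlim2: "\<exists>\<omega>. (X \<longlongrightarrow> \<omega>) (at (\<gamma> s) within \<Omega>) \<and> Im \<omega> \<in> {- c * d2, c * d2, - 1 - c * d4, 1 + c * d4}"
      if s: "s \<in> {t2<..<t3} \<or> s \<in> {t4<..<1}" "\<gamma> s \<in> J - E" for s
    proof -
      obtain l1 where l1: "(f1 \<longlongrightarrow> l1) (at (\<gamma> s) within \<Omega>)" using lim(1)[OF s(2)] by blast
      have R: "Re l1 = u1 (\<gamma> s)" using Relim[OF l1 _ u(1) fu(1)] s(2) by blast
      obtain l2 where l2: "(f2 \<longlongrightarrow> l2) (at (\<gamma> s) within \<Omega>)" "u1 (\<gamma> s) + c * Im l2 \<in> {c * d2, 1 + c * d4}"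
      proof (cases "s \<in> {t2<..<t3}")
        case True
        then show ?thesis using that[OF f2(1)[OF True]] u1(1)[of s] by simp
      next
        case False
        then have s': "s \<in> {t4<..<1}" using s by blast
        then show ?thesis using that[OF f2(2)[OF s']] u1(2)[of s] by simp
      qed
      have "(X \<longlongrightarrow> k * (- \<i> * l1 - of_real c * l2)) (at (\<gamma> s) within \<Omega>)"
        unfolding X_def by (intro tendsto_intros l1 l2)
      moreover have "Im (k * (- \<i> * l1 - of_real c * l2)) = - Re k * (u1 (\<gamma> s) + c * Im l2)" using k R by auto
      then have "Im (k * (- \<i> * l1 - of_real c * l2)) \<in> {- c * d2, c * d2, - 1 - c * d4, 1 + c * d4}" using k l2(2) by auto
      ultimately show ?thesis by blast
    qed
    obtain sq where sq: "sq \<in> {0<..<t2}" "\<gamma> sq \<in> J - E" using free[of 0 t2] t by auto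
    obtain \<omega>q where \<omega>q: "(X \<longlongrightarrow> \<omega>q) (at (\<gamma> sq) within \<Omega>)" "Re \<omega>q \<le> Re k * b3" using Xlim sq by blast
    have "Re (X z) \<le> Re k * b3"
    proof (rule mixed_boundary_maximum[OF domain_facts(1-3) _ E(1) E\<Omega> _ _ _ _ \<omega>q z])
      show "X holomorphic_on \<Omega>" unfolding X_def by (intro holomorphic_intros hol)
      show "finite {- c * d2, c * d2, - 1 - c * d4, 1 + c * d4}" by simp
      show "Re (X z) \<le> B1 + \<bar>c\<bar> * C2" if z: "z \<in> \<Omega>" for z
      proof -
        have "Re (X z) \<le> \<bar>Im (f1 z) - c * u2 z\<bar>" using k fu(2)[OF z] by (auto simp: X_def)
        also have "\<dots> \<le> \<bar>Im (f1 z)\<bar> + \<bar>c\<bar> * \<bar>u2 z\<bar>" by (simp add: abs_mult flip: abs_mult)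
        also have "\<dots> \<le> B1 + \<bar>c\<bar> * C2" using B1[OF z] C2[OF z] by (intro add_mono mult_left_mono) auto
        finally show ?thesis .
      qed
      show "\<gamma> sq \<in> frontier \<Omega>" using sq domain_facts(5) by blast
      fix p assume "p \<in> frontier \<Omega> - E"
      then have p: "p \<in> J - E" using domain_facts(5) by blast
      from cases2[OF p] obtain s where "p = \<gamma> s"
        "s \<in> {0<..<t2} \<or> s \<in> {t2<..<t3} \<or> s \<in> {t3<..<t4} \<or> s \<in> {t4<..<1}" by blast
      then show "\<exists>\<omega>. (X \<longlongrightarrow> \<omega>) (at p within \<Omega>) \<and>
          (Re \<omega> \<le> Re k * b3 \<or> Im \<omega> \<in> {- c * d2, c * d2, - 1 - c * d4, 1 + c * d4})"
        using Xlim[of s] Xlim2[of s] p by blast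
    qed
    then show ?thesis by (simp add: X_def)
  qed
  show ?thesis
    using main[OF z, of 1] main[OF z, of "-1"] fu(2)[OF z] by (simp add: c_def)
qed

section \<open>Boundary arcs of a quadrilateral\<close>


lemma mixed_maximum_continuous:
  assumes hol: "W holomorphic_on \<Omega>" and contW: "continuous_on (closure \<Omega>) W" and Y: "finite Y"
    and bd: "\<And>p. p \<in> J \<Longrightarrow> Re (W p) \<le> m \<or> Im (W p) \<in> Y" and q: "q \<in> J" "Re (W q) \<le> m"
    and z: "z \<in> closure \<Omega>"
  shows "Re (W z) \<le> m"
proof -
  have lim: "(W \<longlongrightarrow> W p) (at p within \<Omega>)" if "p \<in> J" for p
    using domain_facts(7) that by (intro continuous_on_tendsto_subset[OF contW _ closure_subset]) auto
  have "compact ((\<lambda>z. Re (W z)) ` closure \<Omega>)"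
    by (intro compact_continuous_image continuous_intros contW domain_facts(10))
  then obtain b where b: "\<And>z. z \<in> closure \<Omega> \<Longrightarrow> Re (W z) \<le> b"
    by (metis (no_types, lifting) abs_le_D1 bounded_iff compact_imp_bounded imageI real_norm_def)
  have \<Omega>: "Re (W z) \<le> m" if "z \<in> \<Omega>" for z
  proof (rule mixed_boundary_maximum[OF domain_facts(1-3) hol finite.emptyI _ Y _ _ _ lim[OF q(1)] q(2) that])
    show "Re (W z) \<le> b" if "z \<in> \<Omega>" for z using b that closure_subset by blast
    show "q \<in> frontier \<Omega>" using q domain_facts(5) by simp
    fix p assume "p \<in> frontier \<Omega> - {}"
    then have p: "p \<in> J" using domain_facts(5) by simp
    show "\<exists>\<omega>. (W \<longlongrightarrow> \<omega>) (at p within \<Omega>) \<and> (Re \<omega> \<le> m \<or> Im \<omega> \<in> Y)" using lim[OF p] bd[OF p] by blast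
  qed simp
  show ?thesis
  proof (cases "z \<in> \<Omega>")
    case False
    then have p: "z \<in> J" using z domain_facts(7) by blast
    show ?thesis
      by (rule tendsto_upperbound[OF tendsto_Re[OF lim[OF p]] _ nontrivial[OF p]])
         (use \<Omega> in \<open>auto simp: eventually_at_filter\<close>)
  qed (rule \<Omega>)
qed

lemma positive_boundary_shift:
  assumes pos: "\<And>z. z \<in> \<Omega> \<Longrightarrow> winding_number \<gamma> z = 1" and a: "a \<in> {0..1}"
  shows "\<And>z. z \<in> inside (path_image (shiftpath a \<gamma>)) \<Longrightarrow> winding_number (shiftpath a \<gamma>) z = 1"
    "positive_boundary \<Omega> (shiftpath a \<gamma>)"
proof -
  interpret g: jordan_curve "shiftpath a \<gamma>" using shift(1)[OF a] .
  have w: "winding_number (shiftpath a \<gamma>) z = 1" if "z \<in> \<Omega>" for z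
    using winding_number_shiftpath[of \<gamma> z a] simple closed_path a pos[OF that] notin that
    by (auto simp: simple_path_imp_path)
  then show "\<And>z. z \<in> inside (path_image (shiftpath a \<gamma>)) \<Longrightarrow> winding_number (shiftpath a \<gamma>) z = 1"
    using shift(2)[OF a] by simp
  show "positive_boundary \<Omega> (shiftpath a \<gamma>)"
    unfolding positive_boundary_def using w g.simple g.closed_path shift(2)[OF a] by simp
qed

lemma shift_image:
  assumes "0 \<le> a" "a \<le> b" "b \<le> 1"
  shows "shiftpath a \<gamma> ` {0..b - a} = \<gamma> ` {a..b}"
proof -
  have "shiftpath a \<gamma> ` {0..b - a} = (\<lambda>x. \<gamma> (a + x)) ` {0..b - a}"
    using assms by (intro image_cong) (auto simp: shiftpath_def)
  also have "\<dots> = \<gamma> ` ((+) a ` {0..b - a})" by (rule image_image[symmetric])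
  also have "(+) a ` {0..b - a} = {a..b}" by (simp add: image_add_atLeastAtMost)
  finally show ?thesis .
qed

text \<open>Rotating the base point to \<open>a\<close> makes the arc an initial piece;
  \<open>boundary_arc\<close> asks for a final parameter below 1, hence
  \<open>b - a < 1\<close>.\<close>

lemma arc_subset_boundary_arc:
  assumes pos: "\<And>z. z \<in> \<Omega> \<Longrightarrow> winding_number \<gamma> z = 1" and ab: "0 \<le> a" "a \<le> b" "b \<le> 1" "b - a < 1"
  shows "\<gamma> ` {a..b} \<subseteq> boundary_arc \<Omega> (\<gamma> a) (\<gamma> b)"
proof
  fix p assume "p \<in> \<gamma> ` {a..b}"
  then obtain x where x: "x \<in> {a..b}" "p = \<gamma> x" by blast
  have a: "a \<in> {0..1}" using ab by auto
  have "shiftpath a \<gamma> 0 = \<gamma> a" "shiftpath a \<gamma> (b - a) = \<gamma> b" "shiftpath a \<gamma> (x - a) = p"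
    using ab x by (auto simp: shiftpath_def)
  then show "p \<in> boundary_arc \<Omega> (\<gamma> a) (\<gamma> b)"
    unfolding boundary_arc_def mem_Collect_eq using positive_boundary_shift(2)[OF pos a] ab x
    by (intro exI[of _ "shiftpath a \<gamma>"] exI[of _ "b - a"] exI[of _ "x - a"]) simp
qed

text \<open>A parametrisation of the complementary arc would make the overlap of opposite pairs of arcs
  infinite.\<close>

lemma first_boundary_arc:
  assumes pos: "\<And>z. z \<in> \<Omega> \<Longrightarrow> winding_number \<gamma> z = 1" and t: "0 < t2" "t2 < t3" "t3 < t4" "t4 < 1"
    and fin: "finite (boundary_arc \<Omega> (\<gamma> 0) (\<gamma> t2) \<inter>
      (boundary_arc \<Omega> (\<gamma> t2) (\<gamma> t3) \<union> boundary_arc \<Omega> (\<gamma> t4) (\<gamma> 0)))"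
  shows "boundary_arc \<Omega> (\<gamma> 0) (\<gamma> t2) = \<gamma> ` {0..t2}"
proof
  show "\<gamma> ` {0..t2} \<subseteq> boundary_arc \<Omega> (\<gamma> 0) (\<gamma> t2)" using arc_subset_boundary_arc[OF pos, of 0 t2] t by simp
  show "boundary_arc \<Omega> (\<gamma> 0) (\<gamma> t2) \<subseteq> \<gamma> ` {0..t2}"
  proof
    fix p assume "p \<in> boundary_arc \<Omega> (\<gamma> 0) (\<gamma> t2)"
    then obtain g s t where g: "positive_boundary \<Omega> g" "0 \<le> t" "t \<le> s" "s < 1" "g 0 = \<gamma> 0" "g s = \<gamma> t2" "g t = p"
      unfolding boundary_arc_def by blast
    interpret g: jordan_curve g using g(1) by (simp add: positive_boundary_def jordan_curve_def)
    have "g.\<Omega> = \<Omega>" using g(1) by (simp add: positive_boundary_def)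
    then have gJ: "g.J = J" using domain_facts(5) g.domain_facts(5) by simp
    \<comment> \<open>The piece of the other parametrisation from \<open>\<gamma> 0\<close> to
      \<open>\<gamma> t2\<close>. All of it belongs to the boundary arc; if it reached a point
      beyond \<open>t2\<close>, connectedness would make it cover part of the second or of the
      fourth arc.\<close>
    define X where "X = g ` {0..s}"
    have "continuous_on {0..s} g" using g.cont g(4) by (auto intro: continuous_on_subset)
    then have cX: "connected X" unfolding X_def by (intro connected_continuous_image) auto
    have XJ: "X \<subseteq> J" unfolding X_def gJ[symmetric] using g(4) by (auto simp: path_image_def)
    have Xarc: "X \<subseteq> boundary_arc \<Omega> (\<gamma> 0) (\<gamma> t2)"
    proof
      fix x assume "x \<in> X"
      then obtain r where r: "0 \<le> r" "r \<le> s" "x = g r" by (auto simp: X_def)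
      then show "x \<in> boundary_arc \<Omega> (\<gamma> 0) (\<gamma> t2)"
        unfolding boundary_arc_def mem_Collect_eq using g by (intro exI[of _ g] exI[of _ s] exI[of _ r]) simp
    qed
    have X0: "\<gamma> 0 \<in> X" using g unfolding X_def by (intro image_eqI[of _ _ 0]) auto
    have pX: "p \<in> X" using g unfolding X_def by (intro image_eqI[of _ _ t]) auto
    show "p \<in> \<gamma> ` {0..t2}"
    proof (rule ccontr)
      assume np: "p \<notin> \<gamma> ` {0..t2}"
      obtain \<tau> where \<tau>: "\<tau> \<in> {0..1}" "p = \<gamma> \<tau>" using pX XJ by (auto simp: path_image_def)
      have "t2 < \<tau>" using np \<tau> by (meson atLeastAtMost_iff image_eqI linorder_not_less)
      have sub1: "\<gamma> ` {t2..t3} \<subseteq> boundary_arc \<Omega> (\<gamma> t2) (\<gamma> t3)" using t by (intro arc_subset_boundary_arc[OF pos]) auto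
      have sub2: "\<gamma> ` {t4..1} \<subseteq> boundary_arc \<Omega> (\<gamma> t4) (\<gamma> 0)"
        using t arc_subset_boundary_arc[OF pos, of t4 1] endpoints by auto
      have "\<tau> \<noteq> 1"
      proof
        assume "\<tau> = 1"
        then have "p = \<gamma> 0" using \<tau> endpoints by simp
        then show False using np t by auto
      qed
      then have \<tau>1: "\<tau> < 1" using \<tau> by simp
      have "\<gamma> ` {0<..<\<tau>} \<subseteq> X \<or> \<gamma> ` ({0..1} - {0..\<tau>}) \<subseteq> X"
        using X0 pX \<tau> \<open>t2 < \<tau>\<close> t by (intro connected_contains_arc[OF cX XJ]) auto
      then show False
      proof
        assume a: "\<gamma> ` {0<..<\<tau>} \<subseteq> X"
        have "{t2<..<min \<tau> t3} \<subseteq> {0<..<\<tau>}" "{t2<..<min \<tau> t3} \<subseteq> {t2..t3}" using t by auto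
        then have "\<gamma> ` {t2<..<min \<tau> t3} \<subseteq> boundary_arc \<Omega> (\<gamma> 0) (\<gamma> t2) \<inter>
           (boundary_arc \<Omega> (\<gamma> t2) (\<gamma> t3) \<union> boundary_arc \<Omega> (\<gamma> t4) (\<gamma> 0))" using a Xarc sub1 by blast
        then have "finite (\<gamma> ` {t2<..<min \<tau> t3})" by (rule finite_subset[OF _ fin])
        moreover have "infinite (\<gamma> ` {t2<..<min \<tau> t3})" using t \<open>t2 < \<tau>\<close> by (intro infinite_arc) auto
        ultimately show False by blast
      next
        assume a: "\<gamma> ` ({0..1} - {0..\<tau>}) \<subseteq> X"
        have "{max \<tau> t4<..<1} \<subseteq> {0..1} - {0..\<tau>}" "{max \<tau> t4<..<1} \<subseteq> {t4..1}" using t by auto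
        then have "\<gamma> ` {max \<tau> t4<..<1} \<subseteq> boundary_arc \<Omega> (\<gamma> 0) (\<gamma> t2) \<inter>
           (boundary_arc \<Omega> (\<gamma> t2) (\<gamma> t3) \<union> boundary_arc \<Omega> (\<gamma> t4) (\<gamma> 0))" using a Xarc sub2 by blast
        then have "finite (\<gamma> ` {max \<tau> t4<..<1})" by (rule finite_subset[OF _ fin])
        moreover have "infinite (\<gamma> ` {max \<tau> t4<..<1})" using t \<tau>1 by (intro infinite_arc) auto
        ultimately show False by blast
      qed
    qed
  qed
qed

text \<open>\<open>first_boundary_arc\<close> at each corner in turn, with the base point rotated
  there. Shifted parameters such as \<open>1 - t3 + t2\<close> belong to corners that lie past the
  old base point.\<close>

lemma boundary_arcs:
  assumes pos: "\<And>z. z \<in> \<Omega> \<Longrightarrow> winding_number \<gamma> z = 1" and t: "0 < t2" "t2 < t3" "t3 < t4" "t4 < 1"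
    and fin: "finite ((boundary_arc \<Omega> (\<gamma> t2) (\<gamma> t3) \<union> boundary_arc \<Omega> (\<gamma> t4) (\<gamma> 0)) \<inter>
      (boundary_arc \<Omega> (\<gamma> 0) (\<gamma> t2) \<union> boundary_arc \<Omega> (\<gamma> t3) (\<gamma> t4)))"
  shows "boundary_arc \<Omega> (\<gamma> 0) (\<gamma> t2) = \<gamma> ` {0..t2}" "boundary_arc \<Omega> (\<gamma> t2) (\<gamma> t3) = \<gamma> ` {t2..t3}"
    "boundary_arc \<Omega> (\<gamma> t3) (\<gamma> t4) = \<gamma> ` {t3..t4}" "boundary_arc \<Omega> (\<gamma> t4) (\<gamma> 0) = \<gamma> ` {t4..1}"
proof -
  have sh: "boundary_arc \<Omega> (shiftpath a \<gamma> 0) (shiftpath a \<gamma> x) = shiftpath a \<gamma> ` {0..x}"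
    if a: "a \<in> {0..1}" and s: "0 < x" "x < y" "y < w" "w < 1"
      and f: "finite (boundary_arc \<Omega> (shiftpath a \<gamma> 0) (shiftpath a \<gamma> x) \<inter>
        (boundary_arc \<Omega> (shiftpath a \<gamma> x) (shiftpath a \<gamma> y) \<union> boundary_arc \<Omega> (shiftpath a \<gamma> w) (shiftpath a \<gamma> 0)))"
    for a x y w
  proof -
    interpret g: jordan_curve "shiftpath a \<gamma>" using shift(1)[OF a] .
    show ?thesis using g.first_boundary_arc[OF positive_boundary_shift(1)[OF pos a] s] f shift(2)[OF a] by simp
  qed
  have "finite (boundary_arc \<Omega> (\<gamma> 0) (\<gamma> t2) \<inter>
      (boundary_arc \<Omega> (\<gamma> t2) (\<gamma> t3) \<union> boundary_arc \<Omega> (\<gamma> t4) (\<gamma> 0)))"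
    by (rule finite_subset[OF _ fin]) blast
  then show "boundary_arc \<Omega> (\<gamma> 0) (\<gamma> t2) = \<gamma> ` {0..t2}" using first_boundary_arc[OF pos t] by blast
  have v2: "shiftpath t2 \<gamma> 0 = \<gamma> t2" "shiftpath t2 \<gamma> (t3 - t2) = \<gamma> t3" "shiftpath t2 \<gamma> (t4 - t2) = \<gamma> t4" "shiftpath t2 \<gamma> (1 - t2) = \<gamma> 0"
    using t endpoints by (auto simp: shiftpath_def)
  have "boundary_arc \<Omega> (shiftpath t2 \<gamma> 0) (shiftpath t2 \<gamma> (t3 - t2)) = shiftpath t2 \<gamma> ` {0..t3 - t2}"
    by (rule sh[where y = "t4 - t2" and w = "1 - t2"], use t in auto) (rule finite_subset[OF _ fin], unfold v2, blast)
  then show "boundary_arc \<Omega> (\<gamma> t2) (\<gamma> t3) = \<gamma> ` {t2..t3}" using v2 shift_image[of t2 t3] t by simp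
  have v3: "shiftpath t3 \<gamma> 0 = \<gamma> t3" "shiftpath t3 \<gamma> (t4 - t3) = \<gamma> t4" "shiftpath t3 \<gamma> (1 - t3) = \<gamma> 0" "shiftpath t3 \<gamma> (1 - t3 + t2) = \<gamma> t2"
    using t endpoints by (auto simp: shiftpath_def)
  have "boundary_arc \<Omega> (shiftpath t3 \<gamma> 0) (shiftpath t3 \<gamma> (t4 - t3)) = shiftpath t3 \<gamma> ` {0..t4 - t3}"
    by (rule sh[where y = "1 - t3" and w = "1 - t3 + t2"], use t in auto)
       (rule finite_subset[OF _ fin], unfold v3, blast)
  then show "boundary_arc \<Omega> (\<gamma> t3) (\<gamma> t4) = \<gamma> ` {t3..t4}" using v3 shift_image[of t3 t4] t by simp
  have v4: "shiftpath t4 \<gamma> 0 = \<gamma> t4" "shiftpath t4 \<gamma> (1 - t4) = \<gamma> 0" "shiftpath t4 \<gamma> (1 - t4 + t2) = \<gamma> t2" "shiftpath t4 \<gamma> (1 - t4 + t3) = \<gamma> t3"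
    using t endpoints by (auto simp: shiftpath_def)
  have "boundary_arc \<Omega> (shiftpath t4 \<gamma> 0) (shiftpath t4 \<gamma> (1 - t4)) = shiftpath t4 \<gamma> ` {0..1 - t4}"
    by (rule sh[where y = "1 - t4 + t2" and w = "1 - t4 + t3"], use t in auto) (rule finite_subset[OF _ fin], unfold v4, blast)
  then show "boundary_arc \<Omega> (\<gamma> t4) (\<gamma> 0) = \<gamma> ` {t4..1}" using v4 shift_image[of t4 1] t by simp
qed

text \<open>Collects what a solution contributes to the rest of the proof. \<open>E\<close> enters
  through an equation so that the two problems, whose Dirichlet and Neumann parts are exchanged, can
  share one exceptional set.\<close>

lemma dirichlet_neumann_data:
  assumes har: "harmonic_on u \<Omega>" and dn: "dirichlet_neumann \<Omega> A B \<psi> (\<lambda>t. 0) u"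
    and E: "E = {p \<in> frontier \<Omega>. \<nexists>n. exterior_normal \<Omega> p n} \<union> (A \<inter> B)"
  obtains f where "f holomorphic_on \<Omega>" "\<And>z. z \<in> \<Omega> \<Longrightarrow> Re (f z) = u z"
    "\<And>p. p \<in> J - E \<Longrightarrow> \<exists>l. (f \<longlongrightarrow> l) (at p within \<Omega>)"
    "\<And>a b. \<lbrakk>0 \<le> a; a < b; b \<le> 1; \<gamma> ` {a..b} \<subseteq> B\<rbrakk> \<Longrightarrow>
       \<exists>y. \<forall>t\<in>{a<..<b}. (f \<longlongrightarrow> Complex (u (\<gamma> t)) y) (at (\<gamma> t) within \<Omega>)"
proof -
  have u: "continuous_on (closure \<Omega>) u" and reg: "regular_domain \<Omega>" and fAB: "finite (A \<inter> B)" and AB: "frontier \<Omega> = A \<union> B"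
    using dn unfolding dirichlet_neumann_def by auto
  obtain g where g: "\<And>z. z \<in> closure \<Omega> - E \<Longrightarrow> (u has_derivative (\<lambda>v. g z \<bullet> v)) (at z within closure \<Omega>)"
      "continuous_on (closure \<Omega> - E) g"
      "\<And>t n. \<lbrakk>t \<in> B - E; exterior_normal \<Omega> t n\<rbrakk> \<Longrightarrow> g t \<bullet> n = 0"
  proof -
    have "\<exists>g. (\<forall>z\<in>closure \<Omega> - E. (u has_derivative (\<lambda>v. g z \<bullet> v)) (at z within closure \<Omega>)) \<and>
            continuous_on (closure \<Omega> - E) g \<and>
            (\<forall>t\<in>B - E. \<forall>n. exterior_normal \<Omega> t n \<longrightarrow> g t \<bullet> n = 0)"
      using dn unfolding dirichlet_neumann_def Let_def E[symmetric] by (elim conjE) assumption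
    then show ?thesis using that by blast
  qed
  have fE: "finite E" unfolding E using finitely_many_without_normal[OF reg] fAB by blast
  have EJ: "E \<subseteq> J" unfolding E using AB domain_facts(5) by blast
  have normal: "\<exists>n. exterior_normal \<Omega> p n" if "p \<in> J - E" for p using that domain_facts(5) unfolding E by blast
  obtain f where f: "f holomorphic_on \<Omega>" "\<And>z. z \<in> \<Omega> \<Longrightarrow> Re (f z) = u z"
    using harmonic_real_part[OF domain_facts(1,9) har] by blast
  show ?thesis
  proof (rule that[OF f])
    fix p assume p: "p \<in> J - E"
    then obtain n where n: "exterior_normal \<Omega> p n" using normal by blast
    obtain \<eta> where \<eta>: "\<eta> > 0" "\<forall>q \<in> J \<inter> ball p \<eta>. \<exists>l. (f \<longlongrightarrow> l) (at q within \<Omega>)"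
      using boundary_regularity[OF f fE EJ g(1,2) p n zero_less_one] by blast
    have "p \<in> J \<inter> ball p \<eta>" using p \<eta>(1) by simp
    then show "\<exists>l. (f \<longlongrightarrow> l) (at p within \<Omega>)" using \<eta>(2) by blast
  next
    fix a b :: real assume ab: "0 \<le> a" "a < b" "b \<le> 1" and sub: "\<gamma> ` {a..b} \<subseteq> B"
    have neu: "g q \<bullet> n = 0" if "q \<in> \<gamma> ` {a..b} - E" "exterior_normal \<Omega> q n" for q n
      using g(3) that sub by blast
    show "\<exists>y. \<forall>t\<in>{a<..<b}. (f \<longlongrightarrow> Complex (u (\<gamma> t)) y) (at (\<gamma> t) within \<Omega>)"
      by (rule conjugate_constant_on_neumann_arc[OF f u fE EJ g(1,2) normal ab neu]) blast+
  qed
qed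

end

section \<open>Mapping onto a rectangle\<close>

text \<open>The segment is convex, so the straight homotopy to \<open>linepath a b\<close> never
  meets \<open>w\<close>.\<close>

lemma winding_number_in_segment:
  assumes p: "path p" "path_image p \<subseteq> closed_segment a b" "pathstart p = a" "pathfinish p = b"
    and w: "w \<notin> closed_segment a b"
  shows "winding_number p w = winding_number (linepath a b) w"
proof (rule winding_number_homotopic_paths, rule homotopic_paths_linear)
  fix t :: real assume t: "t \<in> {0..1}"
  have "p t \<in> closed_segment a b" using p(2) t by (auto simp: path_image_def)
  moreover have "linepath a b t \<in> closed_segment a b" using t by (metis linepath_in_path atLeastAtMost_iff)
  ultimately have "closed_segment (p t) (linepath a b t) \<subseteq> closed_segment a b"
    by (intro closed_segment_subset convex_closed_segment)
  then show "closed_segment (p t) (linepath a b t) \<subseteq> - {w}" using w by blast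
qed (use p in auto)

lemma quad_rectangle_box: "quad_rectangle h = box 0 (Complex 1 h)"
  by (auto simp: quad_rectangle_def in_box_complex_iff)

text \<open>Each piece can be replaced by the straight side it runs in, which leaves the rectangle
  traversed from \<open>Complex 1 c\<close>. For \<open>c < 0\<close> it lies below the real axis
  and the same order of corners runs clockwise, whence \<open>- 1\<close>.\<close>

lemma winding_number_around_rectangle:
  assumes P: "path P" and t: "0 < t2" "t2 < t3" "t3 < t4" "t4 < 1"
    and v: "P 0 = Complex 1 c" "P t2 = Complex 0 c" "P t3 = 0" "P t4 = 1" "P 1 = Complex 1 c"
    and sides: "P ` {0..t2} \<subseteq> closed_segment (Complex 1 c) (Complex 0 c)" "P ` {t2..t3} \<subseteq> closed_segment (Complex 0 c) 0"
      "P ` {t3..t4} \<subseteq> closed_segment 0 1" "P ` {t4..1} \<subseteq> closed_segment 1 (Complex 1 c)"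
    and w: "0 < Re w" "Re w < 1" "(0 < Im w \<and> Im w < c) \<or> (c < Im w \<and> Im w < 0)"
  shows "winding_number P w = (if 0 < c then 1 else - 1)"
proof -
  have ns: "w \<notin> closed_segment (Complex 1 c) (Complex 0 c)" "w \<notin> closed_segment (Complex 0 c) 0"
      "w \<notin> closed_segment 0 1" "w \<notin> closed_segment 1 (Complex 1 c)"
    using w by (auto simp: closed_segment_same_Re closed_segment_same_Im)
  define L where "L = (\<lambda>a b. winding_number (linepath a b) w)"
  have pw: "w \<notin> path_image P"
  proof
    assume "w \<in> path_image P"
    then obtain s where s: "s \<in> {0..1}" "w = P s" by (auto simp: path_image_def)
    then have "s \<in> {0..t2} \<or> s \<in> {t2..t3} \<or> s \<in> {t3..t4} \<or> s \<in> {t4..1}" by auto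
    then show False using sides ns s(2) by blast
  qed
  have sub: "winding_number (subpath a b P) w = L (P a) (P b)"
    if "0 \<le> a" "a \<le> b" "b \<le> 1" "P ` {a..b} \<subseteq> closed_segment (P a) (P b)" "w \<notin> closed_segment (P a) (P b)" for a b
    unfolding L_def
  proof (rule winding_number_in_segment)
    show "path (subpath a b P)" using P that by (intro path_subpath) auto
    show "path_image (subpath a b P) \<subseteq> closed_segment (P a) (P b)" using that by (simp add: path_image_subpath)
  qed (use that in auto)
  have comb: "winding_number (subpath 0 b P) w + winding_number (subpath b d P) w = winding_number (subpath 0 d P) w"
    if "b \<in> {0..1}" "d \<in> {0..1}" for b d
    using that by (intro winding_number_subpath_combine[OF P pw]) auto
  have "winding_number P w = winding_number (subpath 0 t2 P) w + winding_number (subpath t2 t3 P) w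
      + winding_number (subpath t3 t4 P) w + winding_number (subpath t4 1 P) w"
    using comb[of t2 t3] comb[of t3 t4] comb[of t4 1] t by simp
  also have "\<dots> = L (Complex 1 c) (Complex 0 c) + L (Complex 0 c) 0 + L 0 1 + L 1 (Complex 1 c)"
    using sub[of 0 t2] sub[of t2 t3] sub[of t3 t4] sub[of t4 1] sides ns t by (simp add: v)
  finally have sum: "winding_number P w = L (Complex 1 c) (Complex 0 c) + L (Complex 0 c) 0 + L 0 1 + L 1 (Complex 1 c)" .
  have rp: "winding_number (linepath a b +++ linepath b d +++ linepath d e +++ linepath e a) w = L a b + L b d + L d e + L e a"
    if "w \<notin> closed_segment a b" "w \<notin> closed_segment b d" "w \<notin> closed_segment d e" "w \<notin> closed_segment e a" for a b d e
    using that by (simp add: winding_number_join L_def path_image_join)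
  have rev: "L b a = - L a b" if "w \<notin> closed_segment a b" for a b
    using winding_number_reversepath[of "linepath a b" w] that by (simp add: L_def)
  have one: "Complex 1 0 = 1" "Complex 0 0 = 0" by (simp_all add: complex_eq_iff)
  show ?thesis
  proof (cases "0 < c")
    case True
    have "w \<in> box 0 (Complex 1 c)" using w True by (auto simp: in_box_complex_iff)
    then have "winding_number (rectpath 0 (Complex 1 c)) w = 1" by (rule winding_number_rectpath)
    then have "L 0 1 + L 1 (Complex 1 c) + L (Complex 1 c) (Complex 0 c) + L (Complex 0 c) 0 = 1"
      unfolding rectpath_def Let_def using ns by (simp add: one rp)
    then show ?thesis using sum True by (simp add: algebra_simps)
  next
    case False
    have "w \<in> box (Complex 0 c) 1" using w False by (auto simp: in_box_complex_iff)
    then have "winding_number (rectpath (Complex 0 c) 1) w = 1" by (rule winding_number_rectpath)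
    then have "L (Complex 0 c) (Complex 1 c) + L (Complex 1 c) 1 + L 1 0 + L 0 (Complex 0 c) = 1"
      unfolding rectpath_def Let_def using ns by (simp add: one rp closed_segment_commute)
    then have "- (L (Complex 1 c) (Complex 0 c) + L (Complex 0 c) 0 + L 0 1 + L 1 (Complex 1 c)) = 1"
      using ns by (simp add: rev algebra_simps)
    then show ?thesis using sum False by (metis minus_equation_iff)
  qed
qed

text \<open>The four lines are closed, and two of them can meet on the frontier of the rectangle
  only in a corner. So the connected open piece of the path lies in one line, and the endpoints
  follow by closure.\<close>

lemma path_in_rectangle_side:
  fixes P :: "real \<Rightarrow> complex"
  assumes ab: "a < b" and contP: "continuous_on {a..b} P"
    and im: "\<And>s. s \<in> {a<..<b} \<Longrightarrow> P s \<in> cbox 0 (Complex 1 h) - box 0 (Complex 1 h) - {Complex 1 h, Complex 0 h, 0, 1}"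
  shows "\<exists>S\<in>{{z. Re z = 0}, {z. Re z = 1}, {z. Im z = 0}, {z. Im z = h}}. P ` {a..b} \<subseteq> S"
proof -
  let ?\<S> = "{{z::complex. Re z = 0}, {z. Re z = 1}, {z. Im z = 0}, {z. Im z = h}}"
  define X where "X = P ` {a<..<b}"
  have "continuous_on {a<..<b} P" using contP by (rule continuous_on_subset) auto
  then have cX: "connected X" unfolding X_def by (intro connected_continuous_image) auto
  have XU: "X \<subseteq> \<Union>?\<S>" using im by (force simp: X_def in_cbox_complex_iff in_box_complex_iff)
  have clS: "closed S" if "S \<in> ?\<S>" for S
    using that by (auto intro!: closed_Collect_eq continuous_intros)
  have disj: "S \<inter> S' \<inter> X = {}" if "S \<in> ?\<S>" "S' \<in> ?\<S>" "S \<noteq> S'" for S S'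
  proof -
    have "z \<notin> X" if z: "z \<in> S" "z \<in> S'" for z
    proof
      assume "z \<in> X"
      then have zz: "z \<noteq> Complex 1 h" "z \<noteq> Complex 0 h" "z \<noteq> 0" "z \<noteq> 1" using im by (auto simp: X_def)
      have "Re z = 0 \<or> Re z = 1" "Im z = 0 \<or> Im z = h"
        using z \<open>S \<in> ?\<S>\<close> \<open>S' \<in> ?\<S>\<close> \<open>S \<noteq> S'\<close> by (elim insertE emptyE; simp)+
      then show False using zz by (auto simp: complex_eq_iff)
    qed
    then show ?thesis by blast
  qed
  define m where "m = (a + b) / 2"
  have mX: "P m \<in> X" using ab by (auto simp: X_def m_def)
  then obtain S where S: "S \<in> ?\<S>" "P m \<in> S" using XU by blast
  define T where "T = \<Union>(?\<S> - {S})"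
  have "closed T" unfolding T_def using clS by (intro closed_Union) auto
  moreover have "S \<inter> T \<inter> X = {}" using disj[OF S(1)] by (auto simp: T_def)
  moreover have "X \<subseteq> S \<union> T" using XU unfolding T_def by blast
  ultimately have "S \<inter> X = {} \<or> T \<inter> X = {}" using connected_closedD[OF cX _ _ clS[OF S(1)]] by blast
  then have "X \<subseteq> S" using S(2) mX \<open>X \<subseteq> S \<union> T\<close> by blast
  moreover have "closure {a<..<b} = {a..b}" using ab by (rule closure_greaterThanLessThan)
  ultimately have "P ` {a..b} \<subseteq> S"
    using image_closure_subset[of "{a<..<b}" P S] contP clS[OF S(1)] by (simp add: X_def)
  then show ?thesis using S(1) by blast
qed

section \<open>Existence and uniqueness of the map onto the rectangle\<close>

context jordan_curve
begin

lemma curve_pieces: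
  assumes "p \<in> J" "0 < t2" "t2 < t3" "t3 < t4" "t4 < 1"
  obtains s where "p = \<gamma> s" "s \<in> {0..t2} \<or> s \<in> {t2..t3} \<or> s \<in> {t3..t4} \<or> s \<in> {t4..1}"
proof -
  obtain s where "s \<in> {0..1}" "p = \<gamma> s" using assms(1) by (auto simp: path_image_def)
  then show ?thesis using that[of s] assms by force
qed

lemma real_part_zero_if_mixed_zero:
  assumes hol: "W holomorphic_on \<Omega>" and contW: "continuous_on (closure \<Omega>) W" and Y: "finite Y"
    and bd: "\<And>p. p \<in> J \<Longrightarrow> Re (W p) = 0 \<or> Im (W p) \<in> Y" and q: "q \<in> J" "Re (W q) = 0"
    and z: "z \<in> closure \<Omega>"
  shows "Re (W z) = 0"
proof (rule antisym)
  show "Re (W z) \<le> 0" by (rule mixed_maximum_continuous[OF hol contW Y _ q(1) _ z]) (use bd q in force)+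
  have "Re (- W z) \<le> 0"
    by (rule mixed_maximum_continuous[where W = "\<lambda>z. - W z" and Y = "uminus ` Y", OF _ _ _ _ q(1) _ z])
       (use bd q Y in \<open>force intro!: holomorphic_intros continuous_intros hol contW\<close>)+
  then show "0 \<le> Re (W z)" by simp
qed

text \<open>The sign of \<open>c\<close> is not given. The maximum principle first confines the
  image to the closed rectangle with heights between 0 and \<open>c\<close>, so the boundary curve
  winds \<open>1\<close> or \<open>- 1\<close> times around interior points according to that sign;
  a number of zeros cannot be \<open>- 1\<close>, and with \<open>n = 1\<close> every interior value
  is attained exactly once.\<close>

lemma conformal_onto_rectangle:
  assumes pos: "\<And>z. z \<in> \<Omega> \<Longrightarrow> winding_number \<gamma> z = 1" and t: "0 < t2" "t2 < t3" "t3 < t4" "t4 < 1"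
    and hol: "f holomorphic_on \<Omega>" and contf: "continuous_on (closure \<Omega>) f"
    and f: "\<And>s. s \<in> {0..t2} \<Longrightarrow> Im (f (\<gamma> s)) = c" "\<And>s. s \<in> {t2..t3} \<Longrightarrow> Re (f (\<gamma> s)) = 0"
      "\<And>s. s \<in> {t3..t4} \<Longrightarrow> Im (f (\<gamma> s)) = 0" "\<And>s. s \<in> {t4..1} \<Longrightarrow> Re (f (\<gamma> s)) = 1"
  shows "canonical_conformal_map \<Omega> (\<gamma> 0) (\<gamma> t2) (\<gamma> t3) (\<gamma> t4) c f"
proof -
  have \<gamma>J: "\<gamma> s \<in> J" if "0 \<le> s" "s \<le> 1" for s using that by (auto simp: path_image_def)
  have Jc: "p \<in> closure \<Omega>" if "p \<in> J" for p using that domain_facts(7) by blast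
  have bd: "Re (f p) \<in> {0, 1} \<or> Im (f p) \<in> {0, c}" if "p \<in> J" for p
    by (rule curve_pieces[OF that t]) (use f in auto)
  have v: "f (\<gamma> 0) = Complex 1 c" "f (\<gamma> t2) = Complex 0 c" "f (\<gamma> t3) = 0" "f (\<gamma> t4) = 1"
    using f(1)[of 0] f(4)[of 1] f(1)[of t2] f(2)[of t2] f(2)[of t3] f(3)[of t3] f(3)[of t4] f(4)[of t4] t endpoints
    by (auto simp: complex_eq_iff)
  have J24: "\<gamma> t2 \<in> J" "\<gamma> t4 \<in> J" "\<gamma> t3 \<in> J" using \<gamma>J t by auto
  have hols: "(\<lambda>z. k * f z) holomorphic_on \<Omega>" "continuous_on (closure \<Omega>) (\<lambda>z. k * f z)" for k
    by (intro holomorphic_intros continuous_intros hol contf)+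
  have rect: "0 \<le> Re (f z) \<and> Re (f z) \<le> 1 \<and> min 0 c \<le> Im (f z) \<and> Im (f z) \<le> max 0 c" if z: "z \<in> closure \<Omega>" for z
  proof -
    \<comment> \<open>One half-plane for each side: the factors 1, \<open>- 1\<close>,
      \<open>- \<i>\<close> and \<open>\<i>\<close> turn each bound into one for a real part, and a
      corner satisfying it serves as the point \<open>q\<close>.\<close>
    have "Re (1 * f z) \<le> 1"
      by (rule mixed_maximum_continuous[OF hols, of "{0, c}" 1 _ "\<gamma> t2", OF _ _ J24(1) _ z]) (use bd v in force)+
    moreover have "Re ((-1) * f z) \<le> 0"
      by (rule mixed_maximum_continuous[OF hols, of "{0, -c}" _ 0 "\<gamma> t2", OF _ _ J24(1) _ z]) (use bd v in force)+
    moreover have "Re ((- \<i>) * f z) \<le> max 0 c"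
      by (rule mixed_maximum_continuous[OF hols, of "{0, -1}" _ "max 0 c" "\<gamma> t3", OF _ _ J24(3) _ z]) (use bd v in force)+
    moreover have "Re (\<i> * f z) \<le> - min 0 c"
      by (rule mixed_maximum_continuous[OF hols, of "{0, 1}" _ "- min 0 c" "\<gamma> t3", OF _ _ J24(3) _ z]) (use bd v in force)+
    ultimately show ?thesis by simp
  qed
  \<comment> \<open>For \<open>c = 0\<close> the function would be real on the whole closure; then
    every boundary point has height 0, and the value 0 at \<open>\<gamma> t2\<close> bounds the real
    part everywhere, against the value 1 at \<open>\<gamma> t4\<close>.\<close>
  have c0: "c \<noteq> 0"
  proof
    assume "c = 0"
    then have Im0: "Im (f z) = 0" if "z \<in> closure \<Omega>" for z using rect[OF that] by simp
    have "Re (f (\<gamma> t4)) \<le> 0"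
      by (rule mixed_maximum_continuous[OF hol contf, of "{0}" 0 "\<gamma> t2", OF _ _ J24(1) _ Jc[OF J24(2)]]) (use v Jc Im0 in auto)
    then show False using v by simp
  qed
  have pathf: "path (f \<circ> \<gamma>)"
    unfolding path_def using Jc \<gamma>J
    by (intro continuous_on_compose cont continuous_on_subset[OF contf]) auto
  have wn: "winding_number (f \<circ> \<gamma>) w = (if 0 < c then 1 else - 1)"
    if w: "0 < Re w" "Re w < 1" "(0 < Im w \<and> Im w < c) \<or> (c < Im w \<and> Im w < 0)" for w
  proof (rule winding_number_around_rectangle[OF pathf t _ _ _ _ _ _ _ _ _ w])
    have r: "0 \<le> Re (f (\<gamma> s)) \<and> Re (f (\<gamma> s)) \<le> 1 \<and> min 0 c \<le> Im (f (\<gamma> s)) \<and> Im (f (\<gamma> s)) \<le> max 0 c"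
      if "s \<in> {0..1}" for s using rect[OF Jc[OF \<gamma>J]] that by auto
    have r': "Im (f (\<gamma> s)) \<in> closed_segment c 0 \<and> Im (f (\<gamma> s)) \<in> closed_segment 0 c \<and> Re (f (\<gamma> s)) \<in> closed_segment 1 0 \<and> Re (f (\<gamma> s)) \<in> closed_segment 0 1"
      if "s \<in> {0..1}" for s
      using r[OF that] by (auto simp: closed_segment_eq_real_ivl min_def max_def split: if_splits)
    show "(f \<circ> \<gamma>) ` {0..t2} \<subseteq> closed_segment (Complex 1 c) (Complex 0 c)"
      using r' f(1) t by (auto simp: closed_segment_same_Im)
    show "(f \<circ> \<gamma>) ` {t2..t3} \<subseteq> closed_segment (Complex 0 c) 0"
      using r' f(2) t by (auto simp: closed_segment_same_Re)
    show "(f \<circ> \<gamma>) ` {t3..t4} \<subseteq> closed_segment 0 1"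
      using r' f(3) t by (auto simp: closed_segment_same_Im)
    show "(f \<circ> \<gamma>) ` {t4..1} \<subseteq> closed_segment 1 (Complex 1 c)"
      using r' f(4) t by (auto simp: closed_segment_same_Re)
  qed (use v endpoints in auto)
  have count: "\<exists>n. (if 0 < c then 1 else - 1) = (of_nat n :: complex) \<and> finite {z \<in> \<Omega>. f z = w} \<and>
      card {z \<in> \<Omega>. f z = w} \<le> n \<and> ({z \<in> \<Omega>. f z = w} = {} \<longrightarrow> n = 0)"
    if w: "0 < Re w" "Re w < 1" "(0 < Im w \<and> Im w < c) \<or> (c < Im w \<and> Im w < 0)" for w
  proof -
    have nz: "f z - w \<noteq> 0" if "z \<in> J" for z using bd[OF that] w by auto
    have "winding_number ((\<lambda>z. f z - w) \<circ> \<gamma>) 0 = (if 0 < c then 1 else - 1)"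
      using wn[OF w] by (simp add: winding_number_offset[of _ w] o_def)
    then show ?thesis
      using winding_number_image_counts_zeros[OF pos, of "\<lambda>z. f z - w"] nz contf hol
      by (force intro!: continuous_intros holomorphic_intros)
  qed
  have cpos: "0 < c"
  proof (rule ccontr)
    assume "\<not> 0 < c"
    then have "c < 0" using c0 by simp
    then obtain n :: nat where "of_nat n = (- 1 :: complex)"
      using count[of "Complex (1/2) (c/2)"] by force
    then have "of_nat (Suc n) = (0 :: complex)" by simp
    then show False by (simp only: of_nat_eq_0_iff)
  qed
  have cnt: "\<exists>!z. z \<in> \<Omega> \<and> f z = w" if w: "w \<in> quad_rectangle c" for w
  proof -
    obtain n where n: "(1 :: complex) = of_nat n" "finite {z \<in> \<Omega>. f z = w}" "card {z \<in> \<Omega>. f z = w} \<le> n"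
        "{z \<in> \<Omega>. f z = w} = {} \<longrightarrow> n = 0"
      using count[of w] w cpos by (auto simp: quad_rectangle_def)
    have "n = 1" using n(1) by (metis of_nat_eq_1_iff)
    then have "{z \<in> \<Omega>. f z = w} \<noteq> {}" using n(4) by simp
    then have "card {z \<in> \<Omega>. f z = w} \<noteq> 0" using n(2) card_0_eq by blast
    then have "card {z \<in> \<Omega>. f z = w} = 1" using n(3) \<open>n = 1\<close> by linarith
    then obtain z where "{z \<in> \<Omega>. f z = w} = {z}" by (auto simp: card_1_singleton_iff)
    then show ?thesis by (intro ex1I[of _ z]) blast+
  qed
  have nc: "\<not> f constant_on \<Omega>"
  proof
    assume "f constant_on \<Omega>"
    then obtain k where k: "\<And>z. z \<in> \<Omega> \<Longrightarrow> f z = k" unfolding constant_on_def by blast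
    have "f (\<gamma> t2) = k" "f (\<gamma> t4) = k" using continuous_constant_on_closure[OF contf k] J24 Jc by blast+
    then show False using v by (simp add: complex_eq_iff)
  qed
  have "open (f ` \<Omega>)" using open_mapping_thm[OF hol domain_facts(1,2,1) order_refl nc] .
  moreover have "f ` \<Omega> \<subseteq> cbox 0 (Complex 1 c)"
  proof
    fix w assume "w \<in> f ` \<Omega>"
    then obtain z where z: "z \<in> \<Omega>" "w = f z" by blast
    then show "w \<in> cbox 0 (Complex 1 c)"
      using rect[of z] subsetD[OF closure_subset z(1)] cpos by (simp add: in_cbox_complex_iff)
  qed
  ultimately have "f ` \<Omega> \<subseteq> box 0 (Complex 1 c)"
    by (metis interior_cbox interior_maximal)
  then have im1: "f ` \<Omega> \<subseteq> quad_rectangle c" by (simp add: quad_rectangle_box)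
  have im: "f ` \<Omega> = quad_rectangle c" using im1 cnt by blast
  have inj: "inj_on f \<Omega>" using cnt im1 by (metis imageI inj_onI subsetD)
  have "\<exists>g. homeomorphism (closure \<Omega>) (closure (quad_rectangle c)) f g"
  proof (rule homeomorphism_of_conformal[OF contf hol _ _ im inj])
    show "open (quad_rectangle c)" "convex (quad_rectangle c)" by (simp_all add: quad_rectangle_box open_box)
    show "f z \<notin> quad_rectangle c" if "z \<in> J" for z using bd[OF that] by (auto simp: quad_rectangle_def)
  qed
  then show ?thesis
    unfolding canonical_conformal_map_def using hol im inj v by (auto simp: bij_betw_def)
qed

text \<open>Only corners are prescribed for \<open>F\<close>. It maps \<open>J\<close> into the
  frontier of the rectangle, and by injectivity an open arc between neighbouring corners avoids all
  four corner values, so it stays on one side line, identified by the images of its ends. Then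
  \<open>W = F - f\<close> has real part 0 on two opposite arcs and height 0 or \<open>h - c\<close>
  on the others; \<open>h = c\<close> comes out only at the end.\<close>

lemma canonical_conformal_map_unique:
  assumes t: "0 < t2" "t2 < t3" "t3 < t4" "t4 < 1"
    and hol: "f holomorphic_on \<Omega>" and contf: "continuous_on (closure \<Omega>) f"
    and f: "\<And>s. s \<in> {0..t2} \<Longrightarrow> Im (f (\<gamma> s)) = c" "\<And>s. s \<in> {t2..t3} \<Longrightarrow> Re (f (\<gamma> s)) = 0"
      "\<And>s. s \<in> {t3..t4} \<Longrightarrow> Im (f (\<gamma> s)) = 0" "\<And>s. s \<in> {t4..1} \<Longrightarrow> Re (f (\<gamma> s)) = 1"
    and F: "canonical_conformal_map \<Omega> (\<gamma> 0) (\<gamma> t2) (\<gamma> t3) (\<gamma> t4) h F"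
  shows "h = c" "\<And>z. z \<in> closure \<Omega> \<Longrightarrow> F z = f z"
proof -
  have \<gamma>J: "\<gamma> s \<in> J" if "0 \<le> s" "s \<le> 1" for s using that by (auto simp: path_image_def)
  have Jc: "p \<in> closure \<Omega>" if "p \<in> J" for p using that domain_facts(7) by blast
  obtain g where holF: "F holomorphic_on \<Omega>" and bij: "bij_betw F \<Omega> (quad_rectangle h)"
    and hom: "homeomorphism (closure \<Omega>) (closure (quad_rectangle h)) F g"
    and vF: "F (\<gamma> 0) = Complex 1 h" "F (\<gamma> t2) = Complex 0 h" "F (\<gamma> t3) = 0" "F (\<gamma> t4) = 1"
    using F unfolding canonical_conformal_map_def by blast
  have ne: "quad_rectangle h \<noteq> {}" using bij domain_facts(4) by (auto simp: bij_betw_def)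
  then have h: "h > 0" by (auto simp: quad_rectangle_def)
  have cl: "closure (quad_rectangle h) = cbox 0 (Complex 1 h)"
    using ne by (simp add: quad_rectangle_box closure_box)
  have contF: "continuous_on (closure \<Omega>) F" using hom by (simp add: homeomorphism_def)
  have injF: "inj_on F (closure \<Omega>)" by (rule inj_on_inverseI[of _ g]) (rule homeomorphism_apply1[OF hom])
  have imF: "F ` closure \<Omega> = cbox 0 (Complex 1 h)" using hom cl by (simp add: homeomorphism_def)
  have FJ: "F p \<in> cbox 0 (Complex 1 h) - box 0 (Complex 1 h)" if p: "p \<in> J" for p
  proof
    show "F p \<in> cbox 0 (Complex 1 h)" using imF Jc[OF p] by blast
    show "F p \<notin> box 0 (Complex 1 h)"
    proof
      assume "F p \<in> box 0 (Complex 1 h)"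
      then have "F p \<in> F ` \<Omega>" using bij by (simp add: bij_betw_def quad_rectangle_box)
      then obtain z where "z \<in> \<Omega>" "F p = F z" by blast
      then have "p = z" using injF Jc[OF p] closure_subset by (meson inj_onD subsetD)
      then show False using \<open>z \<in> \<Omega>\<close> notin[OF p] by simp
    qed
  qed
  have side: "\<exists>S\<in>{{z. Re z = 0}, {z. Re z = 1}, {z. Im z = 0}, {z. Im z = h}}. \<forall>s\<in>{a..b}. F (\<gamma> s) \<in> S"
    if ab: "0 \<le> a" "a < b" "b \<le> 1" "{t2, t3, t4} \<inter> {a<..<b} = {}" for a b
  proof -
    have "\<exists>S\<in>{{z. Re z = 0}, {z. Re z = 1}, {z. Im z = 0}, {z. Im z = h}}. (F \<circ> \<gamma>) ` {a..b} \<subseteq> S"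
    proof (rule path_in_rectangle_side[OF ab(2)])
      have "continuous_on {a..b} \<gamma>" using cont ab by (auto intro: continuous_on_subset)
      then show "continuous_on {a..b} (F \<circ> \<gamma>)"
        using Jc \<gamma>J ab by (intro continuous_on_compose continuous_on_subset[OF contF]) auto
      fix s assume s: "s \<in> {a<..<b}"
      have ne: "F (\<gamma> s) \<noteq> F (\<gamma> r)" if r: "r \<in> {0, t2, t3, t4}" for r
      proof
        assume eq: "F (\<gamma> s) = F (\<gamma> r)"
        have sr: "0 \<le> s" "s \<le> 1" "0 \<le> r" "r \<le> 1" using s r ab t by auto
        have "\<gamma> s = \<gamma> r" by (rule inj_onD[OF injF eq Jc[OF \<gamma>J[OF sr(1,2)]] Jc[OF \<gamma>J[OF sr(3,4)]]])
        then have "s = r \<or> s = 0 \<or> s = 1" using injD[of s r] sr by blast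
        then show False using s r ab by auto
      qed
      show "(F \<circ> \<gamma>) s \<in> cbox 0 (Complex 1 h) - box 0 (Complex 1 h) - {Complex 1 h, Complex 0 h, 0, 1}"
        using FJ[of "\<gamma> s"] \<gamma>J[of s] s ab ne[of 0] ne[of t2] ne[of t3] ne[of t4] vF by auto
    qed
    then show ?thesis by (auto simp: image_subset_iff)
  qed
  have side3: "\<exists>S\<in>{{z. Re z = 0}, {z. Re z = 1}, {z. Im z = 0}, {z. Im z = h}}. F (\<gamma> a) \<in> S \<and> F (\<gamma> b) \<in> S \<and> F (\<gamma> s) \<in> S"
    if "0 \<le> a" "a < b" "b \<le> 1" "{t2, t3, t4} \<inter> {a<..<b} = {}" "s \<in> {a..b}" for a b s
  proof -
    have "a \<in> {a..b}" "b \<in> {a..b}" using that(2) by auto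
    then show ?thesis using side[OF that(1-4)] that(5) by blast
  qed
  \<comment> \<open>Since \<open>h > 0\<close>, \<open>Im z = h\<close> is the only one of the four
    lines through both \<open>Complex 1 h\<close> and \<open>Complex 0 h\<close>; the other three
    arcs are analogous.\<close>
  have s1: "Im (F (\<gamma> s)) = h" if s: "s \<in> {0..t2}" for s
    using side3[OF _ _ _ _ s] t h vF by auto
  have s2: "Re (F (\<gamma> s)) = 0" if s: "s \<in> {t2..t3}" for s
    using side3[OF _ _ _ _ s] t h vF by auto
  have s3: "Im (F (\<gamma> s)) = 0" if s: "s \<in> {t3..t4}" for s
    using side3[OF _ _ _ _ s] t h vF by auto
  have s4: "Re (F (\<gamma> s)) = 1" if s: "s \<in> {t4..1}" for s
    using side3[OF _ _ _ _ s] t h vF endpoints by auto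
  define W where "W = (\<lambda>z. F z - f z)"
  have hW: "W holomorphic_on \<Omega>" "continuous_on (closure \<Omega>) W"
    unfolding W_def by (intro holomorphic_intros continuous_intros hol contf holF contF)+
  have J3: "\<gamma> t3 \<in> J" using \<gamma>J t by auto
  have W3: "W (\<gamma> t3) = 0" using vF f(2)[of t3] f(3)[of t3] t by (auto simp: W_def complex_eq_iff)
  have ReW: "Re (W z) = 0" if z: "z \<in> closure \<Omega>" for z
  proof (rule real_part_zero_if_mixed_zero[OF hW _ _ J3 _ z])
    show "finite {0, h - c}" by simp
    show "Re (W p) = 0 \<or> Im (W p) \<in> {0, h - c}" if "p \<in> J" for p
      by (rule curve_pieces[OF that t]) (use f s1 s2 s3 s4 in \<open>auto simp: W_def\<close>)
  qed (simp add: W3)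
  \<comment> \<open>Now \<open>Im (\<i> * W)\<close> is \<open>Re W\<close>, known to be 0, so a
    single height suffices and the zero of \<open>W\<close> at \<open>\<gamma> t3\<close> fixes the
    constant.\<close>
  have "Re (\<i> * W z) = 0" if z: "z \<in> closure \<Omega>" for z
  proof (rule real_part_zero_if_mixed_zero[where W = "\<lambda>z. \<i> * W z", OF _ _ _ _ J3 _ z])
    show "(\<lambda>z. \<i> * W z) holomorphic_on \<Omega>" "continuous_on (closure \<Omega>) (\<lambda>z. \<i> * W z)"
      by (intro holomorphic_intros continuous_intros hW)+
    show "finite {0::real}" by simp
    show "Re (\<i> * W p) = 0 \<or> Im (\<i> * W p) \<in> {0}" if "p \<in> J" for p using ReW[OF Jc[OF that]] by simp
  qed (simp add: W3)
  then have W0: "W z = 0" if "z \<in> closure \<Omega>" for z using ReW[OF that] that by (simp add: complex_eq_iff)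
  then show "\<And>z. z \<in> closure \<Omega> \<Longrightarrow> F z = f z" by (simp add: W_def)
  have "W (\<gamma> 0) = 0" using W0 Jc \<gamma>J by simp
  then show "h = c" using vF f(1)[of 0] t by (simp add: W_def complex_eq_iff)
qed

end

section \<open>The conjugate function method\<close>

text \<open>The second conjunct renders the definite article in "the conformal mapping". As
  \<open>quad_modulus\<close> is a definite description, its value becomes known only once existence
  and uniqueness of the height are both established.\<close>

theorem mainTheorem2:
  fixes \<Omega> :: "complex set" and z1 z2 z3 z4 :: complex
    and u1 u2 :: "complex \<Rightarrow> real" and h :: real and f :: "complex \<Rightarrow> complex"
  assumes "quadrilateral \<Omega> z1 z2 z3 z4"
    and "quad_dirichlet_neumann_solution \<Omega> z1 z2 z3 z4 u1"
    and "h = quad_modulus \<Omega> z1 z2 z3 z4"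
    and "quad_dirichlet_neumann_solution \<Omega> z2 z3 z4 z1 u2"
    and "f = (\<lambda>z. of_real (u1 z) + \<i> * of_real h * of_real (u2 z))"
  shows "canonical_conformal_map \<Omega> z1 z2 z3 z4 h f \<and>
         (\<forall>F. canonical_conformal_map \<Omega> z1 z2 z3 z4 h F \<longrightarrow> (\<forall>z\<in>closure \<Omega>. F z = f z))"
proof -
  obtain \<gamma> t2 t3 t4 where pb: "positive_boundary \<Omega> \<gamma>" and t: "0 < t2" "t2 < t3" "t3 < t4" "t4 < 1"
    and z: "\<gamma> 0 = z1" "\<gamma> t2 = z2" "\<gamma> t3 = z3" "\<gamma> t4 = z4"
    using assms(1) unfolding quadrilateral_def by blast
  interpret jordan_curve \<gamma> using pb by (simp add: positive_boundary_def jordan_curve_def)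
  have \<Omega>: "\<Omega> = inside (path_image \<gamma>)" using pb by (simp add: positive_boundary_def)
  have pos: "winding_number \<gamma> z = 1" if "z \<in> inside (path_image \<gamma>)" for z
    using pb that by (simp add: positive_boundary_def)
  have sol1: "quad_dirichlet_neumann_solution (inside (path_image \<gamma>)) (\<gamma> 0) (\<gamma> t2) (\<gamma> t3) (\<gamma> t4) u1"
    and sol2: "quad_dirichlet_neumann_solution (inside (path_image \<gamma>)) (\<gamma> t2) (\<gamma> t3) (\<gamma> t4) (\<gamma> 0) u2"
    using assms(2,4) by (simp_all add: z \<Omega>)
  \<comment> \<open>Finiteness of the overlap of Dirichlet and Neumann parts is part of the problem;
    it identifies the boundary arcs with images of parameter intervals.\<close>
  have fin: "finite ((boundary_arc (inside (path_image \<gamma>)) (\<gamma> t2) (\<gamma> t3) \<union> boundary_arc (inside (path_image \<gamma>)) (\<gamma> t4) (\<gamma> 0)) \<inter>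
      (boundary_arc (inside (path_image \<gamma>)) (\<gamma> 0) (\<gamma> t2) \<union> boundary_arc (inside (path_image \<gamma>)) (\<gamma> t3) (\<gamma> t4)))"
    using sol1 unfolding quad_dirichlet_neumann_solution_def Let_def dirichlet_neumann_def by (elim conjE)
  have arcs: "boundary_arc (inside (path_image \<gamma>)) (\<gamma> 0) (\<gamma> t2) = \<gamma> ` {0..t2}" "boundary_arc (inside (path_image \<gamma>)) (\<gamma> t2) (\<gamma> t3) = \<gamma> ` {t2..t3}"
      "boundary_arc (inside (path_image \<gamma>)) (\<gamma> t3) (\<gamma> t4) = \<gamma> ` {t3..t4}" "boundary_arc (inside (path_image \<gamma>)) (\<gamma> t4) (\<gamma> 0) = \<gamma> ` {t4..1}"
    by (rule boundary_arcs[OF pos t fin]; assumption)+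
  define G1 where "G1 = \<gamma> ` {0..t2}"
  define G2 where "G2 = \<gamma> ` {t2..t3}"
  define G3 where "G3 = \<gamma> ` {t3..t4}"
  define G4 where "G4 = \<gamma> ` {t4..1}"
  note Gs = G1_def G2_def G3_def G4_def
  have dn1: "harmonic_on u1 (inside (path_image \<gamma>))"
      "dirichlet_neumann (inside (path_image \<gamma>)) (G2 \<union> G4) (G1 \<union> G3) (\<lambda>t. if t \<in> G4 then 1 else 0) (\<lambda>t. 0) u1"
    by (rule sol1[unfolded quad_dirichlet_neumann_solution_def Let_def arcs Gs[symmetric], THEN conjunct1],
        rule sol1[unfolded quad_dirichlet_neumann_solution_def Let_def arcs Gs[symmetric], THEN conjunct2])
  have dn2: "harmonic_on u2 (inside (path_image \<gamma>))"
      "dirichlet_neumann (inside (path_image \<gamma>)) (G3 \<union> G1) (G2 \<union> G4) (\<lambda>t. if t \<in> G1 then 1 else 0) (\<lambda>t. 0) u2"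
    by (rule sol2[unfolded quad_dirichlet_neumann_solution_def Let_def arcs Gs[symmetric], THEN conjunct1],
        rule sol2[unfolded quad_dirichlet_neumann_solution_def Let_def arcs Gs[symmetric], THEN conjunct2])
  define E where "E = {p \<in> frontier (inside (path_image \<gamma>)). \<nexists>n. exterior_normal (inside (path_image \<gamma>)) p n} \<union> ((G2 \<union> G4) \<inter> (G1 \<union> G3))"
  have E2: "E = {p \<in> frontier (inside (path_image \<gamma>)). \<nexists>n. exterior_normal (inside (path_image \<gamma>)) p n} \<union> ((G3 \<union> G1) \<inter> (G2 \<union> G4))"
    unfolding E_def by blast
  obtain f1 where f1: "f1 holomorphic_on inside (path_image \<gamma>)" "\<And>z. z \<in> inside (path_image \<gamma>) \<Longrightarrow> Re (f1 z) = u1 z"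
      "\<And>p. p \<in> path_image \<gamma> - E \<Longrightarrow> \<exists>l. (f1 \<longlongrightarrow> l) (at p within inside (path_image \<gamma>))"
      "\<And>a b. \<lbrakk>0 \<le> a; a < b; b \<le> 1; \<gamma> ` {a..b} \<subseteq> G1 \<union> G3\<rbrakk> \<Longrightarrow>
         \<exists>y. \<forall>t\<in>{a<..<b}. (f1 \<longlongrightarrow> Complex (u1 (\<gamma> t)) y) (at (\<gamma> t) within inside (path_image \<gamma>))"
    by (rule dirichlet_neumann_data[OF dn1 E_def]) (rule that; assumption)
  obtain f2 where f2: "f2 holomorphic_on inside (path_image \<gamma>)" "\<And>z. z \<in> inside (path_image \<gamma>) \<Longrightarrow> Re (f2 z) = u2 z"
      "\<And>p. p \<in> path_image \<gamma> - E \<Longrightarrow> \<exists>l. (f2 \<longlongrightarrow> l) (at p within inside (path_image \<gamma>))"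
      "\<And>a b. \<lbrakk>0 \<le> a; a < b; b \<le> 1; \<gamma> ` {a..b} \<subseteq> G2 \<union> G4\<rbrakk> \<Longrightarrow>
         \<exists>y. \<forall>t\<in>{a<..<b}. (f2 \<longlongrightarrow> Complex (u2 (\<gamma> t)) y) (at (\<gamma> t) within inside (path_image \<gamma>))"
    by (rule dirichlet_neumann_data[OF dn2 E2]) (rule that; assumption)
  have cont: "continuous_on (closure (inside (path_image \<gamma>))) u1" "continuous_on (closure (inside (path_image \<gamma>))) u2"
    and reg: "regular_domain (inside (path_image \<gamma>))" and finA: "finite ((G2 \<union> G4) \<inter> (G1 \<union> G3))"
    and fr: "frontier (inside (path_image \<gamma>)) = (G2 \<union> G4) \<union> (G1 \<union> G3)"
    and val1: "\<And>t. t \<in> G2 \<union> G4 \<Longrightarrow> u1 t = (if t \<in> G4 then 1 else 0)"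
    and val2: "\<And>t. t \<in> G3 \<union> G1 \<Longrightarrow> u2 t = (if t \<in> G1 then 1 else 0)"
    using dn1(2) dn2(2) unfolding dirichlet_neumann_def by blast+
  have fE: "finite E" unfolding E_def using finitely_many_without_normal[OF reg] finA by blast
  have EJ: "E \<subseteq> path_image \<gamma>" unfolding E_def using fr domain_facts(5) by blast
  have corners: "{\<gamma> 0, \<gamma> t2, \<gamma> t3, \<gamma> t4} \<subseteq> E"
  proof -
    have "\<gamma> 0 \<in> G1" "\<gamma> 1 \<in> G4" "\<gamma> t2 \<in> G1" "\<gamma> t2 \<in> G2" "\<gamma> t3 \<in> G2" "\<gamma> t3 \<in> G3" "\<gamma> t4 \<in> G3" "\<gamma> t4 \<in> G4"
      using t by (auto simp: Gs)
    then show ?thesis unfolding E_def using endpoints by auto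
  qed
  have u1: "u1 (\<gamma> s) = 0" if s: "s \<in> {t2..t3}" for s
  proof -
    have "\<gamma> s \<notin> G4"
    proof
      assume "\<gamma> s \<in> G4"
      then obtain r where "r \<in> {t4..1}" "\<gamma> s = \<gamma> r" unfolding G4_def by blast
      then show False using injD[of s r] s t by auto
    qed
    then show ?thesis using val1[of "\<gamma> s"] s by (auto simp: G2_def)
  qed
  have u1': "u1 (\<gamma> s) = 1" if "s \<in> {t4..1}" for s using val1[of "\<gamma> s"] that by (auto simp: G4_def)
  have u2: "u2 (\<gamma> s) = 0" if s: "s \<in> {t3..t4}" for s
  proof -
    have "\<gamma> s \<notin> G1"
    proof
      assume "\<gamma> s \<in> G1"
      then obtain r where "r \<in> {0..t2}" "\<gamma> s = \<gamma> r" unfolding G1_def by blast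
      then show False using injD[of s r] s t by auto
    qed
    then show ?thesis using val2[of "\<gamma> s"] s by (auto simp: G3_def)
  qed
  have u2': "u2 (\<gamma> s) = 1" if "s \<in> {0..t2}" for s using val2[of "\<gamma> s"] that by (auto simp: G1_def)
  \<comment> \<open>The Neumann arcs of \<open>u1\<close> are the first and the third, those of
    \<open>u2\<close> the second and the fourth; the limits cover all interior parameters,
    exceptional points included.\<close>
  have "\<exists>y. \<forall>s\<in>{0<..<t2}. (f1 \<longlongrightarrow> Complex (u1 (\<gamma> s)) y) (at (\<gamma> s) within inside (path_image \<gamma>))"
    by (rule f1(4)) (use t in \<open>auto simp: G1_def\<close>)
  then obtain b1 where b1: "\<And>s. s \<in> {0<..<t2} \<Longrightarrow> (f1 \<longlongrightarrow> Complex (u1 (\<gamma> s)) b1) (at (\<gamma> s) within inside (path_image \<gamma>))"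
    by blast
  have "\<exists>y. \<forall>s\<in>{t3<..<t4}. (f1 \<longlongrightarrow> Complex (u1 (\<gamma> s)) y) (at (\<gamma> s) within inside (path_image \<gamma>))"
    by (rule f1(4)) (use t in \<open>auto simp: G3_def\<close>)
  then obtain b3 where b3: "\<And>s. s \<in> {t3<..<t4} \<Longrightarrow> (f1 \<longlongrightarrow> Complex (u1 (\<gamma> s)) b3) (at (\<gamma> s) within inside (path_image \<gamma>))"
    by blast
  have "\<exists>y. \<forall>s\<in>{t2<..<t3}. (f2 \<longlongrightarrow> Complex (u2 (\<gamma> s)) y) (at (\<gamma> s) within inside (path_image \<gamma>))"
    by (rule f2(4)) (use t in \<open>auto simp: G2_def\<close>)
  then obtain d2 where d2: "\<And>s. s \<in> {t2<..<t3} \<Longrightarrow> (f2 \<longlongrightarrow> Complex (u2 (\<gamma> s)) d2) (at (\<gamma> s) within inside (path_image \<gamma>))"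
    by blast
  have "\<exists>y. \<forall>s\<in>{t4<..<1}. (f2 \<longlongrightarrow> Complex (u2 (\<gamma> s)) y) (at (\<gamma> s) within inside (path_image \<gamma>))"
    by (rule f2(4)) (use t in \<open>auto simp: G4_def\<close>)
  then obtain d4 where d4: "\<And>s. s \<in> {t4<..<1} \<Longrightarrow> (f2 \<longlongrightarrow> Complex (u2 (\<gamma> s)) d4) (at (\<gamma> s) within inside (path_image \<gamma>))"
    by blast
  define c where "c = b1 - b3"
  have im: "Im (f1 z) = c * u2 z + b3" if "z \<in> inside (path_image \<gamma>)" for z
    unfolding c_def
    by (rule conjugate_is_multiple[where ?u1.0 = u1 and ?u2.0 = u2 and E = E, OF t f1(1) f2(1) f1(2) f2(2) cont fE EJ corners
          f1(3) f2(3) u1 u1' u2 u2' b1 b3 d2 d4 that])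
  define k where "k = (\<lambda>z. complex_of_real (u1 z) + \<i> * of_real c * of_real (u2 z))"
  \<comment> \<open>A conjugate is determined up to a constant; subtracting \<open>\<i> * b3\<close>
    puts the third arc on the real axis and exhibits \<open>k\<close> as holomorphic.\<close>
  have keq: "f1 z - \<i> * of_real b3 = k z" if "z \<in> inside (path_image \<gamma>)" for z
    using im[OF that] f1(2)[OF that] by (simp add: k_def complex_eq_iff)
  have holk: "k holomorphic_on inside (path_image \<gamma>)"
    by (rule holomorphic_transform[OF _ keq]) (intro holomorphic_intros f1(1))
  have contk: "continuous_on (closure (inside (path_image \<gamma>))) k"
    unfolding k_def by (intro continuous_intros cont)
  have kb: "\<And>s. s \<in> {0..t2} \<Longrightarrow> Im (k (\<gamma> s)) = c" "\<And>s. s \<in> {t2..t3} \<Longrightarrow> Re (k (\<gamma> s)) = 0"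
      "\<And>s. s \<in> {t3..t4} \<Longrightarrow> Im (k (\<gamma> s)) = 0" "\<And>s. s \<in> {t4..1} \<Longrightarrow> Re (k (\<gamma> s)) = 1"
    using u1 u1' u2 u2' by (simp_all add: k_def)
  have canon: "canonical_conformal_map \<Omega> z1 z2 z3 z4 c k"
    unfolding \<Omega> z[symmetric] by (rule conformal_onto_rectangle[OF pos t holk contk kb])
  have unique: "h' = c" "\<And>z. z \<in> closure \<Omega> \<Longrightarrow> F z = k z" if "canonical_conformal_map \<Omega> z1 z2 z3 z4 h' F" for h' F
    using canonical_conformal_map_unique[OF t holk contk kb, of h' F] that unfolding \<Omega> z[symmetric] by blast+
  have "h = c"
    unfolding assms(3) quad_modulus_def using canon unique(1) by (intro the_equality) blast+
  then have "f = k" by (simp add: assms(5) k_def)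
  then show ?thesis using canon unique(2) \<open>h = c\<close> by blast
qed

end
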